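(* Let $J$ be a bounded half-line Jacobi matrix with coefficients $a(n),b(n)$, and let $w_\pm^{(N)}$, $g_N$, $d\nu_N$, $dk_N$ be the associated objects defined in the context. Let $N_j\to\infty$ be a sequence such that, as $j\to\infty$: $w_\pm^{(N_j)}\to w_\pm$ and $g_{N_j}\to g$ uniformly on compact subsets of $\mathbb{C}^+$ for some $w_+,w_-,g\in\mathcal{H}$; $d\nu_{N_j}\to d\nu$ and $dk_{N_j}\to d\widetilde{k}$ in weak $*$ sense for some Borel probability measures $d\nu,d\widetilde{k}$ on $\mathbb{R}$; and $(a(1)\cdots a(N_j))^{1/N_j}\to A$ for some $A>0$. Introduce $\gamma, k: \mathbb{C}^+\to\mathbb{R}$ by writing $w_+$ as $$w_+(z) = -\gamma(z) + i\pi k(z) .$$ Then $k(t)\equiv\lim_{y\to 0+} k(t+iy)$ exists for every $t\in\mathbb{R}$, $k(t)$ is an increasing function, $-iw_+,w_+'\in\mathcal{H}$, and the following identities hold (for all $z\in\mathbb{C}^+$, with $dk$ the Lebesgue–Stieltjes measure of $t\mapsto k(t)$): $$w_+(z)+w_-(z) \equiv i\pi, \qquad g(z)=w_+'(z), \qquad d\widetilde{k}=d\nu=dk,$$ $$g(z) = \int_{-\infty}^{\infty} \frac{dk(t)}{t-z},$$ $$w_+(z) = \ln A - \int_{-\infty}^{\infty} \ln (t-z)\, dk(t).$$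
   Context: $\mathcal{H}$ is the set of Herglotz functions, i.e. holomorphic maps of $\mathbb{C}^+=\{z\in\mathbb{C}:\operatorname{Im}z>0\}$ to itself. Logarithms: $\operatorname{Im}\ln\zeta\in(0,\pi)$ for $\zeta\in\mathbb{C}^+$, and for $\zeta$ in the open lower half plane, $\ln\zeta=-\ln\zeta^{-1}$. $J$ is a half-line Jacobi matrix on $\ell_2(\mathbb{Z}_+)$, $\mathbb{Z}_+=\{1,2,\dots\}$: $(Ju)(n)=a(n)u(n+1)+a(n-1)u(n-1)+b(n)u(n)$ (term with $u(n-1)$ omitted for $n=1$), with real coefficients satisfying $(M+1)^{-1}\le a(n)\le M+1$, $|b(n)|\le M$ for some $M>0$. Put $a(0)=1$. For $z\in\mathbb{C}^+$ let $f_\pm(n,z)$ be the solutions of $a(n)f(n+1)+a(n-1)f(n-1)+b(n)f(n)=zf(n)$ ($n\ge1$) with $f_-(0,z)=0$, $f_-(1,z)=1$, $f_+(0,z)=1$, $f_+(1,z)=-m_+(z)$, where $m_+(z)=\langle\delta_1,(J-z)^{-1}\delta_1\rangle$. Then $f_\pm(n,z)\ne0$ for $n\ge1$ and $m_\pm(n,z)=\mp \frac{f_\pm(n+1,z)}{a(n)f_\pm(n,z)}$ are Herglotz functions. Put $$w_\pm^{(N)}(z)=\frac1N\sum_{n=1}^N\ln\left[a(n)m_\pm(n,z)\right],\qquad g_N(z)=\frac1N\sum_{n=1}^N\langle\delta_n,(J-z)^{-1}\delta_n\rangle=\int_{\mathbb{R}}\frac{d\nu_N(t)}{t-z},$$ where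 $d\nu_N(t)=\frac1N\sum_{n=1}^N d\|E(t)\delta_n\|^2$ and $E$ is the spectral resolution of $J$. Finally $dk_N=\frac1N\sum_{n=1}^N\delta_{\lambda_n^{(N)}}$, where $\lambda_1^{(N)},\dots,\lambda_N^{(N)}$ are the eigenvalues of the truncation of $J$ to $\ell_2(\{1,\dots,N\})$ with boundary conditions $u(0)=u(N+1)=0$. *)

theory Defs
  imports "HOL-Probability.Probability" "HOL-Complex_Analysis.Complex_Analysis"
begin

definition upper_half_plane :: "complex set" where
  "upper_half_plane = {z. Im z > 0}"

definition herglotz :: "(complex \<Rightarrow> complex) \<Rightarrow> bool" where
  "herglotz f \<longleftrightarrow> f holomorphic_on upper_half_plane \<and> f ` upper_half_plane \<subseteq> upper_half_plane"

text \<open>Sequences are indexed by \<open>nat\<close>; the coordinate with index 0 is a dummy that is fixed to 0.\<close>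

definition ell2 :: "(nat \<Rightarrow> complex) set" where
  "ell2 = {u. u 0 = 0 \<and> summable (\<lambda>n. (cmod (u n))\<^sup>2)}"

definition ell2_inner :: "(nat \<Rightarrow> complex) \<Rightarrow> (nat \<Rightarrow> complex) \<Rightarrow> complex" where
  "ell2_inner u v = (\<Sum>n. cnj (u n) * v n)"

definition ell2_norm :: "(nat \<Rightarrow> complex) \<Rightarrow> real" where
  "ell2_norm u = sqrt (\<Sum>n. (cmod (u n))\<^sup>2)"

definition delta :: "nat \<Rightarrow> nat \<Rightarrow> complex" where
  "delta m = (\<lambda>n. if n = m then 1 else 0)"

definition ell2_linear :: "((nat \<Rightarrow> complex) \<Rightarrow> (nat \<Rightarrow> complex)) \<Rightarrow> bool" where
  "ell2_linear T \<longleftrightarrow>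
     (\<forall>u\<in>ell2. T u \<in> ell2) \<and>
     (\<forall>u\<in>ell2. \<forall>v\<in>ell2. T (\<lambda>n. u n + v n) = (\<lambda>n. T u n + T v n)) \<and>
     (\<forall>u\<in>ell2. \<forall>c. T (\<lambda>n. c * u n) = (\<lambda>n. c * T u n))"

definition ell2_projection :: "((nat \<Rightarrow> complex) \<Rightarrow> (nat \<Rightarrow> complex)) \<Rightarrow> bool" where
  "ell2_projection P \<longleftrightarrow>
     ell2_linear P \<and>
     (\<forall>u\<in>ell2. P (P u) = P u) \<and>
     (\<forall>u\<in>ell2. \<forall>v\<in>ell2. ell2_inner (P u) v = ell2_inner u (P v))"

text \<open>
  \<open>E\<close> is the spectral resolution of the bounded self-adjoint operator \<open>T\<close>: an increasing, strongly
  right-continuous family of orthogonal projections with strong limits 0 and 1 at minus and plus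
  infinity, such that \<open>T\<close> is the integral of \<open>t dE(t)\<close>. The last condition is stated for
  the quadratic form, which determines \<open>T\<close> by polarization; since \<open>E(t)\<close> is an orthogonal
  projection, the distribution function of \<open>d\<langle>u, E(t) u\<rangle>\<close> is the squared norm of \<open>E(t) u\<close>.
\<close>

definition spectral_resolution ::
  "((nat \<Rightarrow> complex) \<Rightarrow> (nat \<Rightarrow> complex)) \<Rightarrow> (real \<Rightarrow> (nat \<Rightarrow> complex) \<Rightarrow> (nat \<Rightarrow> complex)) \<Rightarrow> bool" where
  "spectral_resolution T E \<longleftrightarrow>
     (\<forall>t. ell2_projection (E t)) \<and>
     (\<forall>s t. s \<le> t \<longrightarrow> (\<forall>u\<in>ell2. E s (E t u) = E s u \<and> E t (E s u) = E s u)) \<and>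
     (\<forall>t. \<forall>u\<in>ell2. ((\<lambda>s. ell2_norm (\<lambda>n. E s u n - E t u n)) \<longlongrightarrow> 0) (at_right t)) \<and>
     (\<forall>u\<in>ell2. ((\<lambda>t. ell2_norm (E t u)) \<longlongrightarrow> 0) at_bot) \<and>
     (\<forall>u\<in>ell2. ((\<lambda>t. ell2_norm (\<lambda>n. E t u n - u n)) \<longlongrightarrow> 0) at_top) \<and>
     (\<forall>u\<in>ell2.
        integrable (interval_measure (\<lambda>t. (ell2_norm (E t u))\<^sup>2)) (\<lambda>t. t) \<and>
        ell2_inner u (T u) =
          complex_of_real (\<integral>t. t \<partial>interval_measure (\<lambda>t. (ell2_norm (E t u))\<^sup>2)))"

definition jacobi_coefficients :: "(nat \<Rightarrow> real) \<Rightarrow> (nat \<Rightarrow> real) \<Rightarrow> bool" where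
  "jacobi_coefficients a b \<longleftrightarrow>
     a 0 = 1 \<and>
     (\<exists>M>0. \<forall>n\<ge>1. inverse (M + 1) \<le> a n \<and> a n \<le> M + 1 \<and> \<bar>b n\<bar> \<le> M)"

definition jacobi_op :: "(nat \<Rightarrow> real) \<Rightarrow> (nat \<Rightarrow> real) \<Rightarrow> (nat \<Rightarrow> complex) \<Rightarrow> (nat \<Rightarrow> complex)" where
  "jacobi_op a b u = (\<lambda>n.
     if n = 0 then 0
     else of_real (a n) * u (n + 1) + (if n = 1 then 0 else of_real (a (n - 1)) * u (n - 1))
          + of_real (b n) * u n)"

definition resolvent ::
  "(nat \<Rightarrow> real) \<Rightarrow> (nat \<Rightarrow> real) \<Rightarrow> complex \<Rightarrow> (nat \<Rightarrow> complex) \<Rightarrow> (nat \<Rightarrow> complex)" where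
  "resolvent a b z = inv_into ell2 (\<lambda>u n. jacobi_op a b u n - z * u n)"

definition green :: "(nat \<Rightarrow> real) \<Rightarrow> (nat \<Rightarrow> real) \<Rightarrow> nat \<Rightarrow> complex \<Rightarrow> complex" where
  "green a b n z = ell2_inner (delta n) (resolvent a b z (delta n))"

fun jacobi_sol ::
  "(nat \<Rightarrow> real) \<Rightarrow> (nat \<Rightarrow> real) \<Rightarrow> complex \<Rightarrow> complex \<Rightarrow> complex \<Rightarrow> nat \<Rightarrow> complex" where
  "jacobi_sol a b z c0 c1 0 = c0"
| "jacobi_sol a b z c0 c1 (Suc 0) = c1"
| "jacobi_sol a b z c0 c1 (Suc (Suc n)) =
     ((z - of_real (b (Suc n))) * jacobi_sol a b z c0 c1 (Suc n)
      - of_real (a n) * jacobi_sol a b z c0 c1 n) / of_real (a (Suc n))"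

lemma jacobi_sol_unique:
  assumes "\<And>n. n \<ge> 1 \<Longrightarrow> a n \<noteq> 0"
  shows "f = jacobi_sol a b z c0 c1 \<longleftrightarrow>
    f 0 = c0 \<and> f 1 = c1 \<and>
    (\<forall>n\<ge>1. of_real (a n) * f (n + 1) + of_real (a (n - 1)) * f (n - 1) + of_real (b n) * f n = z * f n)"
    (is "_ \<longleftrightarrow> ?R")
proof
  assume "f = jacobi_sol a b z c0 c1"
  moreover have "of_real (a n) * f (n + 1) + of_real (a (n - 1)) * f (n - 1) + of_real (b n) * f n = z * f n"
    if "f = jacobi_sol a b z c0 c1" "n \<ge> 1" for n
    using that assms[of n] by (cases n) (auto simp: field_simps)
  ultimately show ?R by simp
next
  assume R: ?R
  have "f n = jacobi_sol a b z c0 c1 n \<and> f (Suc n) = jacobi_sol a b z c0 c1 (Suc n)" for n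
  proof (induction n)
    case 0
    then show ?case using R by simp
  next
    case (Suc n)
    have "of_real (a (Suc n)) * f (Suc (Suc n)) + of_real (a n) * f n + of_real (b (Suc n)) * f (Suc n)
      = z * f (Suc n)"
      using R by force
    moreover have "complex_of_real (a (Suc n)) \<noteq> 0" using assms[of "Suc n"] by simp
    ultimately have "f (Suc (Suc n)) =
       ((z - of_real (b (Suc n))) * f (Suc n) - of_real (a n) * f n) / of_real (a (Suc n))"
      by (simp add: nonzero_eq_divide_eq algebra_simps)
    then show ?case using Suc by simp
  qed
  then show "f = jacobi_sol a b z c0 c1" by blast
qed

definition f_minus :: "(nat \<Rightarrow> real) \<Rightarrow> (nat \<Rightarrow> real) \<Rightarrow> nat \<Rightarrow> complex \<Rightarrow> complex" where
  "f_minus a b n z = jacobi_sol a b z 0 1 n"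

definition f_plus :: "(nat \<Rightarrow> real) \<Rightarrow> (nat \<Rightarrow> real) \<Rightarrow> nat \<Rightarrow> complex \<Rightarrow> complex" where
  "f_plus a b n z = jacobi_sol a b z 1 (- green a b 1 z) n"

definition m_minus :: "(nat \<Rightarrow> real) \<Rightarrow> (nat \<Rightarrow> real) \<Rightarrow> nat \<Rightarrow> complex \<Rightarrow> complex" where
  "m_minus a b n z = f_minus a b (n + 1) z / (of_real (a n) * f_minus a b n z)"

definition m_plus :: "(nat \<Rightarrow> real) \<Rightarrow> (nat \<Rightarrow> real) \<Rightarrow> nat \<Rightarrow> complex \<Rightarrow> complex" where
  "m_plus a b n z = - f_plus a b (n + 1) z / (of_real (a n) * f_plus a b n z)"

definition w_minus_avg :: "(nat \<Rightarrow> real) \<Rightarrow> (nat \<Rightarrow> real) \<Rightarrow> nat \<Rightarrow> complex \<Rightarrow> complex" where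
  "w_minus_avg a b N z = (1 / of_nat N) * (\<Sum>n=1..N. Ln (of_real (a n) * m_minus a b n z))"

definition w_plus_avg :: "(nat \<Rightarrow> real) \<Rightarrow> (nat \<Rightarrow> real) \<Rightarrow> nat \<Rightarrow> complex \<Rightarrow> complex" where
  "w_plus_avg a b N z = (1 / of_nat N) * (\<Sum>n=1..N. Ln (of_real (a n) * m_plus a b n z))"

definition g_avg :: "(nat \<Rightarrow> real) \<Rightarrow> (nat \<Rightarrow> real) \<Rightarrow> nat \<Rightarrow> complex \<Rightarrow> complex" where
  "g_avg a b N z = (1 / of_nat N) * (\<Sum>n=1..N. green a b n z)"

definition nu_avg :: "(real \<Rightarrow> (nat \<Rightarrow> complex) \<Rightarrow> (nat \<Rightarrow> complex)) \<Rightarrow> nat \<Rightarrow> real measure" where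
  "nu_avg E N = interval_measure (\<lambda>t. (1 / real N) * (\<Sum>n=1..N. (ell2_norm (E t (delta n)))\<^sup>2))"

definition truncation_eigenvalues :: "(nat \<Rightarrow> real) \<Rightarrow> (nat \<Rightarrow> real) \<Rightarrow> nat \<Rightarrow> real set" where
  "truncation_eigenvalues a b N = {x. \<exists>u :: nat \<Rightarrow> complex.
     u 0 = 0 \<and> u (N + 1) = 0 \<and> (\<exists>n\<in>{1..N}. u n \<noteq> 0) \<and>
     (\<forall>n\<in>{1..N}. of_real (a n) * u (n + 1) + of_real (a (n - 1)) * u (n - 1) + of_real (b n) * u n
        = of_real x * u n)}"

text \<open>
  Because the off-diagonal coefficients do not vanish, an eigenvector is determined by its first
  entry. So the eigenvalues of the truncation (a Hermitian \<open>N \<times> N\<close> matrix) are simple and real,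
  and summing over the set of eigenvalues is summing over all \<open>N\<close> of them.
\<close>

definition k_avg :: "(nat \<Rightarrow> real) \<Rightarrow> (nat \<Rightarrow> real) \<Rightarrow> nat \<Rightarrow> real measure" where
  "k_avg a b N = scale_measure (ennreal (1 / real N))
     (distr (count_space (truncation_eigenvalues a b N)) borel (\<lambda>x. x))"

text \<open>
  Weak-star convergence of finite Borel measures on the line, as functionals on the continuous
  functions vanishing at infinity.
\<close>

definition weak_star_conv :: "(nat \<Rightarrow> real measure) \<Rightarrow> real measure \<Rightarrow> bool" where
  "weak_star_conv \<mu> \<nu> \<longleftrightarrow>
     (\<forall>f :: real \<Rightarrow> real. continuous_on UNIV f \<and> (f \<longlongrightarrow> 0) at_infinity \<longrightarrow>
        (\<lambda>j. \<integral>x. f x \<partial>\<mu> j) \<longlonglongrightarrow> (\<integral>x. f x \<partial>\<nu>))"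

definition locally_uniform_conv ::
  "(nat \<Rightarrow> complex \<Rightarrow> complex) \<Rightarrow> (complex \<Rightarrow> complex) \<Rightarrow> bool" where
  "locally_uniform_conv f h \<longleftrightarrow>
     (\<forall>K. compact K \<and> K \<subseteq> upper_half_plane \<longrightarrow> uniform_limit K f h sequentially)"

text \<open>
  \<open>interval_measure\<close> is only meaningful for right-continuous functions; an increasing function
  is therefore replaced by its right limits, which does not change its Lebesgue--Stieltjes measure.
\<close>

definition stieltjes_measure :: "(real \<Rightarrow> real) \<Rightarrow> real measure" where
  "stieltjes_measure F = interval_measure (\<lambda>t. Lim (at_right t) F)"

end

theory Submission
  imports Defs "HOL-Computational_Algebra.Fundamental_Theorem_Algebra"
begin

text \<open>
  Write \<open>G(n)\<close> for the diagonal Green function. All identities are exact, or exact up to a bounded error,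
  before the average over \<open>n \<le> N\<close> is taken, and then survive the limit.

  \<^item> From \<open>a(n)\<^sup>2 m_plus m_minus = - G(n + 1) / G(n)\<close> the sum of \<open>w_plus\<close> and \<open>w_minus\<close> telescopes to \<open>i pi\<close> plus
    \<open>(Ln G(N + 1) - Ln G(1)) / N\<close>, and \<open>Ln G(n)\<close> is bounded in \<open>n\<close> (\<open>w_avg_sum\<close>, \<open>Ln_green_bound\<close>).

  \<^item> The product of the ratios \<open>f_minus (n + 1) / f_minus n\<close> is the characteristic polynomial of the
    truncation divided by \<open>a(1) ... a(N)\<close>. Hence \<open>w_minus\<close> is the logarithmic potential of the
    eigenvalue measure \<open>dk\<close> of the truncation, minus \<open>ln (a(1) ... a(N)) / N\<close> (\<open>w_minus_avg_eq\<close>). Since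
    the eigenvalues lie in a fixed compact interval, this formula passes to the limit, and with the
    first point it becomes the formula for \<open>w_plus\<close>.

  \<^item> The Christoffel--Darboux formula compares \<open>G(1) + ... + G(N)\<close> with the logarithmic derivative of the
    characteristic polynomial, with an error that does not grow with \<open>N\<close>
    (\<open>green_sum_log_derivative\<close>). Hence \<open>g = - w_minus' = w_plus'\<close>, and \<open>g\<close> is the Stieltjes transform of
    the limit of the eigenvalue measures.

  \<^item> The spectral theorem in the form \<open>\<langle>u, (T - z)\<^sup>-\<^sup>1 u\<rangle> = \<integral> d\<parallel>E(t) u\<parallel>\<^sup>2 / (t - z)\<close> (\<open>resolvent_form\<close>) shows that \<open>g\<close> is also
    the Stieltjes transform of \<open>\<nu>\<close>. A probability measure is determined by its Stieltjes transform
    (\<open>stieltjes_transform_unique\<close>), so the two limit measures agree.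

  \<^item> By the formula for \<open>w_plus\<close>, \<open>- pi k(z)\<close> is the average over \<open>dk(t)\<close> of the argument of \<open>t - z\<close>,
    which lies in \<open>(-pi, 0)\<close>. Its boundary values exist by dominated convergence and give for \<open>k\<close> the distribution
    function with midpoints at the jumps (\<open>arg_integral_boundary_value\<close>).

  \<^item> The solutions \<open>f_plus\<close> are square summable, hence bounded, which gives \<open>Re w_plus \<le> 0\<close>. The
    inequality is strict by the open mapping theorem, since \<open>w_plus' = g\<close> has no zeros; this is the
    Herglotz property of \<open>- i w_plus\<close>.

  The existence of the square summable solution, and with it of the resolvent, is obtained by
  exhausting the half-line by finite intervals (\<open>square_summable_weyl_exists\<close>).
\<close>

section \<open>Logarithms and limits in the upper half-plane\<close>

lemma Im_divide_eq: "y \<noteq> 0 \<Longrightarrow> Im (x / y) = Im (cnj y * x) / (cmod y)\<^sup>2"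
  by (simp add: Im_divide cmod_power2 algebra_simps)

lemma Im_mult_real_left: "Im (complex_of_real c * x) = c * Im x"
  by simp

lemma of_real_minus_nonzero: "Im z \<noteq> 0 \<Longrightarrow> complex_of_real s - z \<noteq> 0"
  by (auto simp: complex_eq_iff)

lemma Im_Ln_abs_le: "w \<noteq> 0 \<Longrightarrow> \<bar>Im (Ln w)\<bar> \<le> pi"
  using mpi_less_Im_Ln[of w] Im_Ln_le_pi[of w] by simp

text \<open>
  The principal branch at \<open>t - z\<close>, whose argument lies in \<open>(-pi, 0)\<close>.
\<close>

lemma Ln_lower_arg:
  assumes z: "Im z > 0"
  shows "Ln (of_real t - z) = Ln (z - of_real t) - \<i> * of_real pi"
proof -
  have "z - of_real t \<noteq> 0" using z by (auto simp: complex_eq_iff)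
  then have "Ln (- (z - of_real t)) = Ln (z - of_real t) - \<i> * of_real pi"
    using z by (subst Ln_minus) auto
  then show ?thesis by simp
qed

text \<open>
  The two sides have equal exponentials, and the imaginary parts of both lie in \<open>(0, 2 pi)\<close>, so no
  multiple of \<open>2 pi i\<close> can separate them.
\<close>

lemma Ln_add_eq_of_mult_eq:
  assumes im: "Im q > 0" "Im r > 0" "Im G > 0" "Im G' > 0" and eq: "q * r * G = - G'"
  shows "Ln q + Ln r = \<i> * of_real pi + Ln G' - Ln G"
proof (rule exp_complex_eqI)
  have bnd: "0 < Im (Ln x) \<and> Im (Ln x) < pi" if "Im x > 0" for x
    using that Im_Ln_pos_lt_imp[of x] Im_Ln_pos_lt[of x] by fastforce
  show "\<bar>Im (Ln q + Ln r) - Im (\<i> * of_real pi + Ln G' - Ln G)\<bar> < 2 * pi"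
    using bnd[OF im(1)] bnd[OF im(2)] bnd[OF im(3)] bnd[OF im(4)] by (simp add: abs_less_iff)
  have nz: "q \<noteq> 0" "r \<noteq> 0" "G \<noteq> 0" "G' \<noteq> 0" using im by auto
  have "exp (\<i> * of_real pi + Ln G' - Ln G) = - G' / G"
    using nz by (simp add: exp_add exp_diff mult.commute[of \<i>])
  also have "\<dots> = q * r" using eq[symmetric] nz by simp
  also have "\<dots> = exp (Ln q + Ln r)" using nz by (simp add: exp_add)
  finally show "exp (Ln q + Ln r) = exp (\<i> * of_real pi + Ln G' - Ln G)" by simp
qed

lemma Ln_divide_upper_half_plane:
  assumes "Im p > 0" "Im q > 0"
  shows "Ln (p / q) = Ln p - Ln q"
proof (rule exp_complex_eqI)
  have nz: "p \<noteq> 0" "q \<noteq> 0" using assms by auto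
  then show "exp (Ln (p / q)) = exp (Ln p - Ln q)" by (simp add: exp_diff)
  have "0 < Im (Ln x) \<and> Im (Ln x) < pi" if "Im x > 0" for x
    using that Im_Ln_pos_lt_imp[of x] Im_Ln_pos_lt[of x] by fastforce
  from this[OF assms(1)] this[OF assms(2)]
  show "\<bar>Im (Ln (p / q)) - Im (Ln p - Ln q)\<bar> < 2 * pi"
    using mpi_less_Im_Ln[of "p / q"] Im_Ln_le_pi[of "p / q"] nz by (simp add: abs_less_iff)
qed

text \<open>
  This removes the divergence of \<open>Ln (h y)\<close> along the imaginary axis, for a function \<open>h\<close> that grows
  linearly there. It is used to identify branches of sums of logarithms.
\<close>

lemma Ln_diff_tendsto:
  assumes lim: "((\<lambda>y. h y / (\<i> * of_real y)) \<longlongrightarrow> of_real c) at_top" and c: "c > 0"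
    and pos: "\<And>y. y > 0 \<Longrightarrow> Im (h y) > 0"
  shows "((\<lambda>y. Ln (h y) - Ln (\<i> * of_real y)) \<longlongrightarrow> of_real (ln c)) at_top"
proof -
  have "((\<lambda>y. Ln (h y / (\<i> * of_real y))) \<longlongrightarrow> Ln (of_real c)) at_top"
    using c by (intro tendsto_Ln lim) auto
  moreover have "Ln (of_real c) = complex_of_real (ln c)" using c by (simp add: Ln_of_real)
  moreover have "\<forall>\<^sub>F y in at_top. Ln (h y / (\<i> * of_real y)) = Ln (h y) - Ln (\<i> * of_real y)"
    using eventually_gt_at_top[of 0]
    by eventually_elim (intro Ln_divide_upper_half_plane pos, auto)
  ultimately show ?thesis using tendsto_cong by fastforce
qed

lemma open_upper_half_plane: "open upper_half_plane"
  and connected_upper_half_plane: "connected upper_half_plane"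
  unfolding upper_half_plane_def
  by (rule open_halfspace_Im_gt) (rule convex_connected[OF convex_halfspace_Im_gt])

lemma locally_uniform_conv_pointwise:
  assumes "locally_uniform_conv f h" and "Im z > 0"
  shows "(\<lambda>j. f j z) \<longlonglongrightarrow> h z"
proof -
  have "uniform_limit {z} f h sequentially"
    using assms(1)[unfolded locally_uniform_conv_def, rule_format, of "{z}"] assms(2)
    by (simp add: upper_half_plane_def)
  then show ?thesis by (rule tendsto_uniform_limitI) simp
qed

text \<open>
  Weierstrass: locally uniform convergence of holomorphic functions passes to the derivatives.
\<close>

lemma locally_uniform_conv_derivative:
  assumes conv: "locally_uniform_conv f h"
    and deriv: "\<And>j z. Im z > 0 \<Longrightarrow> (f j has_field_derivative f' j z) (at z)"
    and z: "Im z > 0"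
  obtains d where "(h has_field_derivative d) (at z)" "(\<lambda>j. f' j z) \<longlonglongrightarrow> d"
proof -
  have "\<exists>d>0. cball x d \<subseteq> upper_half_plane \<and> uniform_limit (cball x d) f h sequentially"
    if x: "x \<in> upper_half_plane" for x
  proof -
    obtain d where "d > 0" "cball x d \<subseteq> upper_half_plane"
      using open_upper_half_plane x by (meson open_contains_cball)
    then show ?thesis using conv by (auto simp: locally_uniform_conv_def)
  qed
  then have "\<exists>g'. \<forall>x\<in>upper_half_plane. (h has_field_derivative g' x) (at x) \<and> (\<lambda>j. f' j x) \<longlonglongrightarrow> g' x"
    using deriv by (intro has_complex_derivative_uniform_sequence open_upper_half_plane)
      (auto simp: upper_half_plane_def)
  then show ?thesis using z that by (auto simp: upper_half_plane_def)
qed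

text \<open>
  A strict version of the maximum principle: by the open mapping theorem, a nonconstant holomorphic
  function cannot attain the boundary value of the half-plane that contains its range.
\<close>

lemma Re_negative_of_nonpositive:
  assumes deriv: "\<And>z. Im z > 0 \<Longrightarrow> (w has_field_derivative g z) (at z)"
    and nz: "\<And>z. Im z > 0 \<Longrightarrow> g z \<noteq> 0"
    and le: "\<And>z. Im z > 0 \<Longrightarrow> Re (w z) \<le> 0" and z: "Im z > 0"
  shows "Re (w z) < 0"
proof -
  let ?U = upper_half_plane
  have hol: "w holomorphic_on ?U"
    using deriv open_upper_half_plane by (auto simp: holomorphic_on_open upper_half_plane_def)
  have "\<not> w constant_on ?U"
  proof
    assume "w constant_on ?U"
    then obtain c where c: "\<And>x. x \<in> ?U \<Longrightarrow> w x = c" by (auto simp: constant_on_def)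
    have zU: "z \<in> ?U" using z by (simp add: upper_half_plane_def)
    have "((\<lambda>_. c) has_field_derivative g z) (at z)"
      by (rule has_field_derivative_transform_within_open[OF deriv[OF z] open_upper_half_plane zU c])
    then have "g z = 0" using DERIV_const DERIV_unique by blast
    then show False using nz[OF z] by simp
  qed
  \<comment> \<open>A point with \<open>Re (w z) = 0\<close> would be interior to the image.\<close>
  then have "open (w ` ?U)"
    by (intro open_mapping_thm[OF hol open_upper_half_plane connected_upper_half_plane open_upper_half_plane]) auto
  moreover have "w z \<in> w ` ?U" using z by (simp add: upper_half_plane_def)
  ultimately obtain e where e: "e > 0" "cball (w z) e \<subseteq> w ` ?U" by (meson open_contains_cball)
  have "w z + of_real e \<in> cball (w z) e" using e by (simp add: dist_norm)
  then obtain x where "x \<in> ?U" "w x = w z + of_real e" using e by force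
  then show ?thesis using le[of x] e by (auto simp: upper_half_plane_def)
qed

section \<open>The Stieltjes transform in terms of the distribution function\<close>

lemma cauchy_kernel_norm: "Im z > 0 \<Longrightarrow> norm (1 / (of_real s - z)\<^sup>2) = 1 / ((s - Re z)\<^sup>2 + (Im z)\<^sup>2)"
  by (simp add: norm_divide norm_power cmod_power2)

lemma cauchy_kernel_integrable:
  assumes z: "Im z > 0"
  shows "integrable lborel (\<lambda>s. 1 / (complex_of_real s - z)\<^sup>2)"
proof -
  have "integrable lborel (\<lambda>x::real. inverse (1 + x\<^sup>2))"
    using integrable_inverse_1_plus_square by (simp add: set_integrable_def)
  then have "integrable lborel (\<lambda>x::real. (1 / (Im z)\<^sup>2) * inverse (1 + x\<^sup>2))" by simp
  then have "integrable lborel (\<lambda>s. (1 / (Im z)\<^sup>2) * inverse (1 + (- Re z / Im z + (1 / Im z) * s)\<^sup>2))"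
    using z by (subst lborel_integrable_real_affine_iff) auto
  then show ?thesis
  proof (rule Bochner_Integration.integrable_bound)
    have "norm (1 / (complex_of_real s - z)\<^sup>2) = (1 / (Im z)\<^sup>2) * inverse (1 + (- Re z / Im z + (1 / Im z) * s)\<^sup>2)" for s
    proof -
      have "- Re z / Im z + (1 / Im z) * s = (s - Re z) / Im z" using z by (simp add: field_simps)
      moreover have "(Im z)\<^sup>2 * (1 + ((s - Re z) / Im z)\<^sup>2) = (s - Re z)\<^sup>2 + (Im z)\<^sup>2"
        using z by (simp add: power_divide field_simps)
      ultimately show ?thesis
        unfolding cauchy_kernel_norm[OF z] by (metis inverse_eq_divide mult.commute nonzero_inverse_mult_distrib divide_inverse inverse_mult_distrib mult_1)
    qed
    then show "AE s in lborel. norm (1 / (complex_of_real s - z)\<^sup>2)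
      \<le> norm ((1 / (Im z)\<^sup>2) * inverse (1 + (- Re z / Im z + (1 / Im z) * s)\<^sup>2))"
      by (intro AE_I2) (metis order_refl abs_ge_self real_norm_def)
  qed measurable
qed

lemma cauchy_kernel_tail_integral:
  assumes z: "Im z > 0"
  shows "(\<integral>s. indicator {t..} s *\<^sub>R (1 / (complex_of_real s - z)\<^sup>2) \<partial>lborel) = 1 / (of_real t - z)"
proof -
  let ?k = "\<lambda>s. 1 / (complex_of_real s - z)\<^sup>2" and ?F = "\<lambda>s. - (1 / (complex_of_real s - z))"
  have nz: "complex_of_real s - z \<noteq> 0" for s using z by (intro of_real_minus_nonzero) simp
  have int: "integrable lborel (\<lambda>s. indicator {t..} s *\<^sub>R ?k s)"
    by (intro integrable_mult_indicator cauchy_kernel_integrable z) simp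
  have FTC: "(\<integral>s. indicator {..y} s *\<^sub>R (indicator {t..} s *\<^sub>R ?k s) \<partial>lborel) = ?F y - ?F t"
    if "t \<le> y" for y
  proof -
    have *: "(\<integral>s. indicator {t..y} s *\<^sub>R ?k s \<partial>lborel) = ?F y - ?F t"
    proof (rule integral_FTC_Icc[OF that])
      fix s
      show "(?F has_vector_derivative ?k s) (at s within {t..y})"
      proof -
        have "((\<lambda>w. - (1 / (w - z))) has_field_derivative ?k s) (at (complex_of_real s))"
          using nz[of s] by (auto intro!: derivative_eq_intros simp: power2_eq_square divide_simps)
        then have "(?F has_vector_derivative ?k s) (at s)"
          by (rule has_vector_derivative_real_field)
        then show ?thesis by (rule has_vector_derivative_at_within)
      qed
      show "continuous_on {t..y} ?k" using nz by (intro continuous_intros) auto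
    qed
    have "indicator {..y} s *\<^sub>R (indicator {t..} s *\<^sub>R ?k s) = indicator {t..y} s *\<^sub>R ?k s" for s
      by (auto simp: indicator_def)
    then show ?thesis using * by (simp only:)
  qed
  have "((\<lambda>y. ?F y - ?F t) \<longlongrightarrow> - 0 - ?F t) at_top"
  proof (intro tendsto_intros)
    have "filterlim (\<lambda>y. complex_of_real y) at_infinity at_top"
      by (simp add: filterlim_at_infinity_conv_norm_at_top filterlim_abs_real filterlim_at_top_imp_at_infinity filterlim_ident)
    then have "filterlim (\<lambda>y. complex_of_real y + - z) at_infinity at_top"
      by (rule tendsto_add_filterlim_at_infinity'[OF _ tendsto_const])
    then show "((\<lambda>y. 1 / (complex_of_real y - z)) \<longlongrightarrow> 0) at_top"
      by (intro tendsto_divide_0[OF tendsto_const]) simp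
  qed
  moreover have "\<forall>\<^sub>F y in at_top. ?F y - ?F t =
      (\<integral>s. indicator {..y} s *\<^sub>R (indicator {t..} s *\<^sub>R ?k s) \<partial>lborel)"
    using eventually_ge_at_top[of t] by eventually_elim (simp only: FTC)
  ultimately have "((\<lambda>y. \<integral>s. indicator {..y} s *\<^sub>R (indicator {t..} s *\<^sub>R ?k s) \<partial>lborel)
      \<longlongrightarrow> - 0 - ?F t) at_top"
    using tendsto_cong by fastforce
  with tendsto_integral_at_top[OF _ int]
  show ?thesis using tendsto_unique[OF trivial_limit_at_top_linorder] by fastforce
qed

text \<open>
  Writing \<open>1 / (t - z)\<close> as the integral of \<open>1 / (s - z)\<^sup>2\<close> over \<open>s \<ge> t\<close> and exchanging the integrals
  expresses an integral against the Stieltjes kernel by integrals over the half-lines \<open>{..s}\<close>. The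
  weight \<open>\<phi>\<close> serves two purposes: \<open>\<phi> = 1\<close> gives a formula that is linear in the distribution function,
  and \<open>\<phi> t = t - z\<close> makes the left side the total mass.
\<close>

lemma stieltjes_layer_cake:
  assumes \<mu>: "finite_borel_measure \<mu>" and z: "Im z > 0"
    and \<phi>: "integrable \<mu> \<phi>"
  shows "(\<integral>t. \<phi> t / (of_real t - z) \<partial>\<mu>) =
      (\<integral>s. (\<integral>t. indicator {..s} t *\<^sub>R \<phi> t \<partial>\<mu>) / (of_real s - z)\<^sup>2 \<partial>lborel)"
proof -
  interpret finite_borel_measure \<mu> by fact
  interpret pair_sigma_finite \<mu> lborel ..
  let ?k = "\<lambda>s. 1 / (complex_of_real s - z)\<^sup>2"
  let ?f = "\<lambda>t s. indicator {..s} t *\<^sub>R \<phi> t * ?k s"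
  note [measurable_cong] = M_is_borel
  have [measurable]: "\<phi> \<in> borel_measurable \<mu>" using \<phi> by simp
  have prod: "integrable (\<mu> \<Otimes>\<^sub>M lborel) (\<lambda>(t, s). \<phi> t * ?k s)"
  proof (rule Fubini_integrable)
    show "integrable \<mu> (\<lambda>t. \<integral>s. norm (case (t, s) of (t, s) \<Rightarrow> \<phi> t * ?k s) \<partial>lborel)"
    proof -
      have "integrable \<mu> (\<lambda>t. norm (\<phi> t) * (\<integral>s. norm (?k s) \<partial>lborel))"
        using \<phi> by (intro integrable_mult_left integrable_norm)
      then show ?thesis by (simp only: prod.case norm_mult integral_mult_right_zero)
    qed
    show "AE t in \<mu>. integrable lborel (\<lambda>s. case (t, s) of (t, s) \<Rightarrow> \<phi> t * ?k s)"
      using cauchy_kernel_integrable[OF z] by (simp only: prod.case integrable_mult_right AE_I2)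
  qed measurable
  have int: "integrable (\<mu> \<Otimes>\<^sub>M lborel) (case_prod ?f)"
  proof (rule Bochner_Integration.integrable_bound[OF prod])
    have [measurable]: "{x \<in> space (\<mu> \<Otimes>\<^sub>M lborel). fst x \<le> snd x} \<in> sets (\<mu> \<Otimes>\<^sub>M lborel)" by measurable
    have "(\<lambda>x. (if fst x \<le> snd x then 1 else 0) *\<^sub>R \<phi> (fst x) * ?k (snd x)) \<in> borel_measurable (\<mu> \<Otimes>\<^sub>M lborel)"
      by measurable
    moreover have "case_prod ?f = (\<lambda>x. (if fst x \<le> snd x then 1 else 0) *\<^sub>R \<phi> (fst x) * ?k (snd x))"
      by (auto simp: fun_eq_iff)
    ultimately show "case_prod ?f \<in> borel_measurable (\<mu> \<Otimes>\<^sub>M lborel)" by simp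
    show "AE x in \<mu> \<Otimes>\<^sub>M lborel. norm (case x of (t, s) \<Rightarrow> ?f t s) \<le> norm (case x of (t, s) \<Rightarrow> \<phi> t * ?k s)"
      by (intro AE_I2) (auto simp: indicator_def norm_mult)
  qed
  have inner: "(\<integral>t. ?f t s \<partial>\<mu>) = (\<integral>t. indicator {..s} t *\<^sub>R \<phi> t \<partial>\<mu>) / (of_real s - z)\<^sup>2" for s
  proof -
    have "(\<integral>t. ?f t s \<partial>\<mu>) = (\<integral>t. indicator {..s} t *\<^sub>R \<phi> t \<partial>\<mu>) * ?k s"
      by (rule integral_mult_left_zero)
    then show ?thesis by simp
  qed
  have outer: "(\<integral>s. ?f t s \<partial>lborel) = \<phi> t / (of_real t - z)" for t
  proof -
    have "(\<integral>s. ?f t s \<partial>lborel) = (\<integral>s. \<phi> t * (indicator {t..} s *\<^sub>R ?k s) \<partial>lborel)"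
      by (intro Bochner_Integration.integral_cong) (auto simp: indicator_def)
    also have "\<dots> = \<phi> t * (\<integral>s. indicator {t..} s *\<^sub>R ?k s \<partial>lborel)"
      by (rule integral_mult_right_zero)
    finally show ?thesis unfolding cauchy_kernel_tail_integral[OF z] by simp
  qed
  show "(\<integral>t. \<phi> t / (of_real t - z) \<partial>\<mu>) =
      (\<integral>s. (\<integral>t. indicator {..s} t *\<^sub>R \<phi> t \<partial>\<mu>) / (of_real s - z)\<^sup>2 \<partial>lborel)"
    using Fubini_integral[OF int] unfolding inner outer by simp
qed

lemma stieltjes_kernel_bounded:
  assumes z: "Im z > 0"
  shows "cmod (1 / (of_real t - z)) \<le> 1 / Im z"
proof -
  have "Im z \<le> cmod (of_real t - z)"
    using abs_Im_le_cmod[of "of_real t - z"] z by simp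
  then show ?thesis using z by (simp add: norm_divide frac_le)
qed

lemma stieltjes_integrable:
  assumes "finite_borel_measure \<mu>" and z: "Im z > 0"
  shows "integrable \<mu> (\<lambda>t. 1 / (complex_of_real t - z))"
proof -
  interpret finite_borel_measure \<mu> by fact
  note [measurable_cong] = M_is_borel
  show ?thesis
    by (rule integrable_const_bound[of _ "1 / Im z"])
      (use stieltjes_kernel_bounded[OF z] in auto)
qed

text \<open>
  The right side depends linearly on the distribution function, which makes it easy to average over
  several measures or to polarize.
\<close>

lemma stieltjes_cdf_integral:
  assumes \<mu>: "finite_borel_measure \<mu>" and z: "Im z > 0"
  shows "(\<integral>t. 1 / (of_real t - z) \<partial>\<mu>) = (\<integral>s. of_real (cdf \<mu> s) / (of_real s - z)\<^sup>2 \<partial>lborel)"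
proof -
  interpret finite_borel_measure \<mu> by fact
  note [measurable_cong] = M_is_borel
  have "(\<integral>t. indicator {..s} t *\<^sub>R (1::complex) \<partial>\<mu>) = of_real (cdf \<mu> s)" for s
    using M_is_borel
    by (subst integral_scaleR_left)
      (auto simp: cdf_def scaleR_conv_of_real emeasure_eq_measure intro!: integrable_real_indicator)
  then show ?thesis using stieltjes_layer_cake(1)[OF \<mu> z, of "\<lambda>_. 1"] by simp
qed

lemma finite_borel_measure_density_indicator:
  assumes "finite_borel_measure \<mu>" and [measurable]: "A \<in> sets borel"
  shows "finite_borel_measure (density \<mu> (\<lambda>t. ennreal (indicator A t)))"
    and "cdf (density \<mu> (\<lambda>t. ennreal (indicator A t))) t = measure \<mu> (A \<inter> {..t})"
proof -
  interpret finite_borel_measure \<mu> by fact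
  note [measurable_cong] = M_is_borel
  have em: "emeasure (density \<mu> (\<lambda>t. ennreal (indicator A t))) B = emeasure \<mu> (A \<inter> B)"
    if [measurable]: "B \<in> sets borel" for B
  proof -
    have "(\<integral>\<^sup>+t. ennreal (indicator A t) * indicator B t \<partial>\<mu>) = (\<integral>\<^sup>+t. indicator (A \<inter> B) t \<partial>\<mu>)"
      by (intro nn_integral_cong) (auto simp: indicator_def)
    also have "\<dots> = emeasure \<mu> (A \<inter> B)" by simp
    finally show ?thesis using M_is_borel by (subst emeasure_density) auto
  qed
  show "finite_borel_measure (density \<mu> (\<lambda>t. ennreal (indicator A t)))"
  proof (intro finite_borel_measure.intro finite_borel_measure_axioms.intro finite_measureI)
    show "emeasure (density \<mu> (\<lambda>t. ennreal (indicator A t))) (space (density \<mu> (\<lambda>t. ennreal (indicator A t)))) \<noteq> \<infinity>"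
      using em[of UNIV] sets_eq_imp_space_eq[OF M_is_borel] by simp
  qed (use M_is_borel in simp)
  show "cdf (density \<mu> (\<lambda>t. ennreal (indicator A t))) t = measure \<mu> (A \<inter> {..t})"
    unfolding cdf_def measure_def by (subst em) auto
qed

section \<open>Boundary values and Stieltjes inversion\<close>

text \<open>
  As \<open>z\<close> approaches the real point \<open>x\<close>, the argument of \<open>t - z\<close> tends to \<open>0\<close> for \<open>t > x\<close>, to \<open>-pi\<close> for
  \<open>t < x\<close>, and stays at \<open>-pi / 2\<close> for \<open>t = x\<close>.
\<close>

lemma Im_Ln_lower_tendsto:
  "((\<lambda>y. Im (Ln (of_real t - Complex x y))) \<longlongrightarrow>
     - pi / 2 * (indicator {..x} t + indicator {..<x} t)) (at_right 0)"
proof -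
  have lim: "((\<lambda>y. Complex x y) \<longlongrightarrow> complex_of_real x) (at_right 0)"
    unfolding Complex_eq by (auto intro!: tendsto_eq_intros)
  have ev: "\<forall>\<^sub>F y in at_right (0::real). y > 0" by (simp add: eventually_at_right_less)
  consider "t > x" | "t = x" | "t < x" by linarith
  then show ?thesis
  proof cases
    case 1
    then have "((\<lambda>y. Im (Ln (of_real t - Complex x y))) \<longlongrightarrow> Im (Ln (of_real t - of_real x))) (at_right 0)"
      by (intro tendsto_Im tendsto_Ln tendsto_diff tendsto_const lim)
        (auto simp: complex_nonpos_Reals_iff)
    moreover have "Im (Ln (of_real t - of_real x)) = 0"
      using 1 Ln_of_real[of "t - x"] by (simp flip: of_real_diff)
    ultimately show ?thesis using 1 by simp
  next
    case 2
    have "Im (Ln (of_real t - Complex x y)) = - pi / 2" if "y > 0" for y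
    proof -
      have "of_real t - Complex x y = - (of_real y * \<i>)" using 2 by (simp add: complex_eq_iff)
      then show ?thesis using that Ln_times_of_real[of y "- \<i>"] by simp
    qed
    with ev have "\<forall>\<^sub>F y in at_right 0. Im (Ln (of_real t - Complex x y)) = - pi / 2"
      by (rule eventually_mono)
    then show ?thesis using 2 by (simp add: tendsto_eventually)
  next
    case 3
    have "((\<lambda>y. Im (Ln (Complex x y - of_real t)) - pi) \<longlongrightarrow> Im (Ln (of_real x - of_real t)) - pi) (at_right 0)"
      using 3 by (intro tendsto_Im tendsto_Ln tendsto_diff tendsto_const lim)
        (auto simp: complex_nonpos_Reals_iff)
    moreover have "Im (Ln (of_real x - of_real t)) = 0"
      using 3 Ln_of_real[of "x - t"] by (simp flip: of_real_diff)
    moreover have "\<forall>\<^sub>F y in at_right 0. Im (Ln (Complex x y - of_real t)) - pi = Im (Ln (of_real t - Complex x y))"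
      using ev by eventually_elim (simp add: Ln_lower_arg)
    ultimately have "((\<lambda>y. Im (Ln (of_real t - Complex x y))) \<longlongrightarrow> - pi) (at_right 0)"
      using tendsto_cong by fastforce
    then show ?thesis using 3 by simp
  qed
qed

text \<open>
  The distribution function with the value at each jump replaced by the midpoint of the jump. It is
  the limit, as \<open>z\<close> approaches the real axis, of the \<open>\<mu>\<close>-average of the argument of \<open>t - z\<close>, divided by
  \<open>-pi\<close>.
\<close>

definition sym_cdf :: "real measure \<Rightarrow> real \<Rightarrow> real" where
  "sym_cdf \<mu> x = (measure \<mu> {..x} + measure \<mu> {..<x}) / 2"

text \<open>
  Dominated convergence: arguments are bounded by \<open>pi\<close> and \<open>\<mu>\<close> is finite.
\<close>

lemma arg_integral_boundary_value:
  assumes "real_distribution \<mu>"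
  shows "((\<lambda>y. \<integral>t. Im (Ln (of_real t - Complex x y)) \<partial>\<mu>) \<longlongrightarrow> - pi * sym_cdf \<mu> x) (at_right 0)"
proof -
  interpret real_distribution \<mu> by fact
  let ?l = "\<lambda>t. - pi / 2 * (indicator {..x} t + indicator {..<x} t)"
  have "((\<lambda>y. \<integral>t. Im (Ln (of_real t - Complex x y)) \<partial>\<mu>) \<longlongrightarrow> (\<integral>t. ?l t \<partial>\<mu>)) (at_right 0)"
  proof (rule tendsto_at_right_sequentially[of 0 1])
    fix S :: "nat \<Rightarrow> real" assume S: "\<And>n. 0 < S n" "S \<longlonglongrightarrow> 0"
    have "S n \<noteq> 0" for n using S(1)[of n] by simp
    then have Sr: "filterlim S (at_right 0) sequentially"
      using S by (simp add: filterlim_at)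
    show "(\<lambda>n. \<integral>t. Im (Ln (of_real t - Complex x (S n))) \<partial>\<mu>) \<longlonglongrightarrow> (\<integral>t. ?l t \<partial>\<mu>)"
    proof (rule integral_dominated_convergence[where w = "\<lambda>_. pi"])
      show "AE t in \<mu>. (\<lambda>n. Im (Ln (of_real t - Complex x (S n)))) \<longlonglongrightarrow> ?l t"
        by (intro AE_I2 filterlim_compose[OF Im_Ln_lower_tendsto Sr])
      show "AE t in \<mu>. norm (Im (Ln (of_real t - Complex x (S n)))) \<le> pi" for n
        using S(1)[of n] by (intro AE_I2) (auto intro!: Im_Ln_abs_le simp: complex_eq_iff)
    qed simp_all
  qed simp
  moreover have "(\<integral>t. ?l t \<partial>\<mu>) = - pi * sym_cdf \<mu> x"
    by (simp add: sym_cdf_def integrable_real_indicator[of] emeasure_eq_measure)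
  ultimately show ?thesis by simp
qed

lemma sym_cdf_bounds:
  assumes "real_distribution \<mu>"
  shows "sym_cdf \<mu> x \<le> cdf \<mu> x" "0 \<le> sym_cdf \<mu> x" and "x < y \<Longrightarrow> cdf \<mu> x \<le> sym_cdf \<mu> y"
proof -
  interpret real_distribution \<mu> by fact
  have "measure \<mu> {..<x} \<le> measure \<mu> {..x}" by (intro finite_measure_mono) auto
  then show "sym_cdf \<mu> x \<le> cdf \<mu> x" by (simp add: sym_cdf_def cdf_def)
  show "0 \<le> sym_cdf \<mu> x" by (simp add: sym_cdf_def)
  assume "x < y"
  then have "measure \<mu> {..x} \<le> measure \<mu> {..<y}" "measure \<mu> {..x} \<le> measure \<mu> {..y}"
    by (intro finite_measure_mono; auto)+
  then show "cdf \<mu> x \<le> sym_cdf \<mu> y" by (simp add: sym_cdf_def cdf_def)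
qed

lemma mono_sym_cdf:
  assumes "real_distribution \<mu>"
  shows "mono (sym_cdf \<mu>)"
proof (rule monoI)
  fix x y :: real assume "x \<le> y"
  then show "sym_cdf \<mu> x \<le> sym_cdf \<mu> y"
    using sym_cdf_bounds(1)[OF assms, of x] sym_cdf_bounds(3)[OF assms, of x y] by fastforce
qed

lemma sym_cdf_right_limit:
  assumes "real_distribution \<mu>"
  shows "(sym_cdf \<mu> \<longlongrightarrow> cdf \<mu> x) (at_right x)"
proof -
  interpret real_distribution \<mu> by fact
  show ?thesis
  proof (rule tendsto_sandwich)
    show "\<forall>\<^sub>F y in at_right x. cdf \<mu> x \<le> sym_cdf \<mu> y"
      using eventually_at_right_less[of x] by eventually_elim (rule sym_cdf_bounds(3)[OF assms])
    show "\<forall>\<^sub>F y in at_right x. sym_cdf \<mu> y \<le> cdf \<mu> y"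
      by (intro always_eventually allI sym_cdf_bounds(1)[OF assms])
    show "(cdf \<mu> \<longlongrightarrow> cdf \<mu> x) (at_right x)"
      using cdf_is_right_cont[of x] by (simp add: continuous_within)
  qed simp
qed

text \<open>
  The right limits of \<open>sym_cdf\<close> form the distribution function of \<open>\<mu>\<close>.
\<close>

lemma stieltjes_measure_sym_cdf:
  assumes "real_distribution \<mu>"
  shows "stieltjes_measure (sym_cdf \<mu>) = \<mu>"
proof -
  interpret real_distribution \<mu> by fact
  have "Lim (at_right x) (sym_cdf \<mu>) = cdf \<mu> x" for x
    by (intro tendsto_Lim sym_cdf_right_limit assms) simp
  then have "stieltjes_measure (sym_cdf \<mu>) = interval_measure (cdf \<mu>)"
    by (simp add: stieltjes_measure_def)
  also have "\<dots> = \<mu>"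
  proof (rule cdf_unique)
    show "real_distribution (interval_measure (cdf \<mu>))"
      by (intro real_distribution_interval_measure cdf_nondecreasing cdf_is_right_cont
          cdf_lim_at_bot cdf_lim_at_top_prob)
    show "cdf (interval_measure (cdf \<mu>)) = cdf \<mu>"
      by (intro cdf_interval_measure cdf_nondecreasing cdf_is_right_cont cdf_lim_at_bot)
  qed fact
  finally show ?thesis .
qed

lemma Ln_lower_has_vector_derivative:
  assumes y: "y > 0"
  shows "((\<lambda>x. Ln (of_real t - Complex x y)) has_vector_derivative - (1 / (of_real t - Complex x y))) (at x)"
proof -
  define c where "c = complex_of_real t - \<i> * of_real y"
  have eq: "of_real t - Complex x y = c - of_real x" for x
    by (simp add: complex_eq_iff c_def)
  have nz: "c - of_real x \<notin> \<real>\<^sub>\<le>\<^sub>0" using y by (auto simp: complex_nonpos_Reals_iff c_def)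
  have "((\<lambda>w. c - w) has_field_derivative -1) (at (complex_of_real x))"
    by (auto intro!: derivative_eq_intros)
  then have "((\<lambda>w. Ln (c - w)) has_field_derivative inverse (c - of_real x) * -1) (at (of_real x))"
    by (rule DERIV_chain2[where g = "\<lambda>w. c - w" and f = Ln, OF has_field_derivative_Ln[OF nz]])
  then have "((\<lambda>x. Ln (c - of_real x)) has_vector_derivative inverse (c - of_real x) * -1) (at x)"
    by (rule has_vector_derivative_real_field)
  then show ?thesis by (simp add: eq divide_inverse)
qed

text \<open>
  The Stieltjes kernel is, up to sign, the derivative of \<open>Ln (t - z)\<close> in \<open>z\<close>; so the transform determines the
  increments of the averaged argument along horizontal lines. Only the argument, which is bounded,
  is integrated, since the logarithm itself need not be integrable.
\<close>

lemma arg_integral_difference: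
  assumes "real_distribution \<mu>" and y: "y > 0" and x: "x1 \<le> x2"
  shows "(\<integral>t. Im (Ln (of_real t - Complex x2 y)) \<partial>\<mu>) - (\<integral>t. Im (Ln (of_real t - Complex x1 y)) \<partial>\<mu>)
    = (\<integral>x. indicator {x1..x2} x *\<^sub>R (- Im (\<integral>t. 1 / (of_real t - Complex x y) \<partial>\<mu>)) \<partial>lborel)"
proof -
  interpret real_distribution \<mu> by fact
  interpret pair_sigma_finite \<mu> lborel ..
  let ?f = "\<lambda>t x. indicator {x1..x2} x *\<^sub>R (- Im (1 / (of_real t - Complex x y)))"
  have L: "integrable \<mu> (\<lambda>t. Im (Ln (of_real t - Complex x y)))" for x
  proof (rule integrable_const_bound[of _ pi])
    show "(\<lambda>t. Im (Ln (of_real t - Complex x y))) \<in> borel_measurable \<mu>" by measurable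
    show "AE t in \<mu>. norm (Im (Ln (of_real t - Complex x y))) \<le> pi"
      using y by (intro AE_I2) (auto intro!: Im_Ln_abs_le simp: complex_eq_iff)
  qed
  have [measurable]: "(\<lambda>x. Complex x y) \<in> borel_measurable borel"
    unfolding Complex_eq by measurable
  have bound: "norm (?f t x) \<le> indicator {x1..x2} x *\<^sub>R (1 / y)" for t x
    using y abs_Im_le_cmod[of "1 / (of_real t - Complex x y)"] stieltjes_kernel_bounded[of "Complex x y" t]
    by (auto simp: indicator_def intro: order_trans)
  have prod: "integrable (\<mu> \<Otimes>\<^sub>M lborel) (\<lambda>(t, x). indicator {x1..x2} x *\<^sub>R (1 / y))"
  proof (rule Fubini_integrable)
    have "integrable lborel (\<lambda>x. indicator {x1..x2} x *\<^sub>R (1 / y))"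
      by (intro integrable_scaleR_left integrable_real_indicator) (auto simp: emeasure_lborel_Icc_eq)
    then show "AE t in \<mu>. integrable lborel (\<lambda>x. case (t, x) of (t, x) \<Rightarrow> indicator {x1..x2} x *\<^sub>R (1 / y))"
      by (simp only: prod.case AE_I2)
    show "(\<lambda>(t, x). indicator {x1..x2} x *\<^sub>R (1 / y)) \<in> borel_measurable (\<mu> \<Otimes>\<^sub>M lborel)"
      by measurable
  qed simp
  have int: "integrable (\<mu> \<Otimes>\<^sub>M lborel) (case_prod ?f)"
  proof (rule Bochner_Integration.integrable_bound[OF prod])
    show "AE p in \<mu> \<Otimes>\<^sub>M lborel. norm (case_prod ?f p) \<le> norm (case p of (t, x) \<Rightarrow> indicator {x1..x2} x *\<^sub>R (1 / y))"
    proof (intro AE_I2)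
      fix p :: "real \<times> real"
      show "norm (case_prod ?f p) \<le> norm (case p of (t, x) \<Rightarrow> indicator {x1..x2} x *\<^sub>R (1 / y))"
        using bound[of "snd p" "fst p"] y by (cases p) (simp add: indicator_def)
    qed
  qed measurable
  have FTC: "(\<integral>x. ?f t x \<partial>lborel) = Im (Ln (of_real t - Complex x2 y)) - Im (Ln (of_real t - Complex x1 y))" for t
  proof (rule integral_FTC_Icc[OF x])
    fix x
    have "((\<lambda>x. Ln (of_real t - Complex x y)) has_vector_derivative - (1 / (of_real t - Complex x y))) (at x within {x1..x2})"
      using Ln_lower_has_vector_derivative[OF y] by (rule has_vector_derivative_at_within)
    then have "((\<lambda>x. Im (Ln (of_real t - Complex x y))) has_vector_derivative Im (- (1 / (of_real t - Complex x y)))) (at x within {x1..x2})"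
      by (rule bounded_linear.has_vector_derivative[OF bounded_linear_Im])
    then show "((\<lambda>x. Im (Ln (of_real t - Complex x y))) has_vector_derivative - Im (1 / (of_real t - Complex x y))) (at x within {x1..x2})"
      by simp
  next
    have "of_real t - (of_real x + \<i> * of_real y) \<noteq> 0" for x using y by (auto simp: complex_eq_iff)
    then show "continuous_on {x1..x2} (\<lambda>x. - Im (1 / (of_real t - Complex x y)))"
      unfolding Complex_eq by (intro continuous_intros) auto
  qed
  have inner: "(\<integral>t. ?f t x \<partial>\<mu>) = indicator {x1..x2} x *\<^sub>R (- Im (\<integral>t. 1 / (of_real t - Complex x y) \<partial>\<mu>))" for x
    using stieltjes_integrable[OF finite_borel_measure_M, of "Complex x y"] y by simp
  have "(\<integral>t. Im (Ln (of_real t - Complex x2 y)) \<partial>\<mu>) - (\<integral>t. Im (Ln (of_real t - Complex x1 y)) \<partial>\<mu>)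
     = (\<integral>t. (\<integral>x. ?f t x \<partial>lborel) \<partial>\<mu>)"
    unfolding FTC using L by simp
  also have "\<dots> = (\<integral>x. (\<integral>t. ?f t x \<partial>\<mu>) \<partial>lborel)" by (rule Fubini_integral[OF int, symmetric])
  finally show ?thesis unfolding inner .
qed

text \<open>
  Stieltjes inversion. Equal transforms give equal increments of the averaged arguments on each
  horizontal line, hence in the limit equal increments of \<open>sym_cdf\<close>; both functions vanish at \<open>-\<infinity>\<close>.
\<close>

lemma stieltjes_transform_unique:
  assumes \<mu>: "real_distribution \<mu>" and \<nu>: "real_distribution \<nu>"
    and eq: "\<And>z. Im z > 0 \<Longrightarrow> (\<integral>t. 1 / (of_real t - z) \<partial>\<mu>) = (\<integral>t. 1 / (of_real t - z) \<partial>\<nu>)"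
  shows "\<mu> = \<nu>"
proof -
  have diff: "sym_cdf \<mu> x2 - sym_cdf \<mu> x1 = sym_cdf \<nu> x2 - sym_cdf \<nu> x1" if x: "x1 \<le> x2" for x1 x2
  proof -
    let ?J = "\<lambda>\<mu> x y. \<integral>t. Im (Ln (of_real t - Complex x y)) \<partial>\<mu>"
    have lim: "((\<lambda>y. ?J \<mu> x2 y - ?J \<mu> x1 y) \<longlongrightarrow> - pi * sym_cdf \<mu> x2 - - pi * sym_cdf \<mu> x1) (at_right 0)"
      if "real_distribution \<mu>" for \<mu>
      by (intro tendsto_diff arg_integral_boundary_value that)
    have "\<forall>\<^sub>F y in at_right 0. ?J \<mu> x2 y - ?J \<mu> x1 y = ?J \<nu> x2 y - ?J \<nu> x1 y"
      using eventually_at_right_less[of 0]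
      by eventually_elim (simp add: arg_integral_difference[OF \<mu> _ x] arg_integral_difference[OF \<nu> _ x] eq)
    then have "((\<lambda>y. ?J \<nu> x2 y - ?J \<nu> x1 y) \<longlongrightarrow> - pi * sym_cdf \<mu> x2 - - pi * sym_cdf \<mu> x1) (at_right 0)"
      using lim[OF \<mu>] tendsto_cong by fastforce
    from tendsto_unique[OF trivial_limit_at_right_real this lim[OF \<nu>]]
    have "- pi * sym_cdf \<mu> x2 - - pi * sym_cdf \<mu> x1 = - pi * sym_cdf \<nu> x2 - - pi * sym_cdf \<nu> x1" .
    then have "pi * (sym_cdf \<mu> x2 - sym_cdf \<mu> x1) = pi * (sym_cdf \<nu> x2 - sym_cdf \<nu> x1)"
      by (simp add: algebra_simps)
    then show ?thesis by simp
  qed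
  have lim0: "(sym_cdf \<mu> \<longlongrightarrow> 0) at_bot" if "real_distribution \<mu>" for \<mu>
  proof -
    interpret real_distribution \<mu> by fact
    show ?thesis
      by (rule tendsto_sandwich[OF _ _ tendsto_const cdf_lim_at_bot])
        (use sym_cdf_bounds[OF that] in auto)
  qed
  have "sym_cdf \<mu> x = sym_cdf \<nu> x" for x
  proof -
    have "((\<lambda>u. sym_cdf \<mu> x - sym_cdf \<mu> u) \<longlongrightarrow> sym_cdf \<mu> x - 0) at_bot"
      by (intro tendsto_intros lim0 \<mu>)
    moreover have "((\<lambda>u. sym_cdf \<nu> x - sym_cdf \<nu> u) \<longlongrightarrow> sym_cdf \<nu> x - 0) at_bot"
      by (intro tendsto_intros lim0 \<nu>)
    moreover have "\<forall>\<^sub>F u in at_bot. sym_cdf \<mu> x - sym_cdf \<mu> u = sym_cdf \<nu> x - sym_cdf \<nu> u"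
      using eventually_le_at_bot[of x] by eventually_elim (rule diff)
    ultimately have "((\<lambda>u. sym_cdf \<nu> x - sym_cdf \<nu> u) \<longlongrightarrow> sym_cdf \<mu> x - 0) at_bot"
      "((\<lambda>u. sym_cdf \<nu> x - sym_cdf \<nu> u) \<longlongrightarrow> sym_cdf \<nu> x - 0) at_bot"
      using tendsto_cong by fastforce+
    then show ?thesis using tendsto_unique[OF trivial_limit_at_bot_linorder] by fastforce
  qed
  then show ?thesis
    using stieltjes_measure_sym_cdf[OF \<mu>] stieltjes_measure_sym_cdf[OF \<nu>]
    by (metis ext)
qed

section \<open>Weak-star limits\<close>

lemma weak_star_conv_complex:
  fixes f :: "real \<Rightarrow> complex"
  assumes conv: "weak_star_conv \<mu> \<nu>" and cont: "continuous_on UNIV f" and van: "(f \<longlongrightarrow> 0) at_infinity"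
    and int: "\<And>j. integrable (\<mu> j) f" "integrable \<nu> f"
  shows "(\<lambda>j. \<integral>t. f t \<partial>\<mu> j) \<longlonglongrightarrow> (\<integral>t. f t \<partial>\<nu>)"
proof -
  have "(\<lambda>j. \<integral>t. Re (f t) \<partial>\<mu> j) \<longlonglongrightarrow> (\<integral>t. Re (f t) \<partial>\<nu>)"
    using conv continuous_on_Re[OF cont] tendsto_Re[OF van] unfolding weak_star_conv_def by simp
  moreover have "(\<lambda>j. \<integral>t. Im (f t) \<partial>\<mu> j) \<longlonglongrightarrow> (\<integral>t. Im (f t) \<partial>\<nu>)"
    using conv continuous_on_Im[OF cont] tendsto_Im[OF van] unfolding weak_star_conv_def by simp
  ultimately show ?thesis
    unfolding tendsto_complex_iff using int by simp
qed

lemma stieltjes_kernel_vanishes: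
  "((\<lambda>t. 1 / (complex_of_real t - z)) \<longlongrightarrow> 0) at_infinity"
proof -
  have "filterlim (\<lambda>t. complex_of_real t) at_infinity at_infinity"
    unfolding filterlim_at_infinity_conv_norm_at_top norm_of_real real_norm_def[symmetric]
    by (rule filterlim_norm_at_top)
  then have "filterlim (\<lambda>t. complex_of_real t + - z) at_infinity at_infinity"
    by (rule tendsto_add_filterlim_at_infinity'[OF _ tendsto_const])
  then show ?thesis by (intro tendsto_divide_0[OF tendsto_const]) simp
qed

lemma weak_star_stieltjes_limit:
  assumes conv: "weak_star_conv \<mu> \<nu>" and z: "Im z > 0"
    and fin: "\<And>j. finite_borel_measure (\<mu> j)" "finite_borel_measure \<nu>"
  shows "(\<lambda>j. \<integral>t. 1 / (of_real t - z) \<partial>\<mu> j) \<longlonglongrightarrow> (\<integral>t. 1 / (of_real t - z) \<partial>\<nu>)"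
proof (rule weak_star_conv_complex[OF conv _ stieltjes_kernel_vanishes])
  have "complex_of_real t - z \<noteq> 0" for t using z by (intro of_real_minus_nonzero) simp
  then show "continuous_on UNIV (\<lambda>t. 1 / (complex_of_real t - z))"
    by (intro continuous_intros) auto
qed (intro stieltjes_integrable fin z)+

text \<open>
  Mass outside \<open>[-C, C]\<close> would be detected by a test function that is positive there and vanishes on
  \<open>[-C, C]\<close>.
\<close>

lemma weak_star_support:
  assumes conv: "weak_star_conv \<mu> \<nu>" and \<nu>: "real_distribution \<nu>"
    and supp: "\<And>j f. (\<And>t. \<bar>t\<bar> \<le> C \<Longrightarrow> f t = 0) \<Longrightarrow> (\<integral>t. (f t :: real) \<partial>\<mu> j) = 0"
  shows "AE t in \<nu>. \<bar>t\<bar> \<le> C"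
proof -
  interpret real_distribution \<nu> by fact
  \<comment> \<open>A test function that vanishes exactly on \<open>[-C, C]\<close>; the second entry of the minimum makes
    it decay at infinity.\<close>
  define f where "f t = min (max 0 (\<bar>t\<bar> - C)) (1 / (1 + \<bar>t\<bar>))" for t :: real
  have f0: "0 \<le> f t" and f1: "f t \<le> 1 / (1 + \<bar>t\<bar>)" for t by (simp_all add: f_def)
  have cont: "continuous_on UNIV f"
    unfolding f_def by (intro continuous_intros) (simp add: add_nonneg_eq_0_iff)
  have "filterlim (\<lambda>t::real. 1 + norm t) at_top at_infinity"
    by (intro filterlim_tendsto_add_at_top[OF tendsto_const] filterlim_norm_at_top)
  then have "((\<lambda>t::real. inverse (1 + norm t)) \<longlongrightarrow> 0) at_infinity"
    by (rule tendsto_inverse_0_at_top)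
  then have "(f \<longlongrightarrow> 0) at_infinity"
    by (rule Lim_null_comparison[rotated])
      (use f0 f1 in \<open>simp add: inverse_eq_divide always_eventually\<close>)
  then have "(\<lambda>j. \<integral>t. f t \<partial>\<mu> j) \<longlonglongrightarrow> (\<integral>t. f t \<partial>\<nu>)"
    using conv cont unfolding weak_star_conv_def by blast
  moreover have "(\<integral>t. f t \<partial>\<mu> j) = 0" for j by (rule supp) (simp add: f_def)
  ultimately have "(\<integral>t. f t \<partial>\<nu>) = 0" using LIMSEQ_unique[OF _ tendsto_const] by simp
  moreover have "integrable \<nu> f"
  proof (rule integrable_const_bound[of _ 1])
    have "f t \<le> 1" for t using f1[of t] by (rule order_trans) simp
    then show "AE t in \<nu>. norm (f t) \<le> 1" using f0 by simp
    show "f \<in> borel_measurable \<nu>"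
      using borel_measurable_continuous_onI[OF cont] by simp
  qed
  ultimately have "AE t in \<nu>. f t = 0"
    using integral_nonneg_eq_0_iff_AE[of \<nu> f] f0 by simp
  then show ?thesis
  proof (rule AE_mp, intro AE_I2 impI)
    fix t assume 0: "f t = 0"
    have "1 / (1 + \<bar>t\<bar>) > 0" by (intro divide_pos_pos) auto
    then show "\<bar>t\<bar> \<le> C" using 0 by (auto simp: f_def min_def max_def split: if_splits)
  qed
qed

text \<open>
  On measures with a common compact support, weak-star convergence extends to continuous integrands
  that are unbounded at infinity.
\<close>

lemma weak_star_compact_support_limit:
  fixes h :: "real \<Rightarrow> complex"
  assumes conv: "weak_star_conv \<mu> \<nu>" and \<nu>: "real_distribution \<nu>"
    and supp: "\<And>j f. (\<And>t. \<bar>t\<bar> \<le> C \<Longrightarrow> f t = 0) \<Longrightarrow> (\<integral>t. (f t :: real) \<partial>\<mu> j) = 0"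
    and int: "\<And>j f. f \<in> borel_measurable borel \<Longrightarrow> integrable (\<mu> j) (f :: real \<Rightarrow> complex)"
    and int_eq: "\<And>j f f'. f \<in> borel_measurable borel \<Longrightarrow> f' \<in> borel_measurable borel \<Longrightarrow>
      (\<And>t. \<bar>t\<bar> \<le> C \<Longrightarrow> f t = f' t) \<Longrightarrow> (\<integral>t. f t \<partial>\<mu> j) = (\<integral>t. (f' t :: complex) \<partial>\<mu> j)"
    and cont: "continuous_on UNIV h"
  shows "integrable \<nu> h" and "(\<lambda>j. \<integral>t. h t \<partial>\<mu> j) \<longlonglongrightarrow> (\<integral>t. h t \<partial>\<nu>)"
proof -
  interpret real_distribution \<nu> by fact
  have AE: "AE t in \<nu>. \<bar>t\<bar> \<le> C" by (rule weak_star_support[OF conv \<nu> supp])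
  \<comment> \<open>A cutoff equal to 1 on \<open>[-C, C]\<close> turns \<open>h\<close> into an admissible test function without
    changing any of the integrals.\<close>
  define cut :: "real \<Rightarrow> real" where "cut t = max 0 (min 1 (C + 1 - \<bar>t\<bar>))" for t
  define f where "f t = of_real (cut t) * h t" for t
  have fh: "f t = h t" if "\<bar>t\<bar> \<le> C" for t using that by (simp add: f_def cut_def)
  have fcont: "continuous_on UNIV f" unfolding f_def cut_def by (intro continuous_intros cont)
  then have fmeas: "f \<in> borel_measurable borel" by (rule borel_measurable_continuous_onI)
  have hmeas: "h \<in> borel_measurable borel" using cont by (rule borel_measurable_continuous_onI)
  have "\<forall>\<^sub>F t in at_infinity. f t = 0"
    unfolding eventually_at_infinity by (intro exI[of _ "C + 1"]) (simp add: f_def cut_def)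
  then have van: "(f \<longlongrightarrow> 0) at_infinity" by (rule tendsto_eventually)
  have fint: "integrable \<nu> f"
  proof -
    have "compact (f ` {-\<bar>C\<bar>..\<bar>C\<bar>})"
      by (intro compact_continuous_image continuous_on_subset[OF fcont]) auto
    then obtain B where B: "\<And>t. t \<in> {-\<bar>C\<bar>..\<bar>C\<bar>} \<Longrightarrow> norm (f t) \<le> B"
      using compact_imp_bounded bounded_iff by (metis imageI)
    show ?thesis
    proof (rule integrable_const_bound[of _ B])
      show "AE t in \<nu>. norm (f t) \<le> B"
        using AE by (rule AE_mp) (intro AE_I2 impI B, auto)
    qed (use fmeas in simp)
  qed
  have AEeq: "AE t in \<nu>. f t = h t" using AE by (rule AE_mp) (intro AE_I2 impI fh)
  show "integrable \<nu> h"
    using integrable_cong_AE[OF _ _ AEeq] fint fmeas hmeas by simp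
  have "(\<lambda>j. \<integral>t. f t \<partial>\<mu> j) \<longlonglongrightarrow> (\<integral>t. f t \<partial>\<nu>)"
    by (rule weak_star_conv_complex[OF conv fcont van int[OF fmeas] fint])
  moreover have "(\<integral>t. f t \<partial>\<mu> j) = (\<integral>t. h t \<partial>\<mu> j)" for j by (rule int_eq[OF fmeas hmeas fh])
  moreover have "(\<integral>t. f t \<partial>\<nu>) = (\<integral>t. h t \<partial>\<nu>)"
    by (rule integral_cong_AE) (use fmeas hmeas AEeq in auto)
  ultimately show "(\<lambda>j. \<integral>t. h t \<partial>\<mu> j) \<longlonglongrightarrow> (\<integral>t. h t \<partial>\<nu>)" by simp
qed

section \<open>Square summable sequences\<close>

lemma ell2_inner_delta: "ell2_inner (delta n) u = u n"
proof -
  have "(\<lambda>k. cnj (delta n k) * u k) = (\<lambda>k. if k = n then u k else 0)"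
    by (auto simp: delta_def)
  then show ?thesis
    unfolding ell2_inner_def using sums_single[of n u] by (simp add: sums_iff)
qed

lemma ell2_add: "u \<in> ell2 \<Longrightarrow> v \<in> ell2 \<Longrightarrow> (\<lambda>n. u n + v n) \<in> ell2"
proof -
  assume "u \<in> ell2" "v \<in> ell2"
  then have s: "summable (\<lambda>n. 2 * (cmod (u n))\<^sup>2 + 2 * (cmod (v n))\<^sup>2)" and 0: "u 0 = 0" "v 0 = 0"
    by (auto simp: ell2_def intro!: summable_add summable_mult)
  have "(cmod (u n + v n))\<^sup>2 \<le> 2 * (cmod (u n))\<^sup>2 + 2 * (cmod (v n))\<^sup>2" for n
  proof -
    have "(cmod (u n + v n))\<^sup>2 \<le> (cmod (u n) + cmod (v n))\<^sup>2"
      by (intro power_mono norm_triangle_ineq) simp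
    also have "\<dots> \<le> 2 * (cmod (u n))\<^sup>2 + 2 * (cmod (v n))\<^sup>2"
      using sum_squares_bound[of "cmod (u n)" "cmod (v n)"] by (simp add: power2_sum)
    finally show ?thesis .
  qed
  then have "summable (\<lambda>n. (cmod (u n + v n))\<^sup>2)"
    by (intro summable_comparison_test'[OF s, of 0]) simp
  then show ?thesis using 0 by (simp add: ell2_def)
qed

lemma ell2_scale: "u \<in> ell2 \<Longrightarrow> (\<lambda>n. c * u n) \<in> ell2"
  by (auto simp: ell2_def norm_mult power_mult_distrib intro!: summable_mult)

lemma ell2_diff: "u \<in> ell2 \<Longrightarrow> v \<in> ell2 \<Longrightarrow> (\<lambda>n. u n - v n) \<in> ell2"
  using ell2_add[of u "\<lambda>n. -1 * v n"] ell2_scale[of v "-1"] by simp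

lemma mult_le_sum_squares:
  fixes x y :: real
  assumes "0 \<le> x" "0 \<le> y"
  shows "x * y \<le> x\<^sup>2 + y\<^sup>2"
proof -
  have "2 * (x * y) \<le> x\<^sup>2 + y\<^sup>2" using sum_squares_bound[of x y] by (simp add: mult.assoc)
  moreover have "0 \<le> x * y" using assms by simp
  ultimately show ?thesis by linarith
qed

lemma ell2_inner_summable:
  assumes "u \<in> ell2" "v \<in> ell2"
  shows "summable (\<lambda>n. cmod (cnj (u n) * v n))" "summable (\<lambda>n. cnj (u n) * v n)"
proof -
  have s: "summable (\<lambda>n. (cmod (u n))\<^sup>2 + (cmod (v n))\<^sup>2)"
    using assms by (auto simp: ell2_def intro!: summable_add)
  have "cmod (u n) * cmod (v n) \<le> (cmod (u n))\<^sup>2 + (cmod (v n))\<^sup>2" for n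
    by (rule mult_le_sum_squares) simp_all
  then show "summable (\<lambda>n. cmod (cnj (u n) * v n))"
    by (intro summable_comparison_test'[OF s, of 0]) (simp add: norm_mult)
  then show "summable (\<lambda>n. cnj (u n) * v n)" by (rule summable_norm_cancel)
qed

lemma ell2_inner_add_right:
  "u \<in> ell2 \<Longrightarrow> v \<in> ell2 \<Longrightarrow> w \<in> ell2 \<Longrightarrow>
    ell2_inner u (\<lambda>n. v n + w n) = ell2_inner u v + ell2_inner u w"
  unfolding ell2_inner_def distrib_left
  by (intro suminf_add[symmetric] ell2_inner_summable)

lemma ell2_inner_add_left:
  "u \<in> ell2 \<Longrightarrow> v \<in> ell2 \<Longrightarrow> w \<in> ell2 \<Longrightarrow>
    ell2_inner (\<lambda>n. v n + w n) u = ell2_inner v u + ell2_inner w u"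
  unfolding ell2_inner_def complex_cnj_add distrib_right
  by (intro suminf_add[symmetric] ell2_inner_summable)

lemma ell2_inner_scale_right:
  "u \<in> ell2 \<Longrightarrow> v \<in> ell2 \<Longrightarrow> ell2_inner u (\<lambda>n. c * v n) = c * ell2_inner u v"
  unfolding ell2_inner_def mult.left_commute[of _ c]
  by (intro suminf_mult ell2_inner_summable)

lemma ell2_inner_scale_left:
  "u \<in> ell2 \<Longrightarrow> v \<in> ell2 \<Longrightarrow> ell2_inner (\<lambda>n. c * u n) v = cnj c * ell2_inner u v"
  unfolding ell2_inner_def complex_cnj_mult mult.assoc
  by (intro suminf_mult ell2_inner_summable)

lemma ell2_inner_diff_right:
  "u \<in> ell2 \<Longrightarrow> v \<in> ell2 \<Longrightarrow> w \<in> ell2 \<Longrightarrow>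
    ell2_inner u (\<lambda>n. v n - w n) = ell2_inner u v - ell2_inner u w"
  unfolding ell2_inner_def right_diff_distrib
  by (intro suminf_diff[symmetric] ell2_inner_summable)

lemma ell2_inner_diff_left:
  "u \<in> ell2 \<Longrightarrow> v \<in> ell2 \<Longrightarrow> w \<in> ell2 \<Longrightarrow>
    ell2_inner (\<lambda>n. v n - w n) u = ell2_inner v u - ell2_inner w u"
  unfolding ell2_inner_def complex_cnj_diff left_diff_distrib
  by (intro suminf_diff[symmetric] ell2_inner_summable)

lemma ell2_inner_cnj:
  assumes "u \<in> ell2" "v \<in> ell2"
  shows "cnj (ell2_inner u v) = ell2_inner v u"
proof -
  have "(\<lambda>n. cnj (cnj (u n) * v n)) sums cnj (ell2_inner u v)"
    unfolding sums_cnj ell2_inner_def by (intro summable_sums ell2_inner_summable assms)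
  then show ?thesis unfolding ell2_inner_def by (simp add: sums_iff mult.commute)
qed

lemma ell2_norm_square:
  assumes "u \<in> ell2"
  shows "(ell2_norm u)\<^sup>2 = (\<Sum>n. (cmod (u n))\<^sup>2)"
  unfolding ell2_norm_def
  using assms by (intro real_sqrt_pow2 suminf_nonneg) (auto simp: ell2_def)

lemma ell2_inner_self:
  assumes "u \<in> ell2"
  shows "ell2_inner u u = of_real ((ell2_norm u)\<^sup>2)"
proof -
  have "(\<lambda>n. complex_of_real ((cmod (u n))\<^sup>2)) sums of_real (\<Sum>n. (cmod (u n))\<^sup>2)"
    using assms by (intro sums_of_real summable_sums) (auto simp: ell2_def)
  then show ?thesis unfolding ell2_inner_def ell2_norm_square[OF assms]
    by (simp add: sums_iff complex_norm_square mult.commute del: of_real_power)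
qed

text \<open>
  A weak form of the Cauchy--Schwarz inequality, sufficient to dominate integrands.
\<close>

lemma ell2_inner_bound:
  assumes u: "u \<in> ell2" and v: "v \<in> ell2"
  shows "cmod (ell2_inner u v) \<le> (ell2_norm u)\<^sup>2 + (ell2_norm v)\<^sup>2"
proof -
  have s: "summable (\<lambda>n. (cmod (u n))\<^sup>2)" "summable (\<lambda>n. (cmod (v n))\<^sup>2)"
    using assms by (auto simp: ell2_def)
  have "cmod (ell2_inner u v) \<le> (\<Sum>n. cmod (cnj (u n) * v n))"
    unfolding ell2_inner_def by (intro summable_norm ell2_inner_summable assms)
  also have "\<dots> \<le> (\<Sum>n. (cmod (u n))\<^sup>2 + (cmod (v n))\<^sup>2)"
  proof (intro suminf_le ell2_inner_summable assms summable_add s)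
    fix n
    show "cmod (cnj (u n) * v n) \<le> (cmod (u n))\<^sup>2 + (cmod (v n))\<^sup>2"
      by (simp add: norm_mult mult_le_sum_squares)
  qed
  also have "\<dots> = (ell2_norm u)\<^sup>2 + (ell2_norm v)\<^sup>2"
    unfolding ell2_norm_square[OF u] ell2_norm_square[OF v] by (intro suminf_add[symmetric] s)
  finally show ?thesis .
qed

lemma ell2_pythagoras:
  assumes P: "ell2_projection P" and u: "u \<in> ell2"
  shows "(ell2_norm u)\<^sup>2 = (ell2_norm (P u))\<^sup>2 + (ell2_norm (\<lambda>n. u n - P u n))\<^sup>2"
proof -
  have Pu: "P u \<in> ell2" using P u by (simp add: ell2_projection_def ell2_linear_def)
  have d: "(\<lambda>n. u n - P u n) \<in> ell2" using u Pu by (rule ell2_diff)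
  have sym: "ell2_inner u (P u) = ell2_inner (P u) (P u)" "ell2_inner (P u) u = ell2_inner (P u) (P u)"
    using P u Pu by (auto simp: ell2_projection_def)
  have "ell2_inner (\<lambda>n. u n - P u n) (\<lambda>n. u n - P u n) = ell2_inner u u - ell2_inner (P u) (P u)"
    using u Pu d by (simp add: ell2_inner_diff_left ell2_inner_diff_right sym)
  then have "complex_of_real ((ell2_norm (\<lambda>n. u n - P u n))\<^sup>2) = of_real ((ell2_norm u)\<^sup>2 - (ell2_norm (P u))\<^sup>2)"
    unfolding ell2_inner_self[OF u] ell2_inner_self[OF Pu] ell2_inner_self[OF d] by simp
  then show ?thesis unfolding of_real_eq_iff by simp
qed

text \<open>
  Polarization.
\<close>

lemma ell2_sesquilinear_zero:
  assumes addl: "\<And>x y w. x \<in> ell2 \<Longrightarrow> y \<in> ell2 \<Longrightarrow> w \<in> ell2 \<Longrightarrow> S (\<lambda>n. x n + y n) w = S x w + S y w"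
    and addr: "\<And>x y w. x \<in> ell2 \<Longrightarrow> y \<in> ell2 \<Longrightarrow> w \<in> ell2 \<Longrightarrow> S w (\<lambda>n. x n + y n) = S w x + S w y"
    and scalel: "\<And>x y. x \<in> ell2 \<Longrightarrow> y \<in> ell2 \<Longrightarrow> S (\<lambda>n. \<i> * x n) y = - \<i> * S x y"
    and scaler: "\<And>x y. x \<in> ell2 \<Longrightarrow> y \<in> ell2 \<Longrightarrow> S x (\<lambda>n. \<i> * y n) = \<i> * S x y"
    and diag: "\<And>x. x \<in> ell2 \<Longrightarrow> S x x = (0 :: complex)"
    and x: "x \<in> ell2" and y: "y \<in> ell2"
  shows "S x y = 0"
proof -
  have *: "S x y + S y x = 0" if x: "x \<in> ell2" and y: "y \<in> ell2" for x y
  proof -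
    have "S (\<lambda>n. x n + y n) (\<lambda>n. x n + y n) = 0" by (rule diag[OF ell2_add[OF x y]])
    then show ?thesis using x y by (simp add: addl addr ell2_add diag)
  qed
  have "S x (\<lambda>n. \<i> * y n) + S (\<lambda>n. \<i> * y n) x = 0" by (rule *[OF x ell2_scale[OF y]])
  then have "\<i> * (S x y - S y x) = 0" using x y by (simp add: scalel scaler algebra_simps)
  then have "S x y - S y x = 0" by simp
  then show ?thesis using *[OF x y] by (simp add: eq_neg_iff_add_eq_0)
qed

section \<open>The resolvent of an operator with a spectral resolution\<close>

text \<open>
  The properties of a spectral resolution yield, in this locale, the resolvent identity
  \<open>\<langle>u, (T - z)\<^sup>-\<^sup>1 u\<rangle> = \<integral> d\<parallel>E(t) u\<parallel>\<^sup>2 / (t - z)\<close>, although only the quadratic form of \<open>T\<close> itself is prescribed. No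
  functional calculus is developed: it suffices to compute \<open>\<langle>E(s) u, T u\<rangle>\<close>.
\<close>

locale spectral =
  fixes T :: "(nat \<Rightarrow> complex) \<Rightarrow> nat \<Rightarrow> complex" and E
  assumes T_linear: "ell2_linear T" and resolution: "spectral_resolution T E"

begin

lemma T_ell2: "u \<in> ell2 \<Longrightarrow> T u \<in> ell2"
  and T_add: "u \<in> ell2 \<Longrightarrow> v \<in> ell2 \<Longrightarrow> T (\<lambda>n. u n + v n) = (\<lambda>n. T u n + T v n)"
  and T_scale: "u \<in> ell2 \<Longrightarrow> T (\<lambda>n. c * u n) = (\<lambda>n. c * T u n)"
  using T_linear by (auto simp: ell2_linear_def)

lemma E_projection: "ell2_projection (E t)"
  using resolution by (simp add: spectral_resolution_def)

lemma E_ell2: "u \<in> ell2 \<Longrightarrow> E t u \<in> ell2"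
  and E_add: "u \<in> ell2 \<Longrightarrow> v \<in> ell2 \<Longrightarrow> E t (\<lambda>n. u n + v n) = (\<lambda>n. E t u n + E t v n)"
  and E_scale: "u \<in> ell2 \<Longrightarrow> E t (\<lambda>n. c * u n) = (\<lambda>n. c * E t u n)"
  and E_sym: "u \<in> ell2 \<Longrightarrow> v \<in> ell2 \<Longrightarrow> ell2_inner (E t u) v = ell2_inner u (E t v)"
  and E_idem: "u \<in> ell2 \<Longrightarrow> E t (E t u) = E t u"
  using E_projection[of t] by (auto simp: ell2_linear_def ell2_projection_def)

lemma E_diff: "u \<in> ell2 \<Longrightarrow> v \<in> ell2 \<Longrightarrow> E t (\<lambda>n. u n - v n) = (\<lambda>n. E t u n - E t v n)"
  using E_add[of u "\<lambda>n. -1 * v n" t] E_scale[of v t "-1"] ell2_scale[of v "-1"] by simp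

lemma E_min: "u \<in> ell2 \<Longrightarrow> E s (E t u) = E (min s t) u"
  using resolution unfolding spectral_resolution_def min_def
  by (cases "s \<le> t") (auto dest: less_imp_le simp: not_le)

text \<open>
  The distribution function of the spectral measure of \<open>u\<close>.
\<close>

definition F :: "(nat \<Rightarrow> complex) \<Rightarrow> real \<Rightarrow> real" where
  "F u t = (ell2_norm (E t u))\<^sup>2"

definition spec :: "(nat \<Rightarrow> complex) \<Rightarrow> real measure" where
  "spec u = interval_measure (F u)"

text \<open>
  Increments are squared norms, by Pythagoras. All properties of a distribution function follow from
  this and the strong limits of \<open>E\<close>.
\<close>

lemma F_increment:
  assumes u: "u \<in> ell2" and "s \<le> t"
  shows "F u t - F u s = (ell2_norm (\<lambda>n. E t u n - E s u n))\<^sup>2"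
proof -
  have "E s (E t u) = E s u" using E_min[OF u, of s t] assms by simp
  then show ?thesis using ell2_pythagoras[OF E_projection[of s] E_ell2[OF u, of t]] by (simp add: F_def)
qed

lemma F_mono: "u \<in> ell2 \<Longrightarrow> s \<le> t \<Longrightarrow> F u s \<le> F u t"
  using F_increment[of u s t] zero_le_power2[of "ell2_norm (\<lambda>n. E t u n - E s u n)"] by linarith

lemma F_right_cont:
  assumes u: "u \<in> ell2"
  shows "continuous (at_right t) (F u)"
proof -
  have "((\<lambda>s. (ell2_norm (\<lambda>n. E s u n - E t u n))\<^sup>2) \<longlongrightarrow> 0\<^sup>2) (at_right t)"
    using resolution u by (intro tendsto_power) (simp add: spectral_resolution_def)
  then have "((\<lambda>s. F u t + (ell2_norm (\<lambda>n. E s u n - E t u n))\<^sup>2) \<longlongrightarrow> F u t + 0\<^sup>2) (at_right t)"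
    by (intro tendsto_add tendsto_const)
  moreover have "F u t + (ell2_norm (\<lambda>n. E s u n - E t u n))\<^sup>2 = F u s" if "t < s" for s
    using F_increment[OF u, of t s] that by simp
  then have "\<forall>\<^sub>F s in at_right t. F u t + (ell2_norm (\<lambda>n. E s u n - E t u n))\<^sup>2 = F u s"
    by (intro eventually_mono[OF eventually_at_right_less])
  ultimately have "(F u \<longlongrightarrow> F u t + 0\<^sup>2) (at_right t)" using tendsto_cong by fastforce
  then show ?thesis by (simp add: continuous_within)
qed

lemma F_at_bot:
  assumes u: "u \<in> ell2"
  shows "(F u \<longlongrightarrow> 0) at_bot"
proof -
  have "((\<lambda>t. (ell2_norm (E t u))\<^sup>2) \<longlongrightarrow> 0\<^sup>2) at_bot"
    using resolution u by (intro tendsto_power) (simp add: spectral_resolution_def)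
  then show ?thesis by (simp add: F_def[abs_def])
qed

lemma F_at_top:
  assumes u: "u \<in> ell2"
  shows "(F u \<longlongrightarrow> (ell2_norm u)\<^sup>2) at_top"
proof -
  have "((\<lambda>t. (ell2_norm u)\<^sup>2 - (ell2_norm (\<lambda>n. E t u n - u n))\<^sup>2) \<longlongrightarrow> (ell2_norm u)\<^sup>2 - 0\<^sup>2) at_top"
    using resolution u by (intro tendsto_power tendsto_diff tendsto_const) (simp add: spectral_resolution_def)
  moreover have "(ell2_norm u)\<^sup>2 - (ell2_norm (\<lambda>n. E t u n - u n))\<^sup>2 = F u t" for t
    using ell2_pythagoras[OF E_projection[of t] u] by (simp add: F_def ell2_norm_def norm_minus_commute)
  ultimately show ?thesis by simp
qed

lemma F_le: "u \<in> ell2 \<Longrightarrow> F u t \<le> (ell2_norm u)\<^sup>2"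
  using ell2_pythagoras[OF E_projection[of t], of u] by (simp add: F_def)

lemma spec_finite: "u \<in> ell2 \<Longrightarrow> finite_borel_measure (spec u)"
  unfolding spec_def
  by (rule finite_borel_measure_interval_measure[OF F_mono F_right_cont F_at_bot F_at_top]) simp_all

lemma spec_total: "u \<in> ell2 \<Longrightarrow> measure (spec u) UNIV = (ell2_norm u)\<^sup>2"
  unfolding spec_def measure_def
  by (subst interval_measure_UNIV[OF F_mono F_right_cont F_at_bot F_at_top]) simp_all

lemma spec_cdf: "u \<in> ell2 \<Longrightarrow> cdf (spec u) = F u"
  unfolding spec_def by (rule cdf_interval_measure[OF F_mono F_right_cont F_at_bot]) simp_all

lemma spec_first_moment:
  assumes "u \<in> ell2"
  shows "integrable (spec u) (\<lambda>t. t)" "ell2_inner u (T u) = of_real (\<integral>t. t \<partial>spec u)"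
  using resolution assms unfolding spectral_resolution_def spec_def F_def by auto

text \<open>
  If the spectral measure of \<open>v\<close> is the restriction of that of \<open>u\<close> to \<open>A\<close>, then the form at \<open>v\<close> is the
  first moment over \<open>A\<close>. This is applied to the two components \<open>E(s) u\<close> and \<open>u - E(s) u\<close>.
\<close>

lemma spec_restrict:
  assumes u: "u \<in> ell2" and v: "v \<in> ell2" and A [measurable]: "A \<in> sets borel"
    and F: "\<And>t. F v t = measure (spec u) (A \<inter> {..t})"
  shows "ell2_inner v (T v) = of_real (\<integral>t. indicator A t * t \<partial>spec u)"
proof -
  interpret finite_borel_measure "spec u" using spec_finite[OF u] .
  note [measurable_cong] = M_is_borel
  have "spec v = density (spec u) (\<lambda>t. ennreal (indicator A t))"
  proof (rule cdf_unique')
    show "cdf (spec v) = cdf (density (spec u) (\<lambda>t. ennreal (indicator A t)))"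
      unfolding spec_cdf[OF v] finite_borel_measure_density_indicator(2)[OF spec_finite[OF u] A, abs_def]
      using F by (simp add: fun_eq_iff)
  qed (intro spec_finite v finite_borel_measure_density_indicator(1) u A)+
  then have "(\<integral>t. t \<partial>spec v) = (\<integral>t. indicator A t * t \<partial>spec u)"
    by (simp add: integral_density)
  then show ?thesis using spec_first_moment(2)[OF v] by simp
qed

text \<open>
  With \<open>p = E(s) u\<close> and \<open>q = u - p\<close>, the spectral measure of \<open>u\<close> splits into its parts on \<open>{..s}\<close> and
  \<open>{s<..}\<close>, so the forms at \<open>p\<close> and \<open>q\<close> add up to the form at \<open>u\<close> and the cross terms
  \<open>\<langle>p, T q\<rangle> + \<langle>q, T p\<rangle>\<close> cancel. Hence \<open>\<langle>p, T q\<rangle> = 0\<close>, and only \<open>\<langle>p, T p\<rangle>\<close> is left. This is the substitute for the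
  commutation of \<open>E(s)\<close> with \<open>T\<close>.
\<close>

lemma ell2_inner_E_T:
  assumes u: "u \<in> ell2"
  shows "ell2_inner (E s u) (T u) = of_real (\<integral>t. indicator {..s} t * t \<partial>spec u)"
proof -
  let ?q = "\<lambda>u n. u n - E s u n"
  have meas: "measure (spec u) ({..s} \<inter> {..t}) = F u (min s t)" if u: "u \<in> ell2" for u t
  proof -
    have "{..s} \<inter> {..t} = {..min s t}" by auto
    then show ?thesis using fun_cong[OF spec_cdf[OF u], of "min s t"] by (simp add: cdf_def)
  qed
  have lower: "ell2_inner (E s u) (T (E s u)) = of_real (\<integral>t. indicator {..s} t * t \<partial>spec u)" if u: "u \<in> ell2" for u
  proof (rule spec_restrict[OF u E_ell2[OF u]])
    show "F (E s u) t = measure (spec u) ({..s} \<inter> {..t})" for t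
      unfolding meas[OF u] F_def E_min[OF u] by (simp only: min.commute)
  qed simp
  have upper: "ell2_inner (?q u) (T (?q u)) = of_real (\<integral>t. indicator {s<..} t * t \<partial>spec u)" if u: "u \<in> ell2" for u
  proof (intro spec_restrict[OF u ell2_diff[OF u E_ell2[OF u]]])
    fix t
    interpret finite_borel_measure "spec u" using spec_finite[OF u] .
    have "{s<..} \<inter> {..t} = {..t} - ({..s} \<inter> {..t})" by auto
    then have "measure (spec u) ({s<..} \<inter> {..t}) = measure (spec u) {..t} - measure (spec u) ({..s} \<inter> {..t})"
      using M_is_borel by (simp add: finite_measure_Diff)
    also have "\<dots> = F u t - F u (min s t)"
      using meas[OF u, of t] fun_cong[OF spec_cdf[OF u], of t] by (simp add: cdf_def)
    also have "\<dots> = (ell2_norm (\<lambda>n. E t u n - E (min s t) u n))\<^sup>2" by (rule F_increment[OF u]) simp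
    also have "\<dots> = F (?q u) t"
      unfolding F_def using u by (simp add: E_diff E_ell2 E_min min.commute)
    finally show "F (?q u) t = measure (spec u) ({s<..} \<inter> {..t})" ..
  qed simp
  have expand: "ell2_inner (\<lambda>n. p n + q n) (T (\<lambda>n. p n + q n)) =
      ell2_inner p (T p) + ell2_inner q (T q) + (ell2_inner p (T q) + ell2_inner q (T p))"
    if "p \<in> ell2" "q \<in> ell2" for p q
    using that by (simp add: T_add T_ell2 ell2_inner_add_left ell2_inner_add_right ell2_add)
  have cross: "ell2_inner (E s u) (T (?q u)) + ell2_inner (?q u) (T (E s u)) = 0" if u: "u \<in> ell2" for u
  proof -
    have q: "?q u \<in> ell2" using ell2_diff[OF u E_ell2[OF u]] .
    have "ell2_inner u (T u) = of_real (\<integral>t. t \<partial>spec u)" by (rule spec_first_moment(2)[OF u])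
    also have "(\<integral>t. t \<partial>spec u) = (\<integral>t. indicator {..s} t * t + indicator {s<..} t * t \<partial>spec u)"
      by (intro Bochner_Integration.integral_cong) (auto simp: indicator_def)
    also have "\<dots> = (\<integral>t. indicator {..s} t * t \<partial>spec u) + (\<integral>t. indicator {s<..} t * t \<partial>spec u)"
      using spec_first_moment(1)[OF u] finite_borel_measure.M_is_borel[OF spec_finite[OF u]]
      by (intro Bochner_Integration.integral_add integrable_real_mult_indicator[unfolded mult.commute[of _ "indicator _ _"]]) auto
    finally have "ell2_inner u (T u) = ell2_inner (E s u) (T (E s u)) + ell2_inner (?q u) (T (?q u))"
      using lower[OF u] upper[OF u] by simp
    then show ?thesis using expand[OF E_ell2[OF u, of s] q] by simp
  qed
  \<comment> \<open>The relation \<open>cross\<close> concerns only the sum of the two cross terms. Applied to \<open>?p + i ?r\<close>,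
    it also gives their difference, so each of them vanishes.\<close>
  let ?p = "E s u" and ?r = "?q u"
  have p: "?p \<in> ell2" and r: "?r \<in> ell2" using E_ell2[OF u] ell2_diff[OF u E_ell2[OF u]] by auto
  let ?w = "\<lambda>n. ?p n + \<i> * ?r n"
  have w: "?w \<in> ell2" using p r by (intro ell2_add ell2_scale)
  have Er: "E s ?r = (\<lambda>n. 0)" using u by (simp add: E_diff E_ell2 E_idem)
  have Ew: "E s ?w = ?p" using p r Er u by (simp add: E_add ell2_scale E_scale[OF r] E_idem)
  have "?q ?w = (\<lambda>n. \<i> * ?r n)" unfolding Ew by simp
  then have "ell2_inner ?p (T (\<lambda>n. \<i> * ?r n)) + ell2_inner (\<lambda>n. \<i> * ?r n) (T ?p) = 0"
    using cross[OF w] Ew by simp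
  moreover have "ell2_inner p (T (\<lambda>n. \<i> * r n)) + ell2_inner (\<lambda>n. \<i> * r n) (T p)
      = \<i> * (ell2_inner p (T r) - ell2_inner r (T p))" if "p \<in> ell2" "r \<in> ell2" for p r
    using that by (simp add: T_scale T_ell2 ell2_inner_scale_left ell2_inner_scale_right right_diff_distrib)
  ultimately have "\<i> * (ell2_inner ?p (T ?r) - ell2_inner ?r (T ?p)) = 0"
    using p r by metis
  then have "ell2_inner ?p (T ?r) = 0" using cross[OF u] by simp
  moreover have "T u = (\<lambda>n. T ?p n + T ?r n)" using T_add[OF p r] by simp
  ultimately have "ell2_inner ?p (T u) = ell2_inner ?p (T ?p)"
    using p r by (simp add: ell2_inner_add_right T_ell2)
  then show ?thesis using lower[OF u] by simp
qed

lemma ell2_inner_E_self: "u \<in> ell2 \<Longrightarrow> ell2_inner (E s u) u = of_real (F u s)"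
  using ell2_inner_self[OF E_ell2[of u s]] E_sym[OF E_ell2[of u s], of u s] E_idem[of u s]
  by (simp add: F_def)

text \<open>
  By polarization, the real and imaginary parts are combinations of monotone functions of \<open>s\<close>.
\<close>

lemma ell2_inner_E_measurable:
  assumes x: "x \<in> ell2" and y: "y \<in> ell2"
  shows "(\<lambda>s. ell2_inner (E s x) y) \<in> borel_measurable borel"
proof -
  have Re: "Re (ell2_inner (E s x) y) = (F (\<lambda>n. x n + y n) s - F x s - F y s) / 2"
    if x: "x \<in> ell2" and y: "y \<in> ell2" for x y s
  proof -
    have "ell2_inner (E s x) y + cnj (ell2_inner (E s x) y) = ell2_inner (E s x) y + ell2_inner (E s y) x"
      using ell2_inner_cnj[OF E_ell2[OF x] y, of s] E_sym[OF y x] by simp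
    also have "of_real (F x s) + of_real (F y s) + \<dots> = of_real (F (\<lambda>n. x n + y n) s)"
      unfolding ell2_inner_E_self[OF x, symmetric] ell2_inner_E_self[OF y, symmetric]
        ell2_inner_E_self[OF ell2_add[OF x y], symmetric]
      using x y by (simp add: E_add E_ell2 ell2_inner_add_left ell2_inner_add_right ell2_add)
    finally have "complex_of_real (F x s + F y s + 2 * Re (ell2_inner (E s x) y)) = of_real (F (\<lambda>n. x n + y n) s)"
      by (simp add: complex_add_cnj)
    then show ?thesis unfolding of_real_eq_iff by simp
  qed
  have F_meas: "F x \<in> borel_measurable borel" if "x \<in> ell2" for x
    using F_mono[OF that] by (intro borel_measurable_mono monoI)
  have Im: "Im (ell2_inner (E s x) y) = Re (ell2_inner (E s x) (\<lambda>n. - \<i> * y n))" for s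
    unfolding ell2_inner_scale_right[OF E_ell2[OF x] y] by simp
  have 1: "(\<lambda>s. Re (ell2_inner (E s x) y)) \<in> borel_measurable borel" if "x \<in> ell2" "y \<in> ell2" for x y
    unfolding Re[OF that] using that by (intro borel_measurable_divide borel_measurable_diff F_meas ell2_add) auto
  have "(\<lambda>s. Im (ell2_inner (E s x) y)) \<in> borel_measurable borel"
    unfolding Im using x y by (intro 1 ell2_scale)
  with 1[OF x y] show ?thesis by (subst borel_measurable_complex_iff) simp
qed

text \<open>
  The sesquilinear form of the operator \<open>\<integral> dE(t) / (t - z)\<close>, integrated by parts as in
  \<open>stieltjes_cdf_integral\<close> so that no complex measures are needed.
\<close>

definition K :: "complex \<Rightarrow> (nat \<Rightarrow> complex) \<Rightarrow> (nat \<Rightarrow> complex) \<Rightarrow> complex" where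
  "K z x y = (\<integral>s. ell2_inner (E s x) y / (of_real s - z)\<^sup>2 \<partial>lborel)"

lemma K_integrable:
  assumes z: "Im z > 0" and x: "x \<in> ell2" and y: "y \<in> ell2"
  shows "integrable lborel (\<lambda>s. ell2_inner (E s x) y / (of_real s - z)\<^sup>2)"
proof (rule Bochner_Integration.integrable_bound)
  let ?B = "(ell2_norm x)\<^sup>2 + (ell2_norm y)\<^sup>2"
  show "integrable lborel (\<lambda>s. ?B *\<^sub>R norm (1 / (complex_of_real s - z)\<^sup>2))"
    by (intro integrable_scaleR_right integrable_norm cauchy_kernel_integrable z)
  show "AE s in lborel. norm (ell2_inner (E s x) y / (of_real s - z)\<^sup>2) \<le> norm (?B *\<^sub>R norm (1 / (complex_of_real s - z)\<^sup>2))"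
  proof (intro AE_I2)
    fix s
    have "cmod (ell2_inner (E s x) y) \<le> F x s + (ell2_norm y)\<^sup>2"
      using ell2_inner_bound[OF E_ell2[OF x] y] by (simp add: F_def)
    also have "\<dots> \<le> ?B" using F_le[OF x] by simp
    finally have "cmod (ell2_inner (E s x) y) * norm (1 / (complex_of_real s - z)\<^sup>2)
       \<le> ?B * norm (1 / (complex_of_real s - z)\<^sup>2)"
      by (intro mult_right_mono) auto
    then show "norm (ell2_inner (E s x) y / (of_real s - z)\<^sup>2) \<le> norm (?B *\<^sub>R norm (1 / (complex_of_real s - z)\<^sup>2))"
      by (simp add: norm_divide)
  qed
  have [measurable]: "(\<lambda>s. ell2_inner (E s x) y) \<in> borel_measurable borel"
    by (rule ell2_inner_E_measurable[OF x y])
  show "(\<lambda>s. ell2_inner (E s x) y / (of_real s - z)\<^sup>2) \<in> borel_measurable lborel" by measurable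
qed

text \<open>
  The diagonal of the identity \<open>K z x ((T - z) y) = \<langle>x, y\<rangle>\<close>, which says that \<open>K z\<close> is the form of the
  resolvent.
\<close>

lemma K_diagonal:
  assumes z: "Im z > 0" and x: "x \<in> ell2"
  shows "K z x (\<lambda>n. T x n - z * x n) = ell2_inner x x"
proof -
  interpret finite_borel_measure "spec x" using spec_finite[OF x] .
  note [measurable_cong] = M_is_borel
  have int: "integrable (spec x) (\<lambda>t. complex_of_real t - z)"
    using spec_first_moment(1)[OF x] by (intro Bochner_Integration.integrable_diff integrable_of_real) auto
  have nz: "complex_of_real t - z \<noteq> 0" for t using z by (intro of_real_minus_nonzero) simp
  \<comment> \<open>The factor \<open>t - z\<close> in the integrand cancels the Stieltjes kernel.\<close>
  have "ell2_inner (E s x) (\<lambda>n. T x n - z * x n) = (\<integral>t. indicator {..s} t *\<^sub>R (of_real t - z) \<partial>spec x)" for s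
  proof -
    have "(\<integral>t. indicator {..s} t *\<^sub>R (of_real t - z) \<partial>spec x)
      = (\<integral>t. of_real (indicator {..s} t * t) - z * of_real (indicator {..s} t) \<partial>spec x)"
      by (intro Bochner_Integration.integral_cong) (auto simp: indicator_def)
    also have "\<dots> = (\<integral>t. of_real (indicator {..s} t * t) \<partial>spec x) - (\<integral>t. z * of_real (indicator {..s} t) \<partial>spec x)"
      using spec_first_moment(1)[OF x] M_is_borel
      by (intro Bochner_Integration.integral_diff integrable_of_real integrable_mult_right
          integrable_real_mult_indicator[unfolded mult.commute[of _ "indicator _ _"]] integrable_real_indicator) 
        (auto simp: emeasure_eq_measure)
    also have "\<dots> = of_real (\<integral>t. indicator {..s} t * t \<partial>spec x) - z * of_real (\<integral>t. indicator {..s} t \<partial>spec x)"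
      by (simp only: integral_complex_of_real integral_mult_right_zero)
    also have "(\<integral>t. indicator {..s} t \<partial>spec x) = F x s"
      using M_is_borel fun_cong[OF spec_cdf[OF x], of s] by (simp add: cdf_def)
    also have "of_real (\<integral>t. indicator {..s} t * t \<partial>spec x) - z * of_real (F x s) = ell2_inner (E s x) (\<lambda>n. T x n - z * x n)"
      using x by (simp add: ell2_inner_diff_right ell2_inner_scale_right ell2_scale T_ell2 E_ell2
          ell2_inner_E_T ell2_inner_E_self)
    finally show ?thesis ..
  qed
  then have "K z x (\<lambda>n. T x n - z * x n) = (\<integral>t. (of_real t - z) / (of_real t - z) \<partial>spec x)"
    unfolding K_def stieltjes_layer_cake(1)[OF spec_finite[OF x] z int] by simp
  also have "\<dots> = of_real ((ell2_norm x)\<^sup>2)"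
    using nz spec_total[OF x] sets_eq_imp_space_eq[OF M_is_borel] by (simp add: scaleR_conv_of_real)
  finally show ?thesis unfolding ell2_inner_self[OF x] .
qed

text \<open>
  Polarizing \<open>K_diagonal\<close> and inserting \<open>(T - z) v = u\<close>.
\<close>

lemma resolvent_form:
  assumes z: "Im z > 0" and u: "u \<in> ell2" and v: "v \<in> ell2"
    and eq: "(\<lambda>n. T v n - z * v n) = u"
  shows "ell2_inner u v = (\<integral>s. of_real (F u s) / (of_real s - z)\<^sup>2 \<partial>lborel)"
proof -
  let ?R = "\<lambda>y n. T y n - z * y n"
  let ?S = "\<lambda>x y. K z x (?R y) - ell2_inner x y"
  have R: "?R y \<in> ell2" if "y \<in> ell2" for y using that by (intro ell2_diff ell2_scale T_ell2)
  have Radd: "?R (\<lambda>n. x n + y n) = (\<lambda>n. ?R x n + ?R y n)" if "x \<in> ell2" "y \<in> ell2" for x y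
    using that by (auto simp: T_add algebra_simps)
  have Rscale: "?R (\<lambda>n. c * x n) = (\<lambda>n. c * ?R x n)" if "x \<in> ell2" for x c
    using that by (auto simp: T_scale algebra_simps)
  have Kaddr: "K z w (\<lambda>n. x n + y n) = K z w x + K z w y"
    and Kaddl: "K z (\<lambda>n. x n + y n) w = K z x w + K z y w"
    if "x \<in> ell2" "y \<in> ell2" "w \<in> ell2" for x y w
    unfolding K_def
    using Bochner_Integration.integral_add[OF K_integrable[OF z that(3,1)] K_integrable[OF z that(3,2)]]
      Bochner_Integration.integral_add[OF K_integrable[OF z that(1,3)] K_integrable[OF z that(2,3)]] that
    by (simp_all add: E_add E_ell2 ell2_inner_add_left ell2_inner_add_right add_divide_distrib)
  have Kscaler: "K z x (\<lambda>n. c * y n) = c * K z x y"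
    and Kscalel: "K z (\<lambda>n. c * x n) y = cnj c * K z x y"
    if "x \<in> ell2" "y \<in> ell2" for x y c
    unfolding K_def integral_mult_right_zero[symmetric]
    using that by (simp_all add: E_scale E_ell2 ell2_inner_scale_left ell2_inner_scale_right)
  have "?S u v = 0"
  proof (rule ell2_sesquilinear_zero[of ?S])
    show "?S (\<lambda>n. x n + y n) w = ?S x w + ?S y w" if "x \<in> ell2" "y \<in> ell2" "w \<in> ell2" for x y w
      using Kaddl[OF that(1,2) R[OF that(3)]] that by (simp add: ell2_inner_add_left)
    show "?S w (\<lambda>n. x n + y n) = ?S w x + ?S w y" if "x \<in> ell2" "y \<in> ell2" "w \<in> ell2" for x y w
      using Kaddr[OF R[OF that(1)] R[OF that(2)] that(3)] that unfolding Radd[OF that(1,2)]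
      by (simp add: ell2_inner_add_right)
    show "?S (\<lambda>n. \<i> * x n) y = - \<i> * ?S x y" if "x \<in> ell2" "y \<in> ell2" for x y
      using Kscalel[OF that(1) R[OF that(2)], of \<i>] that by (simp add: ell2_inner_scale_left algebra_simps)
    show "?S x (\<lambda>n. \<i> * y n) = \<i> * ?S x y" if "x \<in> ell2" "y \<in> ell2" for x y
      using Kscaler[OF that(1) R[OF that(2)], of \<i>] that unfolding Rscale[OF that(2)]
      by (simp add: ell2_inner_scale_right right_diff_distrib)
    show "?S x x = 0" if "x \<in> ell2" for x using K_diagonal[OF z that] by simp
  qed fact+
  then have "ell2_inner u v = K z u u" unfolding eq by simp
  also have "\<dots> = (\<integral>s. of_real (F u s) / (of_real s - z)\<^sup>2 \<partial>lborel)"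
    unfolding K_def ell2_inner_E_self[OF u] ..
  finally show ?thesis .
qed

end

section \<open>Solutions of the Jacobi difference equation\<close>

text \<open>
  The coefficient \<open>a 0 = 1\<close> lets the difference equation at site 1 have the same form as at all other
  sites.
\<close>

locale jacobi =
  fixes a b :: "nat \<Rightarrow> real" and M :: real
  assumes a_0: "a 0 = 1" and M_pos: "M > 0"
    and a_lower: "\<And>n. n \<ge> 1 \<Longrightarrow> inverse (M + 1) \<le> a n"
    and a_upper: "\<And>n. n \<ge> 1 \<Longrightarrow> a n \<le> M + 1"
    and b_bound: "\<And>n. n \<ge> 1 \<Longrightarrow> \<bar>b n\<bar> \<le> M"

begin

lemma a_pos: "a n > 0"
proof (cases "n = 0")
  case False
  then have "inverse (M + 1) \<le> a n" using a_lower[of n] by simp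
  moreover have "inverse (M + 1) > 0" using M_pos by simp
  ultimately show ?thesis by linarith
qed (simp add: a_0)

lemma a_nonzero [simp]: "a n \<noteq> 0"
  using a_pos[of n] by simp

lemma a_le: "a n \<le> M + 1"
  using a_upper[of n] M_pos by (cases "n = 0") (auto simp: a_0)

text \<open>
  The difference expression of the Jacobi matrix, acting on sequences that also have an entry at
  site 0.
\<close>

definition tau :: "(nat \<Rightarrow> complex) \<Rightarrow> nat \<Rightarrow> complex" where
  "tau f n = of_real (a n) * f (n + 1) + of_real (a (n - 1)) * f (n - 1) + of_real (b n) * f n"

definition solves :: "complex \<Rightarrow> (nat \<Rightarrow> complex) \<Rightarrow> bool" where
  "solves z f \<longleftrightarrow> (\<forall>n\<ge>1. tau f n = z * f n)"

text \<open>
  Summation by parts. Every identity about solutions below (constancy of the Wronskian, the energy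
  identity, the Christoffel--Darboux formula) is an instance.
\<close>

lemma green_formula:
  "(\<Sum>n=1..N. f n * tau h n - tau f n * h n) =
     of_real (a N) * (f N * h (N + 1) - f (N + 1) * h N) - (f 0 * h 1 - f 1 * h 0)"
proof (induction N)
  case (Suc N)
  then show ?case by (simp add: tau_def algebra_simps)
qed (simp add: a_0)

lemma solves_jacobi_sol: "solves z (jacobi_sol a b z c0 c1)"
  using jacobi_sol_unique[of a "jacobi_sol a b z c0 c1" b z c0 c1]
  by (simp add: solves_def tau_def)

lemma solves_eq_jacobi_sol: "solves z f \<Longrightarrow> f = jacobi_sol a b z (f 0) (f 1)"
  using jacobi_sol_unique[of a f b z "f 0" "f 1"]
  by (simp add: solves_def tau_def)

lemma solves_f_minus: "solves z (\<lambda>n. f_minus a b n z)"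
  unfolding f_minus_def using solves_jacobi_sol by simp

lemma solves_f_plus: "solves z (\<lambda>n. f_plus a b n z)"
  unfolding f_plus_def using solves_jacobi_sol by simp

lemma f_minus_0 [simp]: "f_minus a b 0 z = 0"
  and f_minus_1 [simp]: "f_minus a b (Suc 0) z = 1"
  by (simp_all add: f_minus_def)

lemma f_plus_0 [simp]: "f_plus a b 0 z = 1"
  and f_plus_1 [simp]: "f_plus a b (Suc 0) z = - green a b 1 z"
  by (simp_all add: f_plus_def)

lemma solves_cnj: "solves z f \<Longrightarrow> solves (cnj z) (\<lambda>n. cnj (f n))"
proof -
  assume "solves z f"
  then have "cnj (tau f n) = cnj (z * f n)" if "n \<ge> 1" for n
    using that by (simp add: solves_def)
  then show ?thesis by (simp add: solves_def tau_def)
qed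

lemma wronskian_constant:
  assumes "solves z f" "solves z h"
  shows "of_real (a N) * (f N * h (N + 1) - f (N + 1) * h N) = f 0 * h 1 - f 1 * h 0"
proof -
  have "(\<Sum>n=1..N. f n * tau h n - tau f n * h n) = 0"
    using assms by (intro sum.neutral) (simp add: solves_def)
  then show ?thesis using green_formula[of f h N] by simp
qed

text \<open>
  Green's formula for a solution and its complex conjugate.
\<close>

lemma energy_identity:
  assumes "solves z f"
  shows "Im z * (\<Sum>n=1..N. (cmod (f n))\<^sup>2) =
    a N * Im (cnj (f N) * f (N + 1)) - Im (cnj (f 0) * f 1)"
proof -
  let ?h = "\<lambda>n. cnj (f n)"
  have c: "Im (cnj x * y - cnj y * x) = 2 * Im (cnj x * y)" for x y
    by (simp add: algebra_simps)
  have eq: "?h n * tau f n - tau ?h n * f n = 2 * \<i> * of_real (Im z * (cmod (f n))\<^sup>2)"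
    if "n \<in> {1..N}" for n
  proof -
    have "?h n * tau f n - tau ?h n * f n = (z - cnj z) * (f n * cnj (f n))"
      using that assms solves_cnj[OF assms] by (simp add: solves_def algebra_simps)
    also have "z - cnj z = 2 * \<i> * of_real (Im z)"
      by (simp add: complex_eq_iff)
    also have "f n * cnj (f n) = of_real ((cmod (f n))\<^sup>2)"
      by (rule complex_norm_square[symmetric])
    finally show ?thesis by simp
  qed
  have "(\<Sum>n=1..N. ?h n * tau f n - tau ?h n * f n)
      = (\<Sum>n=1..N. 2 * \<i> * of_real (Im z * (cmod (f n))\<^sup>2))"
    by (rule sum.cong[OF refl eq])
  also have "\<dots> = 2 * \<i> * of_real (Im z * (\<Sum>n=1..N. (cmod (f n))\<^sup>2))"
    by (simp add: sum_distrib_left)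
  finally have "Im (2 * \<i> * of_real (Im z * (\<Sum>n=1..N. (cmod (f n))\<^sup>2))) =
      Im (of_real (a N) * (?h N * f (N + 1) - ?h (N + 1) * f N) - (?h 0 * f 1 - ?h 1 * f 0))"
    using green_formula[of ?h f N] by simp
  also have "\<dots> = 2 * (a N * Im (cnj (f N) * f (N + 1)) - Im (cnj (f 0) * f 1))"
    using c[of "f N" "f (N + 1)"] c[of "f 0" "f 1"] by (simp add: algebra_simps)
  finally show ?thesis by simp
qed

lemma f_minus_energy:
  "Im z * (\<Sum>n=1..N. (cmod (f_minus a b n z))\<^sup>2) =
    a N * Im (cnj (f_minus a b N z) * f_minus a b (N + 1) z)"
  using energy_identity[OF solves_f_minus, of z N] by simp

lemma f_minus_energy_pos:
  assumes "Im z > 0" "N \<ge> 1"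
  shows "Im (cnj (f_minus a b N z) * f_minus a b (N + 1) z) > 0"
proof -
  have "(cmod (f_minus a b 1 z))\<^sup>2 \<le> (\<Sum>n=1..N. (cmod (f_minus a b n z))\<^sup>2)"
    using assms by (intro member_le_sum) auto
  then have "(\<Sum>n=1..N. (cmod (f_minus a b n z))\<^sup>2) > 0" by simp
  then have "a N * Im (cnj (f_minus a b N z) * f_minus a b (N + 1) z) > 0"
    unfolding f_minus_energy[symmetric] using assms by (intro mult_pos_pos)
  then show ?thesis using a_pos[of N] by (simp only: zero_less_mult_iff) auto
qed

lemma f_minus_nonzero:
  assumes "Im z > 0" "N \<ge> 1"
  shows "f_minus a b N z \<noteq> 0"
  using f_minus_energy_pos[OF assms] by auto

text \<open>
  The Herglotz property of \<open>m_minus\<close>, in a quantitative form.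
\<close>

lemma f_minus_ratio_Im:
  assumes "Im z > 0" "N \<ge> 1"
  shows "a N * Im (f_minus a b (N + 1) z / f_minus a b N z) \<ge> Im z"
proof -
  let ?f = "\<lambda>n. f_minus a b n z"
  have nz: "?f N \<noteq> 0" using f_minus_nonzero[OF assms] .
  have "(cmod (?f N))\<^sup>2 \<le> (\<Sum>n=1..N. (cmod (?f n))\<^sup>2)"
    using assms by (intro member_le_sum) auto
  then have "Im z * (cmod (?f N))\<^sup>2 \<le> a N * Im (cnj (?f N) * ?f (N + 1))"
    unfolding f_minus_energy[symmetric] using assms by (intro mult_left_mono) auto
  then show ?thesis
    using nz by (simp only: Im_divide_eq[OF nz]) (simp add: field_simps)
qed

lemma f_minus_ratio_pos:
  assumes "Im z > 0" "N \<ge> 1"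
  shows "Im (f_minus a b (N + 1) z / f_minus a b N z) > 0"
proof -
  have "a N * Im (f_minus a b (N + 1) z / f_minus a b N z) > 0"
    using f_minus_ratio_Im[OF assms] assms by linarith
  then show ?thesis using a_pos[of N] by (simp only: zero_less_mult_iff) auto
qed

text \<open>
  The solution with initial values \<open>1\<close> and \<open>c\<close>; the Weyl solution is the one for \<open>c = - m_plus(z)\<close>.
\<close>

definition weyl :: "complex \<Rightarrow> complex \<Rightarrow> nat \<Rightarrow> complex" where
  "weyl z c = jacobi_sol a b z 1 c"

lemma weyl_eq: "weyl z c n = jacobi_sol a b z 1 0 n + c * f_minus a b n z"
proof -
  let ?s = "jacobi_sol a b z 1 0"
  define h where "h = (\<lambda>n. ?s n + c * f_minus a b n z)"
  have "tau h n = z * h n" if n: "n \<ge> 1" for n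
  proof -
    have "tau h n = tau ?s n + c * tau (\<lambda>n. f_minus a b n z) n"
      by (simp add: tau_def h_def algebra_simps)
    also have "\<dots> = z * ?s n + c * (z * f_minus a b n z)"
      using n solves_jacobi_sol[of z 1 0] solves_f_minus[of z] by (simp add: solves_def)
    finally show ?thesis by (simp add: h_def algebra_simps)
  qed
  then have "h = jacobi_sol a b z (h 0) (h 1)"
    by (intro solves_eq_jacobi_sol) (simp add: solves_def)
  moreover have "h 0 = 1" "h 1 = c" by (simp_all add: h_def)
  ultimately have "h n = weyl z c n" unfolding weyl_def by simp
  then show ?thesis by (simp add: h_def)
qed

text \<open>
  For a solution that vanishes at the right end of the interval, the energy identity reads
  \<open>Im z * \<Sum> |f n|\<^sup>2 = - Im c\<close>, and the sum is at least \<open>|c|\<^sup>2\<close>. The bounds do not depend on the length of the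
  interval.
\<close>

lemma truncated_weyl_bounds:
  assumes z: "Im z > 0" and N: "N \<ge> 1"
    and zero: "weyl z c (N + 1) = 0"
  shows "cmod c \<le> 1 / Im z" "(\<Sum>n=1..N. (cmod (weyl z c n))\<^sup>2) \<le> 1 / (Im z)\<^sup>2"
proof -
  let ?S = "\<Sum>n=1..N. (cmod (weyl z c n))\<^sup>2"
  have "solves z (weyl z c)" unfolding weyl_def by (rule solves_jacobi_sol)
  from energy_identity[OF this, of N] have E: "Im z * ?S = - Im c"
    using zero by (simp add: weyl_def)
  have "(cmod (weyl z c 1))\<^sup>2 \<le> ?S"
    using N by (intro member_le_sum) auto
  then have "Im z * (cmod c)\<^sup>2 \<le> Im z * ?S" using z by (simp add: weyl_def)
  also have "\<dots> \<le> cmod c" using E abs_Im_le_cmod[of c] by linarith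
  finally have *: "Im z * (cmod c)\<^sup>2 \<le> cmod c" .
  show c: "cmod c \<le> 1 / Im z"
  proof (cases "c = 0")
    case False
    then have "Im z * cmod c \<le> 1" using * by (simp add: power2_eq_square)
    then show ?thesis using z by (simp add: field_simps)
  qed (use z in simp)
  have "Im z * ?S \<le> 1 / Im z" using E abs_Im_le_cmod[of c] c by linarith
  then show "?S \<le> 1 / (Im z)\<^sup>2" using z by (simp add: field_simps power2_eq_square)
qed

text \<open>
  Existence of the resolvent without functional analysis: the initial values of the truncated problems
  stay in a compact disc, and a limit point inherits the uniform bound on the square sums.
\<close>

lemma square_summable_weyl_exists:
  assumes z: "Im z > 0"
  obtains c where "summable (\<lambda>n. (cmod (weyl z c n))\<^sup>2)"
proof -
  \<comment> \<open>\<open>C N\<close> is the initial value of the solution that vanishes at the right end \<open>N + 2\<close>; the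
    index is shifted so that the minimal truncation still has a site.\<close>
  define C where "C N = - jacobi_sol a b z 1 0 (N + 2) / f_minus a b (N + 2) z" for N
  have zero: "weyl z (C N) (N + 1 + 1) = 0" for N
    using f_minus_nonzero[OF z, of "N + 2"] by (simp add: weyl_eq C_def)
  have Cb: "cmod (C N) \<le> 1 / Im z"
    and sumb: "(\<Sum>n=1..N+1. (cmod (weyl z (C N) n))\<^sup>2) \<le> 1 / (Im z)\<^sup>2" for N
    using truncated_weyl_bounds[OF z _ zero] by auto
  have "bounded (range C)" using Cb by (auto simp: bounded_iff)
  then obtain c r where r: "strict_mono r" and lim: "(C \<circ> r) \<longlonglongrightarrow> c"
    using bounded_imp_convergent_subsequence by blast
  have bound: "(\<Sum>n<K. (cmod (weyl z c n))\<^sup>2) \<le> 1 + 1 / (Im z)\<^sup>2" for K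
  proof (rule tendsto_upperbound)
    show "(\<lambda>j. \<Sum>n<K. (cmod (weyl z ((C \<circ> r) j) n))\<^sup>2) \<longlonglongrightarrow> (\<Sum>n<K. (cmod (weyl z c n))\<^sup>2)"
      unfolding weyl_eq by (intro tendsto_intros lim)
    show "\<forall>\<^sub>F j in sequentially. (\<Sum>n<K. (cmod (weyl z ((C \<circ> r) j) n))\<^sup>2) \<le> 1 + 1 / (Im z)\<^sup>2"
    proof (rule eventually_sequentiallyI[of K])
      fix j assume "K \<le> j"
      then have "K \<le> r j" using seq_suble[OF r, of j] by simp
      then have "(\<Sum>n<K. (cmod (weyl z (C (r j)) n))\<^sup>2) \<le> (\<Sum>n\<in>insert 0 {1..r j + 1}. (cmod (weyl z (C (r j)) n))\<^sup>2)"
        by (intro sum_mono2) auto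
      also have "\<dots> = 1 + (\<Sum>n=1..r j+1. (cmod (weyl z (C (r j)) n))\<^sup>2)"
        by (subst sum.insert) (auto simp: weyl_def)
      finally show "(\<Sum>n<K. (cmod (weyl z ((C \<circ> r) j) n))\<^sup>2) \<le> 1 + 1 / (Im z)\<^sup>2"
        using sumb[of "r j"] by simp
    qed
  qed simp
  have "summable (\<lambda>n. (cmod (weyl z c n))\<^sup>2)"
    by (rule bounded_imp_summable[where B = "1 + 1 / (Im z)\<^sup>2"])
      (use bound[of "Suc _"] in \<open>simp_all add: lessThan_Suc_atMost\<close>)
  then show ?thesis by (rule that)
qed

lemma square_summable_boundary_term:
  assumes "summable (\<lambda>n. (cmod (f n))\<^sup>2)"
  shows "(\<lambda>N. a N * Im (cnj (f N) * f (N + 1))) \<longlonglongrightarrow> 0"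
proof (rule Lim_null_comparison)
  have "(\<lambda>n. (cmod (f n))\<^sup>2) \<longlonglongrightarrow> 0" using summable_LIMSEQ_zero[OF assms] .
  then have f0: "(\<lambda>n. cmod (f n)) \<longlonglongrightarrow> 0"
    using tendsto_real_sqrt by fastforce
  show "(\<lambda>N. (M + 1) * (cmod (f N) * cmod (f (N + 1)))) \<longlonglongrightarrow> 0"
    using tendsto_mult_left[OF tendsto_mult[OF f0 LIMSEQ_ignore_initial_segment[OF f0, of 1]], of "M + 1"]
    by simp
  have "\<bar>a N * Im (cnj (f N) * f (N + 1))\<bar> \<le> (M + 1) * (cmod (f N) * cmod (f (N + 1)))" for N
  proof -
    have "\<bar>Im (cnj (f N) * f (N + 1))\<bar> \<le> cmod (f N) * cmod (f (N + 1))"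
      using abs_Im_le_cmod[of "cnj (f N) * f (N + 1)"] by (simp add: norm_mult)
    then show ?thesis
      using a_le[of N] a_pos[of N] M_pos unfolding abs_mult by (intro mult_mono) auto
  qed
  then show "\<forall>\<^sub>F N in sequentially.
      norm (a N * Im (cnj (f N) * f (N + 1))) \<le> (M + 1) * (cmod (f N) * cmod (f (N + 1)))"
    by simp
qed

text \<open>
  For a square summable solution the boundary term at infinity drops out.
\<close>

lemma square_summable_energy:
  assumes f: "solves z f" and s: "summable (\<lambda>n. (cmod (f n))\<^sup>2)"
  shows "Im z * (\<Sum>n. (cmod (f (n + Suc K)))\<^sup>2) = - a K * Im (cnj (f K) * f (K + 1))"
proof -
  let ?e = "\<lambda>n. (cmod (f n))\<^sup>2"
  have "(\<lambda>N. (\<Sum>n<N. ?e (n + Suc K))) \<longlonglongrightarrow> (\<Sum>n. ?e (n + Suc K))"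
    using summable_ignore_initial_segment[OF s] by (rule summable_LIMSEQ)
  then have 1: "(\<lambda>N. Im z * (\<Sum>n<N. ?e (n + Suc K))) \<longlonglongrightarrow> Im z * (\<Sum>n. ?e (n + Suc K))"
    by (intro tendsto_intros)
  have "Im z * (\<Sum>n<N. ?e (n + Suc K)) =
      a (N + K) * Im (cnj (f (N + K)) * f (N + K + 1)) - a K * Im (cnj (f K) * f (K + 1))" for N
  proof -
    have "(\<Sum>n=1..N+K. ?e n) = (\<Sum>n=1..K. ?e n) + (\<Sum>n<N. ?e (n + Suc K))"
      by (induction N) auto
    then show ?thesis
      using energy_identity[OF f, of K] energy_identity[OF f, of "N + K"]
      by (simp add: algebra_simps)
  qed
  moreover have "(\<lambda>N. a (N + K) * Im (cnj (f (N + K)) * f (N + K + 1)) - a K * Im (cnj (f K) * f (K + 1)))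
      \<longlonglongrightarrow> 0 - a K * Im (cnj (f K) * f (K + 1))"
    using LIMSEQ_ignore_initial_segment[OF square_summable_boundary_term[OF s], of K]
    by (intro tendsto_intros) (simp add: add.assoc)
  ultimately have 2: "(\<lambda>N. Im z * (\<Sum>n<N. ?e (n + Suc K))) \<longlonglongrightarrow> 0 - a K * Im (cnj (f K) * f (K + 1))"
    by simp
  show ?thesis using LIMSEQ_unique[OF 1 2] by simp
qed

section \<open>The Green function\<close>

lemma jacobi_op_eq_tau: "u 0 = 0 \<Longrightarrow> n \<ge> 1 \<Longrightarrow> jacobi_op a b u n = tau u n"
  by (auto simp: jacobi_op_def tau_def)

text \<open>
  A symmetric operator has no eigenvalues off the real axis. Here this shows that the inverse
  function in the definition of the resolvent is applied to an injective map.
\<close>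

lemma ell2_eigenvector_zero:
  assumes z: "Im z > 0" and v: "v \<in> ell2" and eig: "\<And>n. n \<ge> 1 \<Longrightarrow> jacobi_op a b v n = z * v n"
  shows "v n = 0"
proof -
  have v0: "v 0 = 0" and s: "summable (\<lambda>n. (cmod (v n))\<^sup>2)" using v by (auto simp: ell2_def)
  have "solves z v" using eig jacobi_op_eq_tau[of v, OF v0] by (simp add: solves_def)
  from square_summable_energy[OF this s, of 0] z v0
  have "(\<Sum>n. (cmod (v (n + 1)))\<^sup>2) = 0" by simp
  then have "(cmod (v (n + 1)))\<^sup>2 = 0" for n
    using suminf_eq_zero_iff[OF summable_ignore_initial_segment[OF s, of 1]] by simp
  then show ?thesis using v0 by (cases n) auto
qed

lemma jacobi_op_diff:
  "jacobi_op a b (\<lambda>n. u n - v n) n = jacobi_op a b u n - jacobi_op a b v n"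
  by (simp add: jacobi_op_def algebra_simps)

lemma resolvent_eqI:
  assumes z: "Im z > 0" and u: "u \<in> ell2" and eq: "(\<lambda>n. jacobi_op a b u n - z * u n) = v"
  shows "resolvent a b z v = u"
proof -
  have inj: "inj_on (\<lambda>u n. jacobi_op a b u n - z * u n) ell2"
  proof (rule inj_onI)
    fix u v assume uv: "u \<in> ell2" "v \<in> ell2"
      and eq: "(\<lambda>n. jacobi_op a b u n - z * u n) = (\<lambda>n. jacobi_op a b v n - z * v n)"
    have "u n - v n = 0" for n
    proof (rule ell2_eigenvector_zero[OF z ell2_diff[OF uv]])
      fix n
      show "jacobi_op a b (\<lambda>n. u n - v n) n = z * (u n - v n)"
        using fun_cong[OF eq, of n] by (simp add: jacobi_op_diff algebra_simps)
    qed
    then show "u = v" by auto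
  qed
  show ?thesis
    unfolding resolvent_def using inv_into_f_f[OF inj u] eq by simp
qed

text \<open>
  The square summable solution, cut off at site 0, solves \<open>(J - z) u = \<delta>\<^sub>1\<close> up to sign. This identifies
  its initial value with \<open>- m_plus(z)\<close>, so it is \<open>f_plus\<close>.
\<close>

lemma f_plus_square_summable:
  assumes z: "Im z > 0"
  shows "summable (\<lambda>n. (cmod (f_plus a b n z))\<^sup>2)"
proof -
  obtain c where s: "summable (\<lambda>n. (cmod (weyl z c n))\<^sup>2)"
    using square_summable_weyl_exists[OF z] .
  define u where "u n = (if n = 0 then 0 else - weyl z c n)" for n
  have "summable (\<lambda>n. (cmod (u n))\<^sup>2)"
    by (rule summable_comparison_test'[OF s, of 0]) (auto simp: u_def)
  then have u: "u \<in> ell2" by (simp add: ell2_def u_def)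
  have "solves z (weyl z c)" unfolding weyl_def by (rule solves_jacobi_sol)
  then have t: "tau (weyl z c) n = z * weyl z c n" if "n \<ge> 1" for n
    using that by (simp add: solves_def)
  have "jacobi_op a b u n - z * u n = delta 1 n" for n
  proof (cases "n = 0")
    case False
    have "jacobi_op a b u n - z * u n =
      - (tau (weyl z c) n - z * weyl z c n) + (if n = 1 then 1 else 0)"
      using False by (cases "n = 1") (auto simp: jacobi_op_def u_def tau_def weyl_def a_0 algebra_simps)
    then show ?thesis using t[of n] False by (simp add: delta_def)
  qed (simp add: jacobi_op_def u_def delta_def)
  then have "resolvent a b z (delta 1) = u" by (intro resolvent_eqI[OF z u]) auto
  then have "green a b 1 z = - c" by (simp add: green_def ell2_inner_delta u_def weyl_def)
  then have "f_plus a b n z = weyl z c n" for n by (simp add: f_plus_def weyl_def)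
  then show ?thesis using s by simp
qed

lemma wronskian_f_plus_f_minus:
  "of_real (a N) * (f_plus a b N z * f_minus a b (N + 1) z - f_plus a b (N + 1) z * f_minus a b N z) = 1"
  using wronskian_constant[OF solves_f_plus solves_f_minus, of N z] by simp

text \<open>
  The column \<open>n\<close> of the Green matrix.
\<close>

definition green_vector :: "nat \<Rightarrow> complex \<Rightarrow> nat \<Rightarrow> complex" where
  "green_vector n z k = - f_minus a b (min k n) z * f_plus a b (max k n) z"

lemma green_vector_ell2:
  assumes z: "Im z > 0"
  shows "green_vector n z \<in> ell2"
proof -
  have "summable (\<lambda>k. (cmod (f_minus a b n z))\<^sup>2 * (cmod (f_plus a b k z))\<^sup>2)"
    by (intro summable_mult f_plus_square_summable[OF z])
  moreover have "norm ((cmod (green_vector n z k))\<^sup>2) \<le>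
      (cmod (f_minus a b n z))\<^sup>2 * (cmod (f_plus a b k z))\<^sup>2" if "k \<ge> n" for k
    using that by (simp add: green_vector_def norm_mult power_mult_distrib min_def max_def)
  ultimately have "summable (\<lambda>k. (cmod (green_vector n z k))\<^sup>2)"
    by (rule summable_comparison_test')
  then show ?thesis by (simp add: ell2_def green_vector_def)
qed

lemma green_vector_equation:
  assumes n: "n \<ge> 1"
  shows "jacobi_op a b (green_vector n z) k - z * green_vector n z k = delta n k"
proof (cases "k = 0")
  case True
  then show ?thesis using n by (simp add: jacobi_op_def green_vector_def delta_def)
next
  case False
  let ?p = "\<lambda>k. f_plus a b k z" and ?m = "\<lambda>k. f_minus a b k z" and ?u = "green_vector n z"
  have k: "k \<ge> 1" using False by simp
  have u0: "?u 0 = 0" by (simp add: green_vector_def)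
  have tp: "tau ?p k = z * ?p k" and tm: "tau ?m k = z * ?m k"
    using solves_f_plus[of z] solves_f_minus[of z] k by (auto simp: solves_def)
  have "tau ?u k - z * ?u k = delta n k"
  proof (cases k n rule: linorder_cases)
    case less
    then have "tau ?u k - z * ?u k = - ?p n * (tau ?m k - z * ?m k)"
      by (simp add: tau_def green_vector_def min_def max_def algebra_simps)
    then show ?thesis using tm less by (simp add: delta_def)
  next
    case greater
    then have "min (k - 1) n = n" "max (k - 1) n = k - 1" "min k n = n" "max k n = k"
      "min (k + 1) n = n" "max (k + 1) n = k + 1" by auto
    then have "tau ?u k - z * ?u k = - ?m n * (tau ?p k - z * ?p k)"
      by (simp add: tau_def green_vector_def algebra_simps)
    then show ?thesis using tp greater by (simp add: delta_def)
  next
    case equal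
    have "min (n - 1) n = n - 1" "max (n - 1) n = n" "min n n = n" "max n n = n"
      "min (n + 1) n = n" "max (n + 1) n = n + 1" by auto
    then have "tau ?u k - z * ?u k = - ?p n * (tau ?m k - z * ?m k)
       + of_real (a n) * (?p n * ?m (n + 1) - ?p (n + 1) * ?m n)"
      using equal by (simp add: tau_def green_vector_def algebra_simps)
    then show ?thesis using tm equal wronskian_f_plus_f_minus[of n z] by (simp add: delta_def)
  qed
  then show ?thesis using jacobi_op_eq_tau[of ?u k, OF u0 k] by simp
qed

lemma green_eq:
  assumes z: "Im z > 0" and n: "n \<ge> 1"
  shows "green a b n z = - f_minus a b n z * f_plus a b n z"
proof -
  have "resolvent a b z (delta n) = green_vector n z"
    by (rule resolvent_eqI[OF z green_vector_ell2[OF z]]) (use green_vector_equation[OF n] in auto)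
  then show ?thesis by (simp add: green_def ell2_inner_delta green_vector_def)
qed

lemma f_plus_energy_bound:
  assumes z: "Im z > 0"
  shows "Im z * (cmod (f_plus a b (n + 1) z))\<^sup>2 \<le> - a n * Im (cnj (f_plus a b n z) * f_plus a b (n + 1) z)"
proof -
  note s = f_plus_square_summable[OF z]
  let ?h = "\<lambda>k. (cmod (f_plus a b (k + Suc n) z))\<^sup>2"
  have "?h 0 \<le> suminf ?h"
    using sum_le_suminf[OF summable_ignore_initial_segment[OF s, of "Suc n"], of "{0}"] by simp
  then have "Im z * ?h 0 \<le> Im z * suminf ?h" using z by simp
  then show ?thesis using square_summable_energy[OF solves_f_plus s, of n] by simp
qed

lemma f_plus_nonzero:
  assumes z: "Im z > 0"
  shows "f_plus a b n z \<noteq> 0"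
proof
  assume 0: "f_plus a b n z = 0"
  then have "Im z * (cmod (f_plus a b (n + 1) z))\<^sup>2 \<le> 0" using f_plus_energy_bound[OF z, of n] by simp
  then have "(cmod (f_plus a b (n + 1) z))\<^sup>2 \<le> 0" using z by (simp add: mult_le_0_iff)
  then have "f_plus a b (n + 1) z = 0" by simp
  then show False using 0 wronskian_f_plus_f_minus[of n z] by simp
qed

text \<open>
  The Herglotz property of \<open>m_plus\<close>.
\<close>

lemma f_plus_ratio_pos:
  assumes z: "Im z > 0"
  shows "Im (- f_plus a b (n + 1) z / f_plus a b n z) > 0"
proof -
  have nz: "f_plus a b n z \<noteq> 0" "f_plus a b (n + 1) z \<noteq> 0" using f_plus_nonzero[OF z] by auto
  then have "Im z * (cmod (f_plus a b (n + 1) z))\<^sup>2 > 0" using z by simp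
  then have "a n * Im (cnj (f_plus a b n z) * - f_plus a b (n + 1) z) > 0"
    using f_plus_energy_bound[OF z, of n] by (simp add: algebra_simps)
  then have "Im (cnj (f_plus a b n z) * - f_plus a b (n + 1) z) > 0"
    using a_pos[of n] by (simp only: zero_less_mult_iff) auto
  then show ?thesis using nz by (subst Im_divide_eq) auto
qed

lemma f_plus_ratio_bound:
  assumes z: "Im z > 0"
  shows "cmod (f_plus a b (n + 1) z / f_plus a b n z) \<le> a n / Im z"
proof -
  let ?p = "cmod (f_plus a b n z)" and ?q = "cmod (f_plus a b (n + 1) z)"
  have nz: "?p > 0" "?q > 0" using f_plus_nonzero[OF z] by auto
  have "\<bar>Im (cnj (f_plus a b n z) * f_plus a b (n + 1) z)\<bar> \<le> ?p * ?q"
    using abs_Im_le_cmod[of "cnj (f_plus a b n z) * f_plus a b (n + 1) z"] by (simp add: norm_mult)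
  then have "- Im (cnj (f_plus a b n z) * f_plus a b (n + 1) z) \<le> ?p * ?q" by linarith
  then have "a n * - Im (cnj (f_plus a b n z) * f_plus a b (n + 1) z) \<le> a n * (?p * ?q)"
    using a_pos[of n] by (intro mult_left_mono) auto
  then have "Im z * ?q\<^sup>2 \<le> a n * (?p * ?q)"
    using f_plus_energy_bound[OF z, of n] by (simp add: algebra_simps)
  then have "Im z * ?q \<le> a n * ?p" using nz by (simp add: power2_eq_square)
  then show ?thesis using nz z by (simp add: norm_divide field_simps)
qed

text \<open>
  The familiar formula \<open>G(n, n) = -1 / (a(n)\<^sup>2 (m_plus + m_minus))\<close>, from which both bounds on the
  Green function are read off.
\<close>

lemma green_as_reciprocal:
  assumes z: "Im z > 0" and n: "n \<ge> 1"
  shows "green a b n z * (of_real (a n) * (f_plus a b (n + 1) z / f_plus a b n z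
           - f_minus a b (n + 1) z / f_minus a b n z)) = 1"
proof -
  have "f_plus a b (n + 1) z / f_plus a b n z - f_minus a b (n + 1) z / f_minus a b n z
    = (f_plus a b (n + 1) z * f_minus a b n z - f_plus a b n z * f_minus a b (n + 1) z)
        / (f_plus a b n z * f_minus a b n z)"
    using f_plus_nonzero[OF z, of n] f_minus_nonzero[OF z n] by (simp add: diff_frac_eq)
  then show ?thesis
    using wronskian_f_plus_f_minus[of n z] f_plus_nonzero[OF z, of n] f_minus_nonzero[OF z n]
    unfolding green_eq[OF z n] by (simp add: algebra_simps)
qed

lemma f_minus_ratio_bound:
  assumes z: "Im z > 0" and n: "n \<ge> 1"
  shows "cmod (of_real (a n) * (f_minus a b (n + 1) z / f_minus a b n z)) \<le> cmod z + M + (M + 1)\<^sup>2 / Im z"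
proof -
  let ?m = "\<lambda>k. f_minus a b k z"
  have nz: "?m n \<noteq> 0" using f_minus_nonzero[OF z n] .
  have "tau ?m n = z * ?m n" using solves_f_minus[of z] n by (simp add: solves_def)
  then have eq: "of_real (a n) * (?m (n + 1) / ?m n) = z - of_real (b n) - of_real (a (n - 1)) * (?m (n - 1) / ?m n)"
    using nz by (simp add: tau_def field_simps)
  have "cmod (?m (n - 1) / ?m n) \<le> (M + 1) / Im z"
  proof (cases "n = 1")
    case False
    then have n1: "n - 1 \<ge> 1" using n by simp
    let ?r = "?m n / ?m (n - 1)"
    have "Im z \<le> a (n - 1) * Im ?r" using f_minus_ratio_Im[OF z n1] n by simp
    also have "\<dots> \<le> (M + 1) * cmod ?r"
      using a_le[of "n - 1"] a_pos[of "n - 1"] M_pos abs_Im_le_cmod[of ?r]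
        f_minus_ratio_pos[OF z n1] n by (intro mult_mono) auto
    finally have "Im z \<le> (M + 1) * cmod ?r" .
    then show ?thesis
      using z nz f_minus_nonzero[OF z n1] by (simp add: norm_divide field_simps)
  qed (use z M_pos in simp)
  then have "cmod (of_real (a (n - 1)) * (?m (n - 1) / ?m n)) \<le> (M + 1) * ((M + 1) / Im z)"
    unfolding norm_mult using a_le[of "n - 1"] a_pos[of "n - 1"] M_pos by (intro mult_mono) auto
  moreover have "cmod (z - of_real (b n)) \<le> cmod z + M"
    using norm_triangle_ineq4[of z "of_real (b n)"] b_bound[OF n] by simp
  ultimately show ?thesis
    unfolding eq using norm_triangle_ineq4[of "z - of_real (b n)" "of_real (a (n - 1)) * (?m (n - 1) / ?m n)"]
    by (simp add: power2_eq_square)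
qed

text \<open>
  Bounds that are uniform in \<open>n\<close>, from the bounds on \<open>m_plus\<close> and \<open>m_minus\<close>.
\<close>

lemma green_bounds:
  assumes z: "Im z > 0" and n: "n \<ge> 1"
  shows green_Im_pos: "Im (green a b n z) > 0"
    and green_upper: "cmod (green a b n z) \<le> 1 / Im z"
    and green_lower: "cmod (green a b n z) \<ge> 1 / (cmod z + M + 2 * (M + 1)\<^sup>2 / Im z)"
proof -
  define q where "q = of_real (a n) * (- f_plus a b (n + 1) z / f_plus a b n z)"
  define r where "r = of_real (a n) * (f_minus a b (n + 1) z / f_minus a b n z)"
  let ?G = "green a b n z"
  have eq: "?G * (q + r) = -1"
    using green_as_reciprocal[OF z n] by (simp add: q_def r_def algebra_simps)
  have q: "Im q > 0"
    unfolding q_def Im_mult_real_left using f_plus_ratio_pos[OF z, of n] a_pos[of n]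
    by (intro mult_pos_pos)
  have r: "Im r \<ge> Im z" unfolding r_def Im_mult_real_left by (rule f_minus_ratio_Im[OF z n])
  have nz: "q + r \<noteq> 0" using eq by auto
  have G: "?G = - 1 / (q + r)" using eq nz by (metis nonzero_mult_div_cancel_right)
  have Im: "Im (q + r) \<ge> Im z" using q r by simp
  have "Im ?G = Im (q + r) / (cmod (q + r))\<^sup>2"
    unfolding G using nz by (subst Im_divide_eq) auto
  then show "Im ?G > 0" using Im z nz by (auto intro!: divide_pos_pos)
  have "cmod (q + r) \<ge> Im z" using Im abs_Im_le_cmod[of "q + r"] by linarith
  then show "cmod ?G \<le> 1 / Im z" unfolding G using z by (simp add: norm_divide frac_le)
  have "cmod q \<le> (M + 1)\<^sup>2 / Im z"
  proof -
    have "cmod q \<le> a n * (a n / Im z)"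
      unfolding q_def norm_mult using f_plus_ratio_bound[OF z, of n] a_pos[of n]
      by (intro mult_mono) (auto simp: norm_divide)
    also have "\<dots> = (a n)\<^sup>2 / Im z" by (simp add: power2_eq_square)
    also have "\<dots> \<le> (M + 1)\<^sup>2 / Im z"
      using a_le[of n] a_pos[of n] z by (intro divide_right_mono power_mono) auto
    finally show ?thesis .
  qed
  then have "cmod (q + r) \<le> cmod z + M + 2 * (M + 1)\<^sup>2 / Im z"
    using f_minus_ratio_bound[OF z n] norm_triangle_ineq[of q r] unfolding r_def by simp
  then show "cmod ?G \<ge> 1 / (cmod z + M + 2 * (M + 1)\<^sup>2 / Im z)"
    unfolding G using nz by (simp add: norm_divide frac_le)
qed

lemma a_m_minus: "of_real (a n) * m_minus a b n z = f_minus a b (n + 1) z / f_minus a b n z"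
  by (simp add: m_minus_def)

lemma a_m_plus: "of_real (a n) * m_plus a b n z = - f_plus a b (n + 1) z / f_plus a b n z"
  by (simp add: m_plus_def)

text \<open>
  Since \<open>a\<^sup>2 m_plus m_minus = - G(n + 1) / G(n)\<close>, the sum over \<open>n\<close> telescopes. The branches fit exactly,
  because \<open>G(n)\<close> also lies in the upper half-plane.
\<close>

lemma w_avg_sum:
  assumes z: "Im z > 0" and N: "N \<ge> 1"
  shows "w_plus_avg a b N z + w_minus_avg a b N z =
    \<i> * of_real pi + (Ln (green a b (N + 1) z) - Ln (green a b 1 z)) / of_nat N"
proof -
  have step: "Ln (of_real (a n) * m_plus a b n z) + Ln (of_real (a n) * m_minus a b n z) =
    \<i> * of_real pi + (Ln (green a b (n + 1) z) - Ln (green a b n z))" if n: "n \<ge> 1" for n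
  proof -
    have "(- f_plus a b (n + 1) z / f_plus a b n z) * (f_minus a b (n + 1) z / f_minus a b n z) * green a b n z
       = - green a b (n + 1) z"
      using f_plus_nonzero[OF z, of n] f_minus_nonzero[OF z n] green_eq[OF z, of n] green_eq[OF z, of "n + 1"] n
      by simp
    then show ?thesis
      unfolding a_m_minus a_m_plus
      using Ln_add_eq_of_mult_eq[OF f_plus_ratio_pos[OF z, of n] f_minus_ratio_pos[OF z n]
          green_Im_pos[OF z n] green_Im_pos[OF z, of "n + 1"]] by simp
  qed
  have "w_plus_avg a b N z + w_minus_avg a b N z =
     (1 / of_nat N) * (\<Sum>n=1..N. Ln (of_real (a n) * m_plus a b n z) + Ln (of_real (a n) * m_minus a b n z))"
    by (simp add: w_plus_avg_def w_minus_avg_def sum.distrib distrib_left)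
  also have "(\<Sum>n=1..N. Ln (of_real (a n) * m_plus a b n z) + Ln (of_real (a n) * m_minus a b n z))
     = (\<Sum>n=1..N. \<i> * of_real pi + (Ln (green a b (n + 1) z) - Ln (green a b n z)))"
    by (intro sum.cong refl step) simp
  also have "\<dots> = of_nat N * (\<i> * of_real pi) + (Ln (green a b (N + 1) z) - Ln (green a b 1 z))"
    using sum_Suc_diff[of 1 N "\<lambda>n. Ln (green a b n z)"] N by (simp add: sum.distrib)
  finally show ?thesis using N by (simp add: field_simps)
qed

lemma Ln_green_bound:
  assumes z: "Im z > 0"
  obtains B where "\<And>n. n \<ge> 1 \<Longrightarrow> cmod (Ln (green a b n z)) \<le> B"
proof -
  let ?L = "1 / (cmod z + M + 2 * (M + 1)\<^sup>2 / Im z)"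
  have Lp: "?L > 0" using z M_pos by (intro divide_pos_pos add_nonneg_pos add_pos_pos) auto
  have "cmod (Ln (green a b n z)) \<le> (\<bar>ln ?L\<bar> + \<bar>ln (1 / Im z)\<bar>) + pi" if n: "n \<ge> 1" for n
  proof -
    have nz: "green a b n z \<noteq> 0" using green_Im_pos[OF z n] by auto
    have "ln ?L \<le> ln (cmod (green a b n z))"
      using green_lower[OF z n] Lp nz by (subst ln_le_cancel_iff) auto
    moreover have "ln (cmod (green a b n z)) \<le> ln (1 / Im z)"
      using green_upper[OF z n] nz z by (subst ln_le_cancel_iff) auto
    ultimately have "\<bar>Re (Ln (green a b n z))\<bar> \<le> \<bar>ln ?L\<bar> + \<bar>ln (1 / Im z)\<bar>"
      using nz by simp
    moreover have "\<bar>Im (Ln (green a b n z))\<bar> \<le> pi" using mpi_less_Im_Ln[OF nz] Im_Ln_le_pi[OF nz] by linarith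
    ultimately show ?thesis using cmod_le[of "Ln (green a b n z)"] by linarith
  qed
  then show ?thesis by (rule that)
qed

section \<open>The trace of the Green matrix and the characteristic polynomial\<close>

text \<open>
  The orthonormal polynomials of \<open>J\<close>, with the index shifted by one to match \<open>f_minus\<close>.
\<close>

fun opoly :: "nat \<Rightarrow> complex poly" where
  "opoly 0 = 0"
| "opoly (Suc 0) = 1"
| "opoly (Suc (Suc n)) = smult (1 / of_real (a (Suc n)))
     ([:- of_real (b (Suc n)), 1:] * opoly (Suc n) - smult (of_real (a n)) (opoly n))"

lemma poly_opoly: "poly (opoly n) z = f_minus a b n z"
  by (induction n rule: opoly.induct) (simp_all add: f_minus_def field_simps)

lemma degree_opoly: "degree (opoly (Suc n)) = n \<and> lead_coeff (opoly (Suc n)) = 1 / of_real (\<Prod>k=1..n. a k)"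
proof (induction n rule: nat_less_induct)
  case (1 n)
  consider "n = 0" | "n = 1" | m where "n = Suc (Suc m)"
    by (metis One_nat_def not0_implies_Suc)
  then show ?case
  proof cases
    case (3 m)
    let ?p = "[:- of_real (b (Suc n)), 1:] * opoly (Suc n)"
    have IH: "degree (opoly (Suc (Suc m))) = Suc m"
      "lead_coeff (opoly (Suc (Suc m))) = 1 / of_real (\<Prod>k=1..Suc m. a k)"
      "degree (opoly (Suc m)) = m"
      using 1 3 by auto
    let ?x = "[:- complex_of_real (b (Suc (Suc m))), 1:]" and ?q = "opoly (Suc (Suc m))"
    have q0: "?q \<noteq> 0" using IH(1) by auto
    have d1: "degree (?x * ?q) = Suc (Suc m)"
      using q0 IH(1) by (subst degree_mult_eq) auto
    have d2: "degree (smult (of_real (a (Suc m))) (opoly (Suc m))) \<le> m"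
      using IH(3) by simp
    have d: "degree (?x * ?q - smult (of_real (a (Suc m))) (opoly (Suc m))) = Suc (Suc m)"
      unfolding diff_conv_add_uminus using d1 d2 by (subst degree_add_eq_left) auto
    have "coeff (?x * ?q - smult (of_real (a (Suc m))) (opoly (Suc m))) (Suc (Suc m)) = coeff (?x * ?q) (Suc (Suc m))"
      using d2 by (simp add: coeff_eq_0)
    also have "\<dots> = lead_coeff (?x * ?q)" using d1 by simp
    also have "\<dots> = 1 / of_real (\<Prod>k=1..Suc m. a k)" unfolding lead_coeff_mult IH(2) by simp
    finally have l: "coeff (?x * ?q - smult (of_real (a (Suc m))) (opoly (Suc m))) (Suc (Suc m))
      = 1 / of_real (\<Prod>k=1..Suc m. a k)" .
    define R where "R = ?x * ?q - smult (of_real (a (Suc m))) (opoly (Suc m))"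
    have step: "opoly (Suc n) = smult (1 / of_real (a (Suc (Suc m)))) R"
      unfolding 3 R_def by (rule opoly.simps(3))
    show ?thesis using d l unfolding step R_def[symmetric] by (simp add: 3)
  qed auto
qed

text \<open>
  The derivative of \<open>f_minus\<close> in the spectral parameter.
\<close>

definition df_minus :: "nat \<Rightarrow> complex \<Rightarrow> complex" where
  "df_minus n z = poly (pderiv (opoly n)) z"

lemma df_minus_0 [simp]: "df_minus 0 z = 0" and df_minus_1 [simp]: "df_minus (Suc 0) z = 0"
  by (simp_all add: df_minus_def)

lemma f_minus_has_derivative: "(f_minus a b n has_field_derivative df_minus n z) (at z)"
  using poly_DERIV[of "opoly n" z] by (simp add: poly_opoly[abs_def] df_minus_def)

lemma tau_df_minus:
  assumes "n \<ge> 1"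
  shows "tau (\<lambda>k. df_minus k z) n = z * df_minus n z + f_minus a b n z"
proof -
  obtain m where n: "n = Suc m" using assms by (cases n) auto
  have "((\<lambda>z. tau (\<lambda>k. f_minus a b k z) n) has_field_derivative tau (\<lambda>k. df_minus k z) n) (at z)"
    unfolding tau_def by (auto intro!: derivative_eq_intros f_minus_has_derivative)
  moreover have "tau (\<lambda>k. f_minus a b k z) n = z * f_minus a b n z" for z
    using solves_f_minus[of z] assms by (simp add: solves_def)
  moreover have "((\<lambda>z. z * f_minus a b n z) has_field_derivative z * df_minus n z + f_minus a b n z) (at z)"
    by (auto intro!: derivative_eq_intros f_minus_has_derivative)
  ultimately show ?thesis using DERIV_unique by simp
qed

text \<open>
  Green's formula for \<open>f\<close> and the derivative of \<open>f_minus\<close>. The case \<open>f = f_minus\<close> is the classical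
  formula; the case \<open>f = f_plus\<close> sums the diagonal of the Green matrix.
\<close>

lemma christoffel_darboux:
  assumes "solves z f"
  shows "(\<Sum>n=1..N. f n * f_minus a b n z)
    = of_real (a N) * (f N * df_minus (N + 1) z - f (N + 1) * df_minus N z)"
proof -
  let ?D = "\<lambda>k. df_minus k z"
  have "(\<Sum>n=1..N. f n * f_minus a b n z) = (\<Sum>n=1..N. f n * tau ?D n - tau f n * ?D n)"
    using assms by (intro sum.cong) (auto simp: tau_df_minus solves_def algebra_simps)
  then show ?thesis using green_formula[of f ?D N] by simp
qed

text \<open>
  The Christoffel--Darboux sum is at most the energy sum, and the latter is controlled by the same
  boundary term by which the former is divided.
\<close>

lemma log_derivative_ratio_bound:
  assumes z: "Im z > 0" and N: "N \<ge> 1"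
  shows "cmod (df_minus (N + 1) z / f_minus a b (N + 1) z - df_minus N z / f_minus a b N z) \<le> 1 / Im z"
proof -
  let ?m = "\<lambda>k. f_minus a b k z"
  let ?q = "df_minus (N + 1) z / ?m (N + 1) - df_minus N z / ?m N"
  have nz: "?m N \<noteq> 0" "?m (N + 1) \<noteq> 0" using f_minus_nonzero[OF z] N by auto
  let ?P = "a N * (cmod (?m N) * cmod (?m (N + 1)))"
  have P: "?P > 0" using nz a_pos[of N] by simp
  have "?P * cmod ?q = cmod (of_real (a N) * (?m N * ?m (N + 1)) * ?q)"
    using a_pos[of N] by (simp add: norm_mult)
  also have "of_real (a N) * (?m N * ?m (N + 1)) * ?q = (\<Sum>n=1..N. ?m n * ?m n)"
  proof -
    have "(?m N * ?m (N + 1)) * ?q = ?m N * df_minus (N + 1) z - ?m (N + 1) * df_minus N z"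
      using nz by (simp add: field_simps)
    then show ?thesis unfolding christoffel_darboux[OF solves_f_minus] by (simp only: mult.assoc)
  qed
  also have "cmod \<dots> \<le> (\<Sum>n=1..N. (cmod (?m n))\<^sup>2)"
    by (rule sum_norm_le) (simp add: norm_mult power2_eq_square)
  also have "\<dots> \<le> ?P / Im z"
  proof -
    have "\<bar>Im (cnj (?m N) * ?m (N + 1))\<bar> \<le> cmod (?m N) * cmod (?m (N + 1))"
      using abs_Im_le_cmod[of "cnj (?m N) * ?m (N + 1)"] by (simp add: norm_mult)
    then have "a N * Im (cnj (?m N) * ?m (N + 1)) \<le> ?P"
      using a_pos[of N] by (intro mult_left_mono) auto
    then have "Im z * (\<Sum>n=1..N. (cmod (?m n))\<^sup>2) \<le> ?P"
      unfolding f_minus_energy .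
    then show ?thesis using z by (simp add: pos_le_divide_eq mult.commute)
  qed
  finally have "?P * cmod ?q \<le> ?P * (1 / Im z)" by simp
  then show ?thesis using P by (simp only: mult_le_cancel_left_pos)
qed

text \<open>
  The trace of the resolvent over the first \<open>N\<close> sites differs from the trace of the resolvent of the
  truncation by a bounded amount. The latter trace is minus the logarithmic derivative of the
  characteristic polynomial \<open>f_minus (N + 1)\<close>.
\<close>

lemma green_sum_log_derivative:
  assumes z: "Im z > 0" and N: "N \<ge> 1"
  shows "cmod ((\<Sum>n=1..N. green a b n z) + df_minus (N + 1) z / f_minus a b (N + 1) z)
    \<le> (M + 1)\<^sup>2 / (Im z) ^ 3"
proof -
  let ?m = "\<lambda>k. f_minus a b k z" and ?p = "\<lambda>k. f_plus a b k z"
  let ?L = "\<lambda>k. df_minus k z / ?m k"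
  have nz: "?m N \<noteq> 0" "?m (N + 1) \<noteq> 0" "?p N \<noteq> 0" using f_minus_nonzero[OF z] f_plus_nonzero[OF z] N by auto
  have "(\<Sum>n=1..N. green a b n z) = - (\<Sum>n=1..N. ?p n * ?m n)"
    unfolding sum_negf[symmetric] by (intro sum.cong) (auto simp: green_eq[OF z])
  also have "(\<Sum>n=1..N. ?p n * ?m n) = of_real (a N) * (?p N * df_minus (N + 1) z - ?p (N + 1) * df_minus N z)"
    by (rule christoffel_darboux[OF solves_f_plus])
  \<comment> \<open>Split off the Wronskian, which equals 1; the rest contains only the increment of \<open>?L\<close>.\<close>
  also have "\<dots> = of_real (a N) * (?p N * ?m (N + 1) - ?p (N + 1) * ?m N) * ?L (N + 1)
      + of_real (a N) * (?p (N + 1) * ?m N) * (?L (N + 1) - ?L N)"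
    using nz by (simp add: field_simps)
  also have "of_real (a N) * (?p N * ?m (N + 1) - ?p (N + 1) * ?m N) = 1"
    by (rule wronskian_f_plus_f_minus)
  finally have "(\<Sum>n=1..N. green a b n z) + ?L (N + 1)
     = - (of_real (a N) * (?p (N + 1) * ?m N) * (?L (N + 1) - ?L N))" by simp
  also have "of_real (a N) * (?p (N + 1) * ?m N) = - (of_real (a N) * (?p (N + 1) / ?p N)) * green a b N z"
    using nz green_eq[OF z N] by simp
  finally have "cmod ((\<Sum>n=1..N. green a b n z) + ?L (N + 1)) =
     (a N * cmod (?p (N + 1) / ?p N)) * cmod (green a b N z) * cmod (?L (N + 1) - ?L N)"
    using a_pos[of N] by (simp only: norm_mult norm_minus_cancel norm_of_real abs_of_pos)
  also have "\<dots> \<le> (a N * (a N / Im z)) * (1 / Im z) * (1 / Im z)"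
    using a_pos[of N] z green_upper[OF z N] f_plus_ratio_bound[OF z, of N] log_derivative_ratio_bound[OF z N]
    by (intro mult_mono mult_nonneg_nonneg) auto
  also have "\<dots> = (a N)\<^sup>2 / (Im z) ^ 3" by (simp add: power2_eq_square power3_eq_cube)
  also have "\<dots> \<le> (M + 1)\<^sup>2 / (Im z) ^ 3"
    using a_le[of N] a_pos[of N] z by (intro divide_right_mono power_mono) auto
  finally show ?thesis .
qed

text \<open>
  Differentiating the logarithms turns the average into a telescoping sum.
\<close>

lemma w_minus_avg_derivative:
  assumes z: "Im z > 0"
  shows "(w_minus_avg a b N has_field_derivative
    (df_minus (N + 1) z / f_minus a b (N + 1) z) / of_nat N) (at z)"
proof -
  let ?m = "\<lambda>k. f_minus a b k z" and ?D = "\<lambda>k. df_minus k z"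
  have step: "((\<lambda>z. Ln (f_minus a b (n + 1) z / f_minus a b n z)) has_field_derivative
      ?D (n + 1) / ?m (n + 1) - ?D n / ?m n) (at z)" if n: "n \<in> {1..N}" for n
  proof -
    have nz: "?m n \<noteq> 0" "?m (n + 1) \<noteq> 0" using f_minus_nonzero[OF z] n by auto
    have "((\<lambda>z. f_minus a b (n + 1) z / f_minus a b n z) has_field_derivative
       (?D (n + 1) * ?m n - ?m (n + 1) * ?D n) / (?m n * ?m n)) (at z)"
      by (rule DERIV_divide[OF f_minus_has_derivative f_minus_has_derivative nz(1)])
    moreover have "?m (n + 1) / ?m n \<notin> \<real>\<^sub>\<le>\<^sub>0"
      using f_minus_ratio_pos[OF z, of n] n by (auto simp: complex_nonpos_Reals_iff)
    ultimately have "((\<lambda>z. Ln (f_minus a b (n + 1) z / f_minus a b n z)) has_field_derivative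
       inverse (?m (n + 1) / ?m n) * ((?D (n + 1) * ?m n - ?m (n + 1) * ?D n) / (?m n * ?m n))) (at z)"
      by (intro DERIV_chain2[OF has_field_derivative_Ln])
    moreover have "inverse (?m (n + 1) / ?m n) * ((?D (n + 1) * ?m n - ?m (n + 1) * ?D n) / (?m n * ?m n))
       = ?D (n + 1) / ?m (n + 1) - ?D n / ?m n"
      using nz by (simp add: field_simps)
    ultimately show ?thesis by simp
  qed
  have tel: "(\<Sum>n=1..N. ?D (n + 1) / ?m (n + 1) - ?D n / ?m n) = ?D (N + 1) / ?m (N + 1)"
    by (induction N) auto
  have "((\<lambda>z. (1 / of_nat N) * (\<Sum>n=1..N. Ln (f_minus a b (n + 1) z / f_minus a b n z))) has_field_derivative
    (1 / of_nat N) * (\<Sum>n=1..N. ?D (n + 1) / ?m (n + 1) - ?D n / ?m n)) (at z)"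
    by (intro DERIV_cmult DERIV_sum step)
  then show ?thesis
    unfolding w_minus_avg_def[abs_def] a_m_minus tel by (simp add: mult.commute)
qed

section \<open>Eigenvalues of the truncations\<close>

lemma truncation_eigenvalues_iff:
  "x \<in> truncation_eigenvalues a b N \<longleftrightarrow> (\<exists>u. u 0 = 0 \<and> u (N + 1) = 0 \<and> (\<exists>n\<in>{1..N}. u n \<noteq> 0)
     \<and> (\<forall>n\<in>{1..N}. tau u n = of_real x * u n))"
  by (simp add: truncation_eigenvalues_def tau_def)

text \<open>
  An eigenvector of the truncation is a multiple of \<open>f_minus\<close>, because the difference equation determines
  it from its first entry.
\<close>

lemma eigenvalue_iff: "x \<in> truncation_eigenvalues a b N \<longleftrightarrow> f_minus a b (N + 1) (of_real x) = 0 \<and> N \<ge> 1"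
proof
  assume "x \<in> truncation_eigenvalues a b N"
  then obtain u :: "nat \<Rightarrow> complex" where u: "u 0 = 0" "u (N + 1) = 0" and nz: "\<exists>n\<in>{1..N}. u n \<noteq> 0"
    and eq: "\<And>n. n \<in> {1..N} \<Longrightarrow> tau u n = of_real x * u n"
    unfolding truncation_eigenvalues_iff by blast
  have *: "u n = u 1 * f_minus a b n (of_real x) \<and> u (Suc n) = u 1 * f_minus a b (Suc n) (of_real x)"
    if "n \<le> N" for n
    using that
  proof (induction n)
    case (Suc n)
    then have IH: "u n = u 1 * f_minus a b n (of_real x)" "u (Suc n) = u 1 * f_minus a b (Suc n) (of_real x)"
      by auto
    let ?m = "\<lambda>n. f_minus a b n (of_real x)"
    have "tau u (Suc n) = of_real x * u (Suc n)" using eq Suc.prems by simp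
    moreover have "tau ?m (Suc n) = of_real x * ?m (Suc n)"
      using solves_f_minus[of "of_real x"] by (simp add: solves_def)
    then have "tau (\<lambda>n. u 1 * ?m n) (Suc n) = of_real x * (u 1 * ?m (Suc n))"
      by (simp add: tau_def algebra_simps) (metis distrib_left mult.left_commute)
    ultimately have "of_real (a (Suc n)) * u (Suc (Suc n)) = of_real (a (Suc n)) * (u 1 * ?m (Suc (Suc n)))"
      using IH unfolding tau_def
      by (simp only: diff_Suc_1 Suc_eq_plus1[symmetric] add_right_cancel[symmetric]) (metis add_right_cancel)
    then show ?case using IH(2) by simp
  qed (use u in simp)
  from nz obtain n where n: "n \<in> {1..N}" "u n \<noteq> 0" by auto
  then have "u 1 \<noteq> 0" using *[of n] by auto
  then show "f_minus a b (N + 1) (of_real x) = 0 \<and> N \<ge> 1" using u *[of N] n by simp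
next
  assume *: "f_minus a b (N + 1) (of_real x) = 0 \<and> N \<ge> 1"
  have "\<forall>n\<in>{1..N}. tau (\<lambda>n. f_minus a b n (of_real x)) n = of_real x * f_minus a b n (of_real x)"
    using solves_f_minus[of "of_real x"] by (simp add: solves_def)
  moreover have "\<exists>n\<in>{1..N}. f_minus a b n (of_real x) \<noteq> 0" using * by (intro bexI[of _ 1]) auto
  ultimately show "x \<in> truncation_eigenvalues a b N"
    using * unfolding truncation_eigenvalues_iff
    by (intro exI[of _ "\<lambda>n. f_minus a b n (of_real x)"]) auto
qed

lemma eigenvalue_bound:
  assumes "x \<in> truncation_eigenvalues a b N"
  shows "\<bar>x\<bar> \<le> 3 * M + 2"
proof -
  obtain u :: "nat \<Rightarrow> complex" where u: "u 0 = 0" "u (N + 1) = 0" and nz: "\<exists>n\<in>{1..N}. u n \<noteq> 0"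
    and eq: "\<And>n. n \<in> {1..N} \<Longrightarrow> tau u n = of_real x * u n"
    using assms unfolding truncation_eigenvalues_iff by blast
  \<comment> \<open>Evaluate the eigenvalue equation at a site where the eigenvector is largest in modulus.\<close>
  let ?m = "Max ((\<lambda>n. cmod (u n)) ` {1..N})"
  have ne: "{1..N} \<noteq> {}" using nz by auto
  have "?m \<in> (\<lambda>n. cmod (u n)) ` {1..N}"
    using ne by (intro Max_in) auto
  then obtain n where n: "n \<in> {1..N}" "?m = cmod (u n)" by blast
  have le: "cmod (u k) \<le> cmod (u n)" if "k \<le> N + 1" for k
  proof (cases "k \<in> {1..N}")
    case True
    then show ?thesis using n(2) by (metis Max_ge finite_atLeastAtMost finite_imageI imageI)
  next
    case False
    then have "k = 0 \<or> k = N + 1" using that by auto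
    then show ?thesis using u by auto
  qed
  have pos: "cmod (u n) > 0" using nz le by (auto simp: not_less)
  have "\<bar>x\<bar> * cmod (u n) = cmod (tau u n)" using eq[OF n(1)] by (simp add: norm_mult)
  also have "\<dots> \<le> a n * cmod (u (n + 1)) + a (n - 1) * cmod (u (n - 1)) + \<bar>b n\<bar> * cmod (u n)"
    unfolding tau_def using a_pos[of n] a_pos[of "n - 1"]
    by (intro order_trans[OF norm_triangle_ineq] add_mono) (auto simp: norm_mult)
  also have "\<dots> \<le> (M + 1) * cmod (u n) + (M + 1) * cmod (u n) + M * cmod (u n)"
    using a_le[of n] a_le[of "n - 1"] a_pos[of n] a_pos[of "n - 1"] b_bound[of n] M_pos n(1) le
    by (intro add_mono mult_mono) auto
  also have "\<dots> = (3 * M + 2) * cmod (u n)" by (simp add: algebra_simps)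
  finally show ?thesis using pos by simp
qed

lemma f_minus_cnj: "f_minus a b n (cnj z) = cnj (f_minus a b n z)"
proof -
  have "solves (cnj z) (\<lambda>n. cnj (f_minus a b n z))" by (rule solves_cnj[OF solves_f_minus])
  from solves_eq_jacobi_sol[OF this] show ?thesis by (simp add: f_minus_def fun_eq_iff)
qed

lemma opoly_root_real:
  assumes N: "N \<ge> 1" and root: "f_minus a b (N + 1) z = 0"
  shows "z = of_real (Re z)"
proof -
  have "\<not> Im z > 0" using f_minus_nonzero[of z "N + 1"] root by auto
  moreover have "\<not> Im (cnj z) > 0" using f_minus_nonzero[of "cnj z" "N + 1"] root by (auto simp: f_minus_cnj)
  ultimately show ?thesis by (simp add: complex_eq_iff)
qed

lemma opoly_roots:
  assumes "N \<ge> 1"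
  shows "{z. poly (opoly (N + 1)) z = 0} = of_real ` truncation_eigenvalues a b N"
proof (intro equalityI subsetI)
  fix z assume "z \<in> {z. poly (opoly (N + 1)) z = 0}"
  then have r: "f_minus a b (N + 1) z = 0" by (simp only: poly_opoly mem_Collect_eq)
  then have "Re z \<in> truncation_eigenvalues a b N"
    using opoly_root_real[OF assms r] assms unfolding eigenvalue_iff by metis
  then show "z \<in> of_real ` truncation_eigenvalues a b N"
    using opoly_root_real[OF assms r] by blast
next
  fix z assume "z \<in> complex_of_real ` truncation_eigenvalues a b N"
  then show "z \<in> {z. poly (opoly (N + 1)) z = 0}"
    unfolding poly_opoly mem_Collect_eq by (auto simp only: eigenvalue_iff)
qed

lemma opoly_simple_roots:
  assumes N: "N \<ge> 1"
  shows "rsquarefree (opoly (N + 1))"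
proof -
  have "\<not> (poly (opoly (N + 1)) z = 0 \<and> poly (pderiv (opoly (N + 1))) z = 0)" for z
  proof
    assume *: "poly (opoly (N + 1)) z = 0 \<and> poly (pderiv (opoly (N + 1))) z = 0"
    then have r: "f_minus a b (N + 1) z = 0" "df_minus (N + 1) z = 0"
      by (auto simp: poly_opoly df_minus_def)
    define x where "x = Re z"
    have zx: "z = of_real x" using opoly_root_real[OF N r(1)] by (simp add: x_def)
    have real: "cnj (f_minus a b n z) = f_minus a b n z" for n
      using f_minus_cnj[of n z] zx by simp
    \<comment> \<open>At a double root the boundary terms in the Christoffel--Darboux formula vanish, but its left
      side is a sum of squares of real numbers that includes \<open>1\<close>.\<close>
    have "(\<Sum>n=1..N. f_minus a b n z * f_minus a b n z) = 0"
      using christoffel_darboux[OF solves_f_minus, of z N] r by simp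
    moreover have "f_minus a b n z * f_minus a b n z = of_real ((cmod (f_minus a b n z))\<^sup>2)" for n
      using complex_norm_square[of "f_minus a b n z"] real[of n] by simp
    ultimately have "complex_of_real (\<Sum>n=1..N. (cmod (f_minus a b n z))\<^sup>2) = 0" by simp
    then have "(\<Sum>n=1..N. (cmod (f_minus a b n z))\<^sup>2) = 0" by (simp only: of_real_eq_0_iff)
    moreover have "(cmod (f_minus a b 1 z))\<^sup>2 \<le> (\<Sum>n=1..N. (cmod (f_minus a b n z))\<^sup>2)"
      using N by (intro member_le_sum) auto
    ultimately show False by simp
  qed
  then show ?thesis by (simp add: rsquarefree_roots)
qed

lemma finite_eigenvalues: "finite (truncation_eigenvalues a b N)"
proof (cases "N \<ge> 1")
  case True
  have "opoly (N + 1) \<noteq> 0" using opoly_simple_roots[OF True] by (auto simp: rsquarefree_def)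
  then have "finite {z. poly (opoly (N + 1)) z = 0}" by (rule poly_roots_finite)
  then show ?thesis unfolding opoly_roots[OF True]
    by (rule finite_imageD) (auto simp: inj_on_def)
qed (auto simp: truncation_eigenvalues_def)

text \<open>
  All roots are real and simple, so the roots are the eigenvalues, each with multiplicity one.
\<close>

lemma f_minus_factorization:
  assumes N: "N \<ge> 1"
  shows "f_minus a b (N + 1) z = (\<Prod>x\<in>truncation_eigenvalues a b N. z - of_real x) / of_real (\<Prod>n=1..N. a n)"
    and card_eigenvalues: "card (truncation_eigenvalues a b N) = N"
proof -
  let ?S = "truncation_eigenvalues a b N"
  have inj: "inj_on complex_of_real ?S" by (auto simp: inj_on_def)
  have lc: "lead_coeff (opoly (N + 1)) = 1 / of_real (\<Prod>n=1..N. a n)"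
    by (rule degree_opoly[of N, THEN conjunct2, unfolded Suc_eq_plus1])
  have "(\<Prod>z | poly (opoly (N + 1)) z = 0. [:- z, 1:]) = (\<Prod>x\<in>?S. [:- complex_of_real x, 1:])"
    unfolding opoly_roots[OF N] prod.reindex[OF inj] by simp
  then have eq: "opoly (N + 1) = smult (1 / of_real (\<Prod>n=1..N. a n)) (\<Prod>x\<in>?S. [:- of_real x, 1:])"
    using complex_poly_decompose_rsquarefree[OF opoly_simple_roots[OF N]] unfolding lc by (simp only:)
  have "f_minus a b (N + 1) z = poly (opoly (N + 1)) z" by (simp only: poly_opoly)
  also have "\<dots> = (\<Prod>x\<in>?S. z - of_real x) / of_real (\<Prod>n=1..N. a n)"
    unfolding eq by (simp add: poly_prod)
  finally show "f_minus a b (N + 1) z = (\<Prod>x\<in>?S. z - of_real x) / of_real (\<Prod>n=1..N. a n)" .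
  have "(\<Prod>n=1..N. a n) \<noteq> 0" by simp
  then have "degree (opoly (N + 1)) = degree (\<Prod>x\<in>?S. [:- complex_of_real x, 1:])"
    unfolding eq by simp
  also have "\<dots> = card ?S" by (subst degree_prod_sum_eq) auto
  finally show "card ?S = N" using degree_opoly[of N] by simp
qed

lemma f_minus_ratio_asymptotics:
  assumes n: "n \<ge> 1"
  shows "((\<lambda>y. (f_minus a b (n + 1) (\<i> * of_real y) / f_minus a b n (\<i> * of_real y)) / (\<i> * of_real y))
           \<longlongrightarrow> of_real (1 / a n)) at_top"
proof -
  obtain m where m: "n = Suc m" using n by (cases n) auto
  have inf: "filterlim (\<lambda>y. \<i> * complex_of_real y) at_infinity at_top"
    unfolding filterlim_at_infinity_conv_norm_at_top
    by (simp add: norm_mult filterlim_at_top_imp_at_infinity filterlim_abs_real filterlim_ident)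
  have asym: "((\<lambda>z. f_minus a b (Suc k) z / z ^ k) \<longlongrightarrow> 1 / of_real (\<Prod>j=1..k. a j)) at_infinity" for k
    using poly_divide_tendsto_aux[of "opoly (Suc k)"] degree_opoly[of k]
    unfolding poly_opoly by metis
  have "((\<lambda>z. (f_minus a b (Suc n) z / z ^ n) / (f_minus a b (Suc m) z / z ^ m)) \<longlongrightarrow>
      (1 / of_real (\<Prod>j=1..n. a j)) / (1 / of_real (\<Prod>j=1..m. a j))) at_infinity"
    by (intro tendsto_divide asym) simp
  also have "(1 / of_real (\<Prod>j=1..n. a j)) / (1 / of_real (\<Prod>j=1..m. a j)) = complex_of_real (1 / a n)"
    by (simp add: m)
  also have "(\<lambda>z. (f_minus a b (Suc n) z / z ^ n) / (f_minus a b (Suc m) z / z ^ m))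
     = (\<lambda>z. (f_minus a b (n + 1) z / f_minus a b n z) / z)"
    by (auto simp: m fun_eq_iff divide_simps)
  finally show ?thesis using filterlim_compose[OF _ inf] by blast
qed

lemma log_derivative_f_minus:
  assumes z: "Im z > 0" and N: "N \<ge> 1"
  shows "df_minus (N + 1) z / f_minus a b (N + 1) z
    = (\<Sum>x\<in>truncation_eigenvalues a b N. 1 / (z - of_real x))"
proof -
  let ?S = "truncation_eigenvalues a b N" and ?A = "complex_of_real (\<Prod>n=1..N. a n)"
  have nz: "z - of_real x \<noteq> 0" for x using z by (auto simp: complex_eq_iff)
  have A: "?A \<noteq> 0" by simp
  have "((\<lambda>z. (\<Prod>x\<in>?S. z - of_real x) / ?A) has_field_derivative
      ((\<Prod>x\<in>?S. z - of_real x) * (\<Sum>x\<in>?S. 1 / (z - of_real x))) / ?A) (at z)"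
    using nz by (intro DERIV_cdivide has_field_derivative_prod') (auto intro!: derivative_eq_intros)
  then have "(f_minus a b (N + 1) has_field_derivative
      ((\<Prod>x\<in>?S. z - of_real x) * (\<Sum>x\<in>?S. 1 / (z - of_real x))) / ?A) (at z)"
    unfolding f_minus_factorization(1)[OF N, abs_def] .
  then have "df_minus (N + 1) z = ((\<Prod>x\<in>?S. z - of_real x) * (\<Sum>x\<in>?S. 1 / (z - of_real x))) / ?A"
    using DERIV_unique f_minus_has_derivative by blast
  also have "\<dots> = f_minus a b (N + 1) z * (\<Sum>x\<in>?S. 1 / (z - of_real x))"
    unfolding f_minus_factorization(1)[OF N] by simp
  finally show ?thesis using f_minus_nonzero[OF z, of "N + 1"] by simp
qed

text \<open>
  The product of the ratios \<open>f_minus (n + 1) / f_minus n\<close> is the polynomial \<open>f_minus (N + 1)\<close>, whose roots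
  are the eigenvalues. The formula holds for the principal branches, not just modulo \<open>2 pi i\<close>.
\<close>

lemma w_minus_avg_eq:
  assumes z: "Im z > 0" and N: "N \<ge> 1"
  shows "w_minus_avg a b N z = ((\<Sum>x\<in>truncation_eigenvalues a b N. Ln (z - of_real x))
     - of_real (ln (\<Prod>n=1..N. a n))) / of_nat N"
proof -
  let ?S = "truncation_eigenvalues a b N"
  \<comment> \<open>Both terms of \<open>?D\<close> are logarithms of a multiple of the same polynomial, so \<open>?D\<close> is constant;
    the constant, which settles the branches, is read off at \<open>z = i y\<close> as \<open>y\<close> tends to infinity.\<close>
  let ?D = "\<lambda>z. of_nat N * w_minus_avg a b N z - (\<Sum>x\<in>?S. Ln (z - of_real x))"
  have N0: "of_nat N \<noteq> (0 :: complex)" using N by simp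
  have "(?D has_field_derivative 0) (at z within {z. Im z > 0})" if z: "z \<in> {z. Im z > 0}" for z
  proof -
    have "(?D has_field_derivative of_nat N * (df_minus (N + 1) z / f_minus a b (N + 1) z / of_nat N)
       - (\<Sum>x\<in>?S. 1 / (z - of_real x))) (at z)"
      using z by (intro DERIV_diff DERIV_cmult w_minus_avg_derivative DERIV_sum)
        (auto intro!: derivative_eq_intros simp: complex_nonpos_Reals_iff field_simps)
    then show ?thesis
      using log_derivative_f_minus[of z N] z N N0 by (simp add: has_field_derivative_at_within)
  qed
  then obtain C where C: "\<And>z. Im z > 0 \<Longrightarrow> ?D z = C"
    using has_field_derivative_zero_constant[of "{z. Im z > 0}" ?D]
      convex_halfspace_Im_gt[of 0] by auto
  have "((\<lambda>y. ?D (\<i> * of_real y)) \<longlongrightarrow> (\<Sum>n=1..N. of_real (ln (1 / a n))) - (\<Sum>x\<in>?S. of_real (ln 1))) at_top"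
  proof -
    have "((\<lambda>y. (\<Sum>n=1..N. Ln (f_minus a b (n + 1) (\<i> * of_real y) / f_minus a b n (\<i> * of_real y)) - Ln (\<i> * of_real y))
        - (\<Sum>x\<in>?S. Ln (\<i> * of_real y - of_real x) - Ln (\<i> * of_real y)))
       \<longlongrightarrow> (\<Sum>n=1..N. of_real (ln (1 / a n))) - (\<Sum>x\<in>?S. of_real (ln 1))) at_top"
    proof (intro tendsto_diff tendsto_sum Ln_diff_tendsto)
      fix n assume n: "n \<in> {1..N}"
      show "((\<lambda>y. f_minus a b (n + 1) (\<i> * of_real y) / f_minus a b n (\<i> * of_real y) / (\<i> * of_real y))
         \<longlongrightarrow> of_real (1 / a n)) at_top"
        using n by (intro f_minus_ratio_asymptotics) simp
      show "0 < 1 / a n" using a_pos by simp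
      show "0 < Im (f_minus a b (n + 1) (\<i> * of_real y) / f_minus a b n (\<i> * of_real y))" if "y > 0" for y
        using n that by (intro f_minus_ratio_pos) auto
    next
      fix x :: real
      have "((\<lambda>y. 1 - (of_real x / \<i>) * of_real (1 / y)) \<longlongrightarrow> 1 - (of_real x / \<i>) * of_real 0) at_top"
        by (intro tendsto_intros tendsto_divide_0[OF tendsto_const]) (simp add: filterlim_at_top_imp_at_infinity filterlim_ident)
      moreover have "\<forall>\<^sub>F y in at_top. 1 - (of_real x / \<i>) * of_real (1 / y) = (\<i> * of_real y - of_real x) / (\<i> * of_real y)"
        using eventually_gt_at_top[of 0] by eventually_elim (simp add: field_simps)
      ultimately show "((\<lambda>y. (\<i> * of_real y - of_real x) / (\<i> * of_real y)) \<longlongrightarrow> of_real 1) at_top"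
        by (simp add: tendsto_cong)
      show "Im (\<i> * of_real y - of_real x) > 0" if "y > 0" for y using that by simp
    qed simp
    moreover have "(\<Sum>n=1..N. Ln (f_minus a b (n + 1) (\<i> * of_real y) / f_minus a b n (\<i> * of_real y)) - Ln (\<i> * of_real y))
        - (\<Sum>x\<in>?S. Ln (\<i> * of_real y - of_real x) - Ln (\<i> * of_real y)) = ?D (\<i> * of_real y)" for y
      unfolding w_minus_avg_def a_m_minus sum_subtractf using N0 card_eigenvalues[OF N] by simp
    \<comment> \<open>There are \<open>N\<close> ratios and \<open>N\<close> eigenvalues, so the divergent terms \<open>Ln (i y)\<close> cancel.\<close>
    ultimately show ?thesis by simp
  qed
  moreover have "((\<lambda>y. ?D (\<i> * of_real y)) \<longlongrightarrow> C) at_top"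
  proof (rule tendsto_eventually)
    show "\<forall>\<^sub>F y in at_top. ?D (\<i> * of_real y) = C"
      using eventually_gt_at_top[of 0] by eventually_elim (rule C, simp)
  qed
  ultimately have "C = (\<Sum>n=1..N. of_real (ln (1 / a n))) - (\<Sum>x\<in>?S. of_real (ln 1))"
    by (intro tendsto_unique[of at_top]) auto
  also have "\<dots> = - of_real (ln (\<Prod>n=1..N. a n))"
    using a_pos by (simp add: ln_prod ln_div sum_negf)
  finally have "?D z = - of_real (ln (\<Prod>n=1..N. a n))" using C[OF z] by simp
  then show ?thesis using N0 by (simp add: field_simps)
qed

section \<open>The averaged measures\<close>

lemma jacobi_op_ell2:
  assumes u: "u \<in> ell2"
  shows "jacobi_op a b u \<in> ell2"
proof -
  have s: "summable (\<lambda>n. (cmod (u n))\<^sup>2)" using u by (simp add: ell2_def)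
  have comp: "v \<in> ell2" if "v 0 = 0" "summable (\<lambda>n. (cmod (w n))\<^sup>2)"
    "\<And>n. cmod (v n) \<le> (M + 1) * cmod (w n)" for v w :: "nat \<Rightarrow> complex"
  proof -
    have "summable (\<lambda>n. (M + 1)\<^sup>2 * (cmod (w n))\<^sup>2)" using that(2) by (rule summable_mult)
    then have "summable (\<lambda>n. (cmod (v n))\<^sup>2)"
    proof (rule summable_comparison_test'[of _ 0])
      fix n
      have "(cmod (v n))\<^sup>2 \<le> ((M + 1) * cmod (w n))\<^sup>2" using that(3) by (intro power_mono) auto
      then show "norm ((cmod (v n))\<^sup>2) \<le> (M + 1)\<^sup>2 * (cmod (w n))\<^sup>2" by (simp add: power_mult_distrib)
    qed
    then show ?thesis using that(1) by (simp add: ell2_def)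
  qed
  define v1 v2 v3 where "v1 n = (if n = 0 then 0 else of_real (a n) * u (n + 1))"
    and "v2 n = (if n \<le> 1 then 0 else of_real (a (n - 1)) * u (n - 1))"
    and "v3 n = (if n = 0 then 0 else of_real (b n) * u n)" for n
  have 1: "v1 \<in> ell2"
  proof (rule comp)
    show "summable (\<lambda>n. (cmod (u (n + 1)))\<^sup>2)" using s by (rule summable_ignore_initial_segment)
    show "cmod (v1 n) \<le> (M + 1) * cmod (u (n + 1))" for n
      using a_le[of n] a_pos[of n] M_pos by (auto simp: v1_def norm_mult intro!: mult_right_mono)
  qed (simp add: v1_def)
  have 2: "v2 \<in> ell2"
  proof (rule comp)
    have "summable (\<lambda>n. (cmod (u (Suc n - 1)))\<^sup>2)" using s by simp
    then show "summable (\<lambda>n. (cmod (u (n - 1)))\<^sup>2)" by (rule summable_Suc_iff[THEN iffD1])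
    show "cmod (v2 n) \<le> (M + 1) * cmod (u (n - 1))" for n
      using a_le[of "n - 1"] a_pos[of "n - 1"] M_pos by (auto simp: v2_def norm_mult intro!: mult_right_mono)
  qed (simp add: v2_def)
  have 3: "v3 \<in> ell2"
  proof (rule comp)
    show "cmod (v3 n) \<le> (M + 1) * cmod (u n)" for n
    proof (cases "n = 0")
      case False
      then have "\<bar>b n\<bar> \<le> M + 1" using b_bound[of n] by simp
      then have "\<bar>b n\<bar> * cmod (u n) \<le> (M + 1) * cmod (u n)" by (rule mult_right_mono) simp
      then show ?thesis using False by (simp add: v3_def norm_mult)
    qed (use M_pos in \<open>simp add: v3_def\<close>)
  qed (use s in \<open>simp_all add: v3_def\<close>)
  have "jacobi_op a b u = (\<lambda>n. v1 n + v2 n + v3 n)"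
    by (auto simp: fun_eq_iff jacobi_op_def v1_def v2_def v3_def)
  then show ?thesis using 1 2 3 by (simp add: ell2_add)
qed

lemma jacobi_op_linear: "ell2_linear (jacobi_op a b)"
  unfolding ell2_linear_def using jacobi_op_ell2
  by (auto simp: jacobi_op_def fun_eq_iff algebra_simps)

lemma delta_ell2: "n \<ge> 1 \<Longrightarrow> delta n \<in> ell2"
  by (auto simp: ell2_def delta_def if_distrib[of cmod] if_distrib[of "\<lambda>x. x\<^sup>2"] intro!: summable_If_finite cong: if_cong)

text \<open>
  Since \<open>green_vector n z\<close> solves \<open>(J - z) v = \<delta>\<^sub>n\<close>, this is an instance of \<open>resolvent_form\<close>.
\<close>

lemma green_spectral:
  assumes E: "spectral_resolution (jacobi_op a b) E" and z: "Im z > 0" and n: "n \<ge> 1"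
  shows "green a b n z = (\<integral>s. of_real ((ell2_norm (E s (delta n)))\<^sup>2) / (of_real s - z)\<^sup>2 \<partial>lborel)"
    and "integrable lborel (\<lambda>s. complex_of_real ((ell2_norm (E s (delta n)))\<^sup>2) / (of_real s - z)\<^sup>2)"
proof -
  interpret spectral "jacobi_op a b" E by standard (fact jacobi_op_linear E)+
  have eq: "(\<lambda>k. jacobi_op a b (green_vector n z) k - z * green_vector n z k) = delta n"
    using green_vector_equation[OF n] by auto
  have "green a b n z = ell2_inner (delta n) (green_vector n z)"
    unfolding green_def using resolvent_eqI[OF z green_vector_ell2[OF z] eq] by simp
  also have "\<dots> = (\<integral>s. of_real (F (delta n) s) / (of_real s - z)\<^sup>2 \<partial>lborel)"
    by (rule resolvent_form[OF z delta_ell2[OF n] green_vector_ell2[OF z] eq])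
  finally show "green a b n z = (\<integral>s. of_real ((ell2_norm (E s (delta n)))\<^sup>2) / (of_real s - z)\<^sup>2 \<partial>lborel)"
    unfolding F_def .
  show "integrable lborel (\<lambda>s. complex_of_real ((ell2_norm (E s (delta n)))\<^sup>2) / (of_real s - z)\<^sup>2)"
    using K_integrable[OF z delta_ell2[OF n] delta_ell2[OF n]]
    unfolding ell2_inner_E_self[OF delta_ell2[OF n]] F_def .
qed

lemma nu_avg_stieltjes:
  assumes E: "spectral_resolution (jacobi_op a b) E"
  shows "finite_borel_measure (nu_avg E N)"
    and "Im z > 0 \<Longrightarrow> g_avg a b N z = (\<integral>t. 1 / (of_real t - z) \<partial>nu_avg E N)"
proof -
  interpret spectral "jacobi_op a b" E by standard (fact jacobi_op_linear E)+
  let ?F = "\<lambda>t. (1 / real N) * (\<Sum>n=1..N. F (delta n) t)"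
  have nu: "nu_avg E N = interval_measure ?F" by (simp add: nu_avg_def F_def)
  have mono: "?F s \<le> ?F t" if "s \<le> t" for s t
    using that by (intro mult_left_mono sum_mono F_mono delta_ell2) auto
  have rc: "continuous (at_right t) ?F" for t
    by (intro continuous_intros F_right_cont delta_ell2) auto
  have bot: "(?F \<longlongrightarrow> 0) at_bot"
    by (rule tendsto_eq_rhs[OF tendsto_mult[OF tendsto_const tendsto_sum[OF F_at_bot[OF delta_ell2]]]]) auto
  have top: "(?F \<longlongrightarrow> (1 / real N) * (\<Sum>n=1..N. (ell2_norm (delta n))\<^sup>2)) at_top"
    by (intro tendsto_mult tendsto_const tendsto_sum F_at_top delta_ell2) auto
  show fin: "finite_borel_measure (nu_avg E N)"
    unfolding nu by (rule finite_borel_measure_interval_measure[OF mono rc bot top])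
      (auto intro!: divide_nonneg_nonneg sum_nonneg)
  have cdf: "cdf (nu_avg E N) = ?F" unfolding nu by (rule cdf_interval_measure[OF mono rc bot])
  assume z: "Im z > 0"
  have "(\<integral>t. 1 / (of_real t - z) \<partial>nu_avg E N) = (\<integral>s. of_real (?F s) / (of_real s - z)\<^sup>2 \<partial>lborel)"
    unfolding stieltjes_cdf_integral[OF fin z] cdf ..
  also have "\<dots> = (\<integral>s. (1 / of_nat N) * (\<Sum>n=1..N. of_real (F (delta n) s) / (of_real s - z)\<^sup>2) \<partial>lborel)"
    by (intro Bochner_Integration.integral_cong) (simp_all add: sum_divide_distrib mult.commute)
  also have "\<dots> = (1 / of_nat N) * (\<Sum>n=1..N. (\<integral>s. of_real (F (delta n) s) / (of_real s - z)\<^sup>2 \<partial>lborel))"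
    unfolding integral_mult_right_zero
    by (subst Bochner_Integration.integral_sum) (use green_spectral(2)[OF E z] in \<open>auto simp: F_def\<close>)
  also have "\<dots> = g_avg a b N z"
    unfolding g_avg_def by (intro arg_cong2[of _ _ _ _ "(*)"] sum.cong refl) (simp add: green_spectral(1)[OF E z] F_def)
  finally show "g_avg a b N z = (\<integral>t. 1 / (of_real t - z) \<partial>nu_avg E N)" ..
qed

text \<open>
  Integrals are easier to compute for a density than for a scaled measure.
\<close>

lemma k_avg_eq_density:
  "k_avg a b N = density (distr (count_space (truncation_eigenvalues a b N)) borel (\<lambda>x. x)) (\<lambda>_. ennreal (1 / real N))"
  unfolding k_avg_def by (rule measure_eqI) (auto simp: emeasure_density_const)

lemma k_avg_integral:
  fixes f :: "real \<Rightarrow> 'b :: {banach, second_countable_topology}"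
  assumes [measurable]: "f \<in> borel_measurable borel"
  shows "integrable (k_avg a b N) f"
    and "(\<integral>x. f x \<partial>k_avg a b N) = (1 / real N) *\<^sub>R (\<Sum>x\<in>truncation_eigenvalues a b N. f x)"
proof -
  have "integrable (distr (count_space (truncation_eigenvalues a b N)) borel (\<lambda>x. x)) (\<lambda>x. (1 / real N) *\<^sub>R f x)"
    by (subst integrable_distr_eq) (auto intro!: integrable_count_space finite_eigenvalues)
  then show "integrable (k_avg a b N) f"
    unfolding k_avg_eq_density by (subst integrable_density) auto
  have "(\<integral>x. f x \<partial>k_avg a b N) = (\<integral>x. (1 / real N) *\<^sub>R f x \<partial>distr (count_space (truncation_eigenvalues a b N)) borel (\<lambda>x. x))"
    unfolding k_avg_eq_density by (subst integral_density) auto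
  also have "\<dots> = (\<integral>x. (1 / real N) *\<^sub>R f x \<partial>count_space (truncation_eigenvalues a b N))"
    by (subst integral_distr) auto
  also have "\<dots> = (1 / real N) *\<^sub>R (\<Sum>x\<in>truncation_eigenvalues a b N. f x)"
    by (simp add: lebesgue_integral_count_space_finite finite_eigenvalues scaleR_sum_right)
  finally show "(\<integral>x. f x \<partial>k_avg a b N) = (1 / real N) *\<^sub>R (\<Sum>x\<in>truncation_eigenvalues a b N. f x)" .
qed

lemma k_avg_stieltjes:
  assumes z: "Im z > 0" and N: "N \<ge> 1"
  shows "(\<integral>t. 1 / (of_real t - z) \<partial>k_avg a b N) = - (df_minus (N + 1) z / f_minus a b (N + 1) z) / of_nat N"
proof -
  let ?S = "truncation_eigenvalues a b N"
  have "(\<integral>t. 1 / (of_real t - z) \<partial>k_avg a b N) = (1 / real N) *\<^sub>R (\<Sum>x\<in>?S. 1 / (of_real x - z))"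
    by (rule k_avg_integral) measurable
  also have "(\<Sum>x\<in>?S. 1 / (of_real x - z)) = - (\<Sum>x\<in>?S. 1 / (z - of_real x))"
    unfolding sum_negf[symmetric] by (intro sum.cong refl) (simp add: minus_divide_right)
  finally show ?thesis unfolding log_derivative_f_minus[OF z N] by (simp add: scaleR_conv_of_real)
qed

text \<open>
  This is the form in which the bound on the eigenvalues enters \<open>weak_star_support\<close>.
\<close>

lemma k_avg_supported:
  fixes f :: "real \<Rightarrow> real"
  assumes "\<And>t. \<bar>t\<bar> \<le> 3 * M + 2 \<Longrightarrow> f t = 0"
  shows "(\<integral>t. f t \<partial>k_avg a b N) = 0"
proof (cases "f \<in> borel_measurable borel")
  case True
  have "(\<Sum>x\<in>truncation_eigenvalues a b N. f x) = 0"
    using assms eigenvalue_bound by (intro sum.neutral) auto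
  then show ?thesis using k_avg_integral(2)[OF True, of N] by simp
next
  \<comment> \<open>The integral of a function that is not measurable is 0 by convention.\<close>
  case False
  then have "\<not> integrable (k_avg a b N) f"
    by (auto simp: k_avg_eq_density dest: borel_measurable_integrable)
  then show ?thesis by (rule not_integrable_integral_eq)
qed

section \<open>Limits of the averages\<close>

lemma f_plus_bounded:
  assumes z: "Im z > 0"
  obtains B where "B > 0" "\<And>n. cmod (f_plus a b n z) \<le> B"
proof -
  have "(\<lambda>n. (cmod (f_plus a b n z))\<^sup>2) \<longlonglongrightarrow> 0"
    by (rule summable_LIMSEQ_zero[OF f_plus_square_summable[OF z]])
  then have "Bseq (\<lambda>n. (cmod (f_plus a b n z))\<^sup>2)" by (intro convergent_imp_Bseq convergentI)
  then obtain K where K: "K > 0" "\<And>n. norm ((cmod (f_plus a b n z))\<^sup>2) \<le> K" by (auto elim: BseqE)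
  have "cmod (f_plus a b n z) \<le> sqrt K" for n using K(2)[of n] by (simp add: real_le_rsqrt)
  then show ?thesis using K(1) by (intro that[of "sqrt K"]) auto
qed

text \<open>
  The real parts of the logarithms telescope.
\<close>

lemma Re_w_plus_avg:
  assumes z: "Im z > 0"
  shows "Re (w_plus_avg a b N z) = (ln (cmod (f_plus a b (N + 1) z)) - ln (cmod (f_plus a b 1 z))) / real N"
proof -
  have "Re (\<Sum>n=1..N. Ln (of_real (a n) * m_plus a b n z))
      = (\<Sum>n=1..N. ln (cmod (f_plus a b (n + 1) z)) - ln (cmod (f_plus a b n z)))"
  proof (subst Re_sum, intro sum.cong refl)
    fix n
    have nz: "f_plus a b n z \<noteq> 0" "f_plus a b (n + 1) z \<noteq> 0" using f_plus_nonzero[OF z] by auto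
    then show "Re (Ln (of_real (a n) * m_plus a b n z)) = ln (cmod (f_plus a b (n + 1) z)) - ln (cmod (f_plus a b n z))"
      unfolding a_m_plus by (subst Re_Ln) (auto simp: norm_divide ln_div)
  qed
  also have "\<dots> = ln (cmod (f_plus a b (N + 1) z)) - ln (cmod (f_plus a b 1 z))"
    by (induction N) auto
  finally show ?thesis by (simp add: w_plus_avg_def Re_divide_of_nat)
qed

text \<open>
  Square summable solutions are bounded, so their exponential growth rate is at most 0.
\<close>

lemma w_plus_limit_Re_nonpos:
  assumes N: "filterlim N at_top sequentially"
    and conv: "locally_uniform_conv (\<lambda>j. w_plus_avg a b (N j)) w" and z: "Im z > 0"
  shows "Re (w z) \<le> 0"
proof -
  obtain B where B: "B > 0" "\<And>n. cmod (f_plus a b n z) \<le> B" using f_plus_bounded[OF z] by metis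
  let ?c = "ln B - ln (cmod (f_plus a b 1 z))"
  have Nr: "filterlim (\<lambda>j. real (N j)) at_top sequentially"
    by (rule filterlim_compose[OF filterlim_real_sequentially N])
  show ?thesis
  proof (rule tendsto_le)
    show "(\<lambda>j. Re (w_plus_avg a b (N j) z)) \<longlonglongrightarrow> Re (w z)"
      by (intro tendsto_Re locally_uniform_conv_pointwise[OF conv z])
    show "(\<lambda>j. ?c / real (N j)) \<longlonglongrightarrow> 0"
      by (intro real_tendsto_divide_at_top[OF tendsto_const] Nr)
    have "Re (w_plus_avg a b (N j) z) \<le> ?c / real (N j)" for j
      unfolding Re_w_plus_avg[OF z]
      using B f_plus_nonzero[OF z] by (intro divide_right_mono diff_right_mono) auto
    then show "\<forall>\<^sub>F j in sequentially. Re (w_plus_avg a b (N j) z) \<le> ?c / real (N j)" by simp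
  qed simp
qed

lemma w_sum_limit:
  assumes N: "filterlim N at_top sequentially"
    and plus: "locally_uniform_conv (\<lambda>j. w_plus_avg a b (N j)) w_plus"
    and minus: "locally_uniform_conv (\<lambda>j. w_minus_avg a b (N j)) w_minus" and z: "Im z > 0"
  shows "w_plus z + w_minus z = \<i> * of_real pi"
proof -
  obtain B where B: "\<And>n. n \<ge> 1 \<Longrightarrow> cmod (Ln (green a b n z)) \<le> B" using Ln_green_bound[OF z] by blast
  have Nr: "filterlim (\<lambda>j. real (N j)) at_top sequentially"
    by (rule filterlim_compose[OF filterlim_real_sequentially N])
  have ev: "\<forall>\<^sub>F j in sequentially. N j \<ge> 1" using N by (auto simp: filterlim_at_top)
  have "(\<lambda>j. w_plus_avg a b (N j) z + w_minus_avg a b (N j) z - \<i> * of_real pi) \<longlonglongrightarrow> 0"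
  proof (rule Lim_null_comparison)
    show "(\<lambda>j. (2 * B) / real (N j)) \<longlonglongrightarrow> 0"
      by (intro real_tendsto_divide_at_top[OF tendsto_const] Nr)
    show "\<forall>\<^sub>F j in sequentially. norm (w_plus_avg a b (N j) z + w_minus_avg a b (N j) z - \<i> * of_real pi)
        \<le> (2 * B) / real (N j)"
      using ev
    proof eventually_elim
      case (elim j)
      have "cmod (Ln (green a b (N j + 1) z) - Ln (green a b 1 z)) \<le> 2 * B"
        using norm_triangle_ineq4[of "Ln (green a b (N j + 1) z)" "Ln (green a b 1 z)"]
          B[of "N j + 1"] B[of 1] by simp
      then show ?case unfolding w_avg_sum[OF z elim] by (simp add: norm_divide divide_right_mono)
    qed
  qed
  then have "(\<lambda>j. w_plus_avg a b (N j) z + w_minus_avg a b (N j) z) \<longlonglongrightarrow> \<i> * of_real pi"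
    by (simp add: LIM_zero_iff)
  moreover have "(\<lambda>j. w_plus_avg a b (N j) z + w_minus_avg a b (N j) z) \<longlonglongrightarrow> w_plus z + w_minus z"
    by (intro tendsto_add locally_uniform_conv_pointwise[OF plus z] locally_uniform_conv_pointwise[OF minus z])
  ultimately show ?thesis using LIMSEQ_unique by blast
qed

lemma g_avg_k_avg_difference:
  assumes N: "filterlim N at_top sequentially" and z: "Im z > 0"
  shows "(\<lambda>j. g_avg a b (N j) z + (df_minus (N j + 1) z / f_minus a b (N j + 1) z) / of_nat (N j)) \<longlonglongrightarrow> 0"
proof (rule Lim_null_comparison)
  have Nr: "filterlim (\<lambda>j. real (N j)) at_top sequentially"
    by (rule filterlim_compose[OF filterlim_real_sequentially N])
  have ev: "\<forall>\<^sub>F j in sequentially. N j \<ge> 1" using N by (auto simp: filterlim_at_top)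
  let ?B = "(M + 1)\<^sup>2 / (Im z) ^ 3"
  show "(\<lambda>j. ?B / real (N j)) \<longlonglongrightarrow> 0"
    by (intro real_tendsto_divide_at_top[OF tendsto_const] Nr)
  show "\<forall>\<^sub>F j in sequentially. norm (g_avg a b (N j) z + (df_minus (N j + 1) z / f_minus a b (N j + 1) z) / of_nat (N j))
      \<le> ?B / real (N j)"
    using ev
  proof eventually_elim
    case (elim j)
    have eq: "g_avg a b (N j) z + (df_minus (N j + 1) z / f_minus a b (N j + 1) z) / of_nat (N j)
      = ((\<Sum>n=1..N j. green a b n z) + df_minus (N j + 1) z / f_minus a b (N j + 1) z) / of_nat (N j)"
      by (simp add: g_avg_def add_divide_distrib)
    show ?case
      unfolding eq norm_divide norm_of_nat
      by (rule divide_right_mono[OF green_sum_log_derivative[OF z elim]]) simp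
  qed
qed

end

section \<open>The limits for a bounded Jacobi matrix\<close>

theorem theorem3p2:
  fixes a b :: "nat \<Rightarrow> real"
    and E :: "real \<Rightarrow> (nat \<Rightarrow> complex) \<Rightarrow> (nat \<Rightarrow> complex)"
    and N :: "nat \<Rightarrow> nat"
    and w_plus w_minus g :: "complex \<Rightarrow> complex"
    and \<nu> k_tilde :: "real measure"
    and A :: real
    and \<gamma> k :: "complex \<Rightarrow> real"
  assumes "jacobi_coefficients a b"
    and "spectral_resolution (jacobi_op a b) E"
    and "filterlim N at_top sequentially"
    and "herglotz w_plus" and "herglotz w_minus" and "herglotz g"
    and "locally_uniform_conv (\<lambda>j. w_plus_avg a b (N j)) w_plus"
    and "locally_uniform_conv (\<lambda>j. w_minus_avg a b (N j)) w_minus"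
    and "locally_uniform_conv (\<lambda>j. g_avg a b (N j)) g"
    and "real_distribution \<nu>" and "real_distribution k_tilde"
    and "weak_star_conv (\<lambda>j. nu_avg E (N j)) \<nu>"
    and "weak_star_conv (\<lambda>j. k_avg a b (N j)) k_tilde"
    and "A > 0"
    and "(\<lambda>j. (\<Prod>n=1..N j. a n) powr (1 / real (N j))) \<longlonglongrightarrow> A"
    and "\<And>z. z \<in> upper_half_plane \<Longrightarrow>
           w_plus z = - of_real (\<gamma> z) + \<i> * of_real pi * of_real (k z)"
  shows "\<exists>k_bd :: real \<Rightarrow> real.
    (\<forall>t. ((\<lambda>y. k (Complex t y)) \<longlongrightarrow> k_bd t) (at_right 0)) \<and>
    mono k_bd \<and>
    herglotz (\<lambda>z. - \<i> * w_plus z) \<and>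
    herglotz (deriv w_plus) \<and>
    (\<forall>z\<in>upper_half_plane. w_plus z + w_minus z = \<i> * of_real pi) \<and>
    (\<forall>z\<in>upper_half_plane. g z = deriv w_plus z) \<and>
    k_tilde = \<nu> \<and>
    \<nu> = stieltjes_measure k_bd \<and>
    (\<forall>z\<in>upper_half_plane.
       integrable (stieltjes_measure k_bd) (\<lambda>t. 1 / (of_real t - z)) \<and>
       g z = (\<integral>t. 1 / (of_real t - z) \<partial>stieltjes_measure k_bd)) \<and>
    (\<forall>z\<in>upper_half_plane.
       integrable (stieltjes_measure k_bd) (\<lambda>t. Ln (of_real t - z)) \<and>
       w_plus z = of_real (ln A) - (\<integral>t. Ln (of_real t - z) \<partial>stieltjes_measure k_bd))"
proof -
  note E = assms(2) and N = assms(3) and conv_plus = assms(7) and conv_minus = assms(8)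
    and conv_g = assms(9) and \<nu> = assms(10) and kt = assms(11) and weak_\<nu> = assms(12)
    and weak_k = assms(13) and A = assms(14) and geo = assms(15) and w_k = assms(16)
  from assms(1) obtain M where M: "jacobi a b M"
    by (auto simp: jacobi_coefficients_def jacobi_def)
  interpret jacobi a b M by (fact M)
  interpret kt: real_distribution k_tilde by (fact kt)
  have ev: "\<forall>\<^sub>F j in sequentially. N j \<ge> 1" using N by (auto simp: filterlim_at_top)
  let ?L = "\<lambda>N z. df_minus (N + 1) z / f_minus a b (N + 1) z / of_nat N"

  \<comment> \<open>The three limits \<open>w_plus\<close>, \<open>w_minus\<close>, \<open>g\<close> determine each other.\<close>
  have sum: "w_plus z + w_minus z = \<i> * of_real pi" if "Im z > 0" for z
    by (rule w_sum_limit[OF N conv_plus conv_minus that])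

  have g_lim: "(\<lambda>j. g_avg a b (N j) z) \<longlonglongrightarrow> g z" if "Im z > 0" for z
    by (rule locally_uniform_conv_pointwise[OF conv_g that])
  have L_lim: "(\<lambda>j. ?L (N j) z) \<longlonglongrightarrow> - g z" if "Im z > 0" for z
    using tendsto_diff[OF g_avg_k_avg_difference[OF N that] g_lim[OF that]] by simp

  have w_minus_deriv: "(w_minus has_field_derivative - g z) (at z)" if z: "Im z > 0" for z
  proof -
    obtain d where d: "(w_minus has_field_derivative d) (at z)" "(\<lambda>j. ?L (N j) z) \<longlonglongrightarrow> d"
      using locally_uniform_conv_derivative[OF conv_minus w_minus_avg_derivative z] by blast
    then show ?thesis using LIMSEQ_unique[OF d(2) L_lim[OF z]] by simp
  qed
  have w_plus_deriv: "(w_plus has_field_derivative g z) (at z)" if z: "Im z > 0" for z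
  proof (rule has_field_derivative_transform_within_open[OF _ open_upper_half_plane])
    show "((\<lambda>z. \<i> * of_real pi - w_minus z) has_field_derivative g z) (at z)"
      using w_minus_deriv[OF z] by (auto intro!: derivative_eq_intros)
    show "z \<in> upper_half_plane" using z by (simp add: upper_half_plane_def)
    show "\<i> * of_real pi - w_minus z = w_plus z" if "z \<in> upper_half_plane" for z
      using sum[of z] that by (simp add: upper_half_plane_def algebra_simps)
  qed
  have deriv_eq: "deriv w_plus z = g z" if "Im z > 0" for z
    by (rule DERIV_imp_deriv[OF w_plus_deriv[OF that]])
  have g_pos: "Im (g z) > 0" if "Im z > 0" for z
    using assms(6) that by (auto simp: herglotz_def upper_half_plane_def)

  \<comment> \<open>Both limit measures have the Stieltjes transform \<open>g\<close>, so they coincide.\<close>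
  have g_\<nu>: "g z = (\<integral>t. 1 / (of_real t - z) \<partial>\<nu>)" if z: "Im z > 0" for z
  proof -
    have "(\<lambda>j. g_avg a b (N j) z) \<longlonglongrightarrow> (\<integral>t. 1 / (of_real t - z) \<partial>\<nu>)"
      unfolding nu_avg_stieltjes(2)[OF E z]
      by (intro weak_star_stieltjes_limit[OF weak_\<nu> z] nu_avg_stieltjes(1)[OF E]
          real_distribution.finite_borel_measure_M \<nu>)
    then show ?thesis using LIMSEQ_unique[OF g_lim[OF z]] by blast
  qed
  have g_k: "g z = (\<integral>t. 1 / (of_real t - z) \<partial>k_tilde)" if z: "Im z > 0" for z
  proof -
    have "(\<lambda>j. \<integral>t. 1 / (of_real t - z) \<partial>k_avg a b (N j)) \<longlonglongrightarrow> (\<integral>t. 1 / (of_real t - z) \<partial>k_tilde)"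
    proof (rule weak_star_conv_complex[OF weak_k _ stieltjes_kernel_vanishes])
      have "complex_of_real t - z \<noteq> 0" for t using z by (intro of_real_minus_nonzero) simp
      then show "continuous_on UNIV (\<lambda>t. 1 / (complex_of_real t - z))" by (intro continuous_intros) auto
      show "integrable (k_avg a b (N j)) (\<lambda>t. 1 / (complex_of_real t - z))" for j
        by (intro k_avg_integral(1)) measurable
      show "integrable k_tilde (\<lambda>t. 1 / (complex_of_real t - z))"
        by (rule stieltjes_integrable[OF kt.finite_borel_measure_M z])
    qed
    moreover have "\<forall>\<^sub>F j in sequentially. (\<integral>t. 1 / (of_real t - z) \<partial>k_avg a b (N j)) = - ?L (N j) z"
      using ev by eventually_elim (simp add: k_avg_stieltjes[OF z])
    ultimately have "(\<lambda>j. - ?L (N j) z) \<longlonglongrightarrow> (\<integral>t. 1 / (of_real t - z) \<partial>k_tilde)"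
      using Lim_transform_eventually by fast
    moreover have "(\<lambda>j. - ?L (N j) z) \<longlonglongrightarrow> - (- g z)" by (intro tendsto_minus L_lim z)
    ultimately show ?thesis using LIMSEQ_unique by fastforce
  qed
  have k_\<nu>: "k_tilde = \<nu>"
    by (rule stieltjes_transform_unique[OF kt \<nu>]) (use g_\<nu> g_k in metis)

  \<comment> \<open>The logarithmic potential is unbounded, but all eigenvalues lie in one compact interval, so the
    weak-star limit applies to it.\<close>
  have log_int: "integrable k_tilde (\<lambda>t. Ln (z - of_real t))"
    and w_minus_eq: "w_minus z = (\<integral>t. Ln (z - of_real t) \<partial>k_tilde) - of_real (ln A)" if z: "Im z > 0" for z
  proof -
    have cont: "continuous_on UNIV (\<lambda>t. Ln (z - of_real t))"
      using z by (intro continuous_intros) (auto simp: complex_nonpos_Reals_iff)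
    then have meas: "(\<lambda>t. Ln (z - of_real t)) \<in> borel_measurable borel" by (rule borel_measurable_continuous_onI)
    have supp_eq: "(\<integral>t. f t \<partial>k_avg a b (N j)) = (\<integral>t. f' t \<partial>k_avg a b (N j))"
      if "f \<in> borel_measurable borel" "f' \<in> borel_measurable borel" "\<And>t. \<bar>t\<bar> \<le> 3 * M + 2 \<Longrightarrow> f t = f' t"
      for j and f f' :: "real \<Rightarrow> complex"
    proof -
      have "(\<Sum>x\<in>truncation_eigenvalues a b (N j). f x) = (\<Sum>x\<in>truncation_eigenvalues a b (N j). f' x)"
        using that(3) eigenvalue_bound by (intro sum.cong) auto
      then show ?thesis unfolding k_avg_integral(2)[OF that(1)] k_avg_integral(2)[OF that(2)] by simp
    qed
    note lim = weak_star_compact_support_limit[OF weak_k kt k_avg_supported k_avg_integral(1) supp_eq cont]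
    show "integrable k_tilde (\<lambda>t. Ln (z - of_real t))" by (rule lim(1))
    have 1: "(\<lambda>j. \<integral>t. Ln (z - of_real t) \<partial>k_avg a b (N j)) \<longlonglongrightarrow> (\<integral>t. Ln (z - of_real t) \<partial>k_tilde)"
      by (rule lim(2))
    have 2: "(\<lambda>j. complex_of_real (ln ((\<Prod>n=1..N j. a n) powr (1 / real (N j))))) \<longlonglongrightarrow> of_real (ln A)"
      using A by (intro tendsto_of_real tendsto_ln geo) simp
    have "\<forall>\<^sub>F j in sequentially. (\<integral>t. Ln (z - of_real t) \<partial>k_avg a b (N j))
        - of_real (ln ((\<Prod>n=1..N j. a n) powr (1 / real (N j)))) = w_minus_avg a b (N j) z"
      using ev
    proof eventually_elim
      case (elim j)
      have "(\<Prod>n=1..N j. a n) > 0" by (intro prod_pos) (simp add: a_pos)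
      then have "ln ((\<Prod>n=1..N j. a n) powr (1 / real (N j))) = ln (\<Prod>n=1..N j. a n) / real (N j)"
        by (simp add: ln_powr)
      then show ?case
        unfolding w_minus_avg_eq[OF z elim] k_avg_integral(2)[OF meas]
        by (simp add: scaleR_conv_of_real diff_divide_distrib)
    qed
    from Lim_transform_eventually[OF tendsto_diff[OF 1 2] this]
    show "w_minus z = (\<integral>t. Ln (z - of_real t) \<partial>k_tilde) - of_real (ln A)"
      using LIMSEQ_unique[OF locally_uniform_conv_pointwise[OF conv_minus z]] by blast
  qed
  have Ln_int: "integrable k_tilde (\<lambda>t. Ln (of_real t - z))"
    and w_plus_eq: "w_plus z = of_real (ln A) - (\<integral>t. Ln (of_real t - z) \<partial>k_tilde)" if z: "Im z > 0" for z
  proof -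
    show "integrable k_tilde (\<lambda>t. Ln (of_real t - z))"
      unfolding Ln_lower_arg[OF z] using log_int[OF z] by simp
    have "(\<integral>t. Ln (of_real t - z) \<partial>k_tilde) = (\<integral>t. Ln (z - of_real t) \<partial>k_tilde) - \<i> * of_real pi"
      unfolding Ln_lower_arg[OF z] using log_int[OF z] kt.prob_space by simp
    moreover have "w_plus z = \<i> * of_real pi - w_minus z" using sum[OF z] by (simp add: eq_diff_eq)
    ultimately show "w_plus z = of_real (ln A) - (\<integral>t. Ln (of_real t - z) \<partial>k_tilde)"
      unfolding w_minus_eq[OF z] by simp
  qed

  \<comment> \<open>The boundary value at \<open>t\<close> counts an atom at \<open>t\<close> with weight one half.\<close>
  have k_lim: "((\<lambda>y. k (Complex t y)) \<longlongrightarrow> sym_cdf k_tilde t) (at_right 0)" for t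
  proof -
    have k_eq: "k z = - (\<integral>t. Im (Ln (of_real t - z)) \<partial>k_tilde) / pi" if z: "Im z > 0" for z
    proof -
      have "pi * k z = Im (w_plus z)" using w_k[of z] z by (simp add: upper_half_plane_def)
      also have "\<dots> = - (\<integral>t. Im (Ln (of_real t - z)) \<partial>k_tilde)"
        unfolding w_plus_eq[OF z] using Ln_int[OF z] by simp
      finally show ?thesis by (simp add: field_simps)
    qed
    have "((\<lambda>y. - (\<integral>s. Im (Ln (of_real s - Complex t y)) \<partial>k_tilde) / pi) \<longlongrightarrow> - (- pi * sym_cdf k_tilde t) / pi) (at_right 0)"
      by (intro tendsto_intros arg_integral_boundary_value kt) simp
    moreover have "\<forall>\<^sub>F y in at_right 0. - (\<integral>s. Im (Ln (of_real s - Complex t y)) \<partial>k_tilde) / pi = k (Complex t y)"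
      using eventually_at_right_less[of 0] by eventually_elim (simp add: k_eq)
    ultimately have "((\<lambda>y. k (Complex t y)) \<longlongrightarrow> - (- pi * sym_cdf k_tilde t) / pi) (at_right 0)"
      using Lim_transform_eventually by fast
    then show ?thesis by simp
  qed

  \<comment> \<open>The Lyapunov exponent \<open>- Re w_plus\<close> is positive, because the solutions \<open>f_plus\<close> are bounded.\<close>
  have Re_neg: "Re (w_plus z) < 0" if "Im z > 0" for z
    by (rule Re_negative_of_nonpositive[OF w_plus_deriv _ w_plus_limit_Re_nonpos[OF N conv_plus] that])
      (use g_pos in force)+
  have H1: "herglotz (\<lambda>z. - \<i> * w_plus z)"
    using assms(4) Re_neg unfolding herglotz_def
    by (auto intro!: holomorphic_intros simp: upper_half_plane_def)
  have H2: "herglotz (deriv w_plus)"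
  proof -
    have "deriv w_plus holomorphic_on upper_half_plane \<longleftrightarrow> g holomorphic_on upper_half_plane"
      by (intro holomorphic_cong) (auto simp: deriv_eq upper_half_plane_def)
    then show ?thesis using assms(6) deriv_eq unfolding herglotz_def by (auto simp: upper_half_plane_def)
  qed
  have st: "stieltjes_measure (sym_cdf k_tilde) = k_tilde" by (rule stieltjes_measure_sym_cdf[OF kt])
  show ?thesis
  proof (intro exI[of _ "sym_cdf k_tilde"] conjI allI ballI)
    show "mono (sym_cdf k_tilde)" by (rule mono_sym_cdf[OF kt])
    show "\<nu> = stieltjes_measure (sym_cdf k_tilde)" using st k_\<nu> by simp
    fix z assume "z \<in> upper_half_plane"
    then have z: "Im z > 0" by (simp add: upper_half_plane_def)
    show "w_plus z + w_minus z = \<i> * of_real pi" by (rule sum[OF z])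
    show "g z = deriv w_plus z" using deriv_eq[OF z] by simp
    show "integrable (stieltjes_measure (sym_cdf k_tilde)) (\<lambda>t. 1 / (of_real t - z))"
      unfolding st by (rule stieltjes_integrable[OF kt.finite_borel_measure_M z])
    show "g z = (\<integral>t. 1 / (of_real t - z) \<partial>stieltjes_measure (sym_cdf k_tilde))"
      unfolding st by (rule g_k[OF z])
    show "integrable (stieltjes_measure (sym_cdf k_tilde)) (\<lambda>t. Ln (of_real t - z))"
      unfolding st by (rule Ln_int[OF z])
    show "w_plus z = of_real (ln A) - (\<integral>t. Ln (of_real t - z) \<partial>stieltjes_measure (sym_cdf k_tilde))"
      unfolding st by (rule w_plus_eq[OF z])
  qed (fact k_lim H1 H2 k_\<nu>)+
qed

end
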